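(* Let $E$ be an infinite subset of $\Gamma$ and $h>0$. The following four properties define the same closed subspace $SB(E,h)$ of $L^2(B(E)\times B(E),\mu^\Phi_{E,h})$: (i) $SB(E,h)$ is the closure in $L^2(B(E)\times B(E),\mu^\Phi_{E,h})$ of the subspace of functions in this space depending only on a finite number of variables and which are antiholomorphic when $B(E)\times B(E)$ is identified with the complexification of $B(E)$ (through $(x,\xi)\mapsto x+i\xi$); (ii) $SB(E,h)$ is the closure in $L^2(B(E)\times B(E),\mu^\Phi_{E,h})$ of the subspace spanned by the functions $Q_{\alpha,h}$, $S(\alpha)\subseteq E$; (iii) $SB(E,h)$ is the range of the Fock space $\mathcal{H}(E)$ by the mapping $J^\Phi_{Eh}\circ W_E$; (iv) $SB(E,h)$ is the range of the space $L^2(B(E),\mu^K_{E,h})$ by the mapping $\theta_{Eh}$.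
   Context: **Spaces and measures.** $\Gamma$ is a countable set and $(b_j)_{j\in\Gamma}$ a fixed family of positive reals such that $\sum_{j\in\Gamma}\int_{\epsilon b_j}^{+\infty}e^{-x^2/2}dx<\infty$ for every $\epsilon>0$. For $E\subseteq\Gamma$, $B(E)$ is the Banach space of real families $x=(x_j)_{j\in E}$ with $|x_j|/b_j\to0$ as $j\to\infty$ in $E$ (so $B(E)=\mathbb{R}^E$ if $E$ is finite), with norm $\sup_{j\in E}|x_j|/b_j$. For $t>0$, $\mu_{t,B(E)}$ is the Borel probability measure on $B(E)$ such that for all $f_1,\dots,f_n\in B(E)'\subset\ell^2(E,\mathbb{R})$ orthonormal in $\ell^2(E,\mathbb R)$, its image under $(f_1,\dots,f_n)$ is $(2\pi t)^{-n/2}e^{-|x|^2/2t}dx$ on $\mathbb{R}^n$. For $h>0$, $\mu^K_{E,h}=\mu_{h/2,B(E)}$ on $B(E)$ and $\mu^\Phi_{E,h}=\mu_{h,B(E)}\otimes\mu_{h,B(E)}$ on $B(E)\times B(E)$. For $a\in\ell^2(E,\mathbb{C})$, $\ell_a$ is the a.e. defined function on $B(E)$ which is the $L^2$-limit (for either Gaussian measure) of $\sum_{j\in F_n}a_jx_j$, $F_n$ finite increasing with union $E$. **Fock spaces.** For a separable complex Hilbert space $Z$, $\mathcal{F}_s(Z)$ is the symmetric Fock space, the Hilbert direct sum over $n\ge0$ of the symmetric subspaces $Z^{\odot n}$ of $Z^{\otimes n}$ ($Z^{\odot0}=\mathbb{C}\Omega$); $u_1\odot\cdots\odot u_n=(n!)^{-1/2}\sum_{\sigma\in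 S_n}u_{\sigma(1)}\otimes\cdots\otimes u_{\sigma(n)}$. $\mathcal{H}(E)=\mathcal{F}_s(\ell^2(E,\mathbb{C}))$ with vacuum $\Omega_K(E)$, $\mathcal{H}_\Phi(E)=\mathcal{F}_s(\ell^2(E,\mathbb{C})^2)$ with vacuum $\Omega_\Phi(E)$. **Segal isomorphisms.** $J^K_{Eh}:\mathcal{H}(E)\to L^2(B(E),\mu^K_{E,h})$ is the unitary isomorphism with $J^K_{Eh}\Omega_K(E)=1$, $J^K_{Eh}u=\sqrt{2/h}\,\ell_u$ for $u\in\ell^2(E,\mathbb{C})$, and $J^K_{Eh}(u_1\odot\cdots\odot u_n)=\Pi_n(J^K_{Eh}(u_1)\cdots J^K_{Eh}(u_n))$, where $P_n$ is the span of constants and of products of at most $n$ functions $\ell_v$, and $\Pi_n$ is the orthogonal projection of $\overline{P_n}$ onto the orthogonal complement of $\overline{P_{n-1}}$ in $\overline{P_n}$. $J^\Phi_{Eh}:\mathcal{H}_\Phi(E)\to L^2(B(E)\times B(E),\mu^\Phi_{E,h})$ is the unitary isomorphism defined in the same way, with $J^\Phi_{Eh}\Omega_\Phi(E)=1$, $J^\Phi_{Eh}(u,v)(x,\xi)=h^{-1/2}(\ell_u(x)+\ell_v(\xi))$. **Segal–Bargmann transform.** $W_E:\mathcal{H}(E)\to\mathcal{H}_\Phi(E)$ is the isometry $W_E\Omega_K(E)=\Omega_\Phi(E)$, $W_E(u_1\odot\cdots\odot u_n)=Tu_1\odot\cdots\odot Tu_n$, with $Tu=2^{-1/2}(u,-iu)$.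 $\theta_{Eh}=J^\Phi_{Eh}\circ W_E\circ(J^K_{Eh})^{-1}$. **The functions $Q_{\alpha,h}$.** For a multi-index $\alpha$ (map $\Gamma\to\mathbb{N}$ vanishing outside a finite set), $S(\alpha)=\{j:\alpha_j\ge1\}$, $|\alpha|=\sum_j\alpha_j$ and $Q_{\alpha,h}(x,\xi)=(2h)^{-|\alpha|/2}\prod_{j\in S(\alpha)}(x_j-i\xi_j)^{\alpha_j}$. *)

theory Defs
  imports "HOL-Probability.Probability" "HOL-Combinatorics.Permutations"
begin

section \<open>The Banach spaces \<open>B(E)\<close> and their Gaussian measures\<close>

text \<open>
  A family indexed by \<open>E\<close> is a function on the ambient index type that vanishes outside \<open>E\<close>, so that
  the vector space operations are the pointwise ones. That \<open>\<bar>x j\<bar> / b j\<close> tends to \<open>0\<close> as \<open>j\<close> tends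
  to infinity in \<open>E\<close> is meant along the cofinite filter of \<open>E\<close>.
\<close>

definition B_space :: "('g \<Rightarrow> real) \<Rightarrow> 'g set \<Rightarrow> ('g \<Rightarrow> real) set" where
  "B_space b E = {x. (\<forall>j. j \<notin> E \<longrightarrow> x j = 0) \<and> (\<forall>\<epsilon>>0. finite {j \<in> E. \<epsilon> \<le> \<bar>x j\<bar> / b j})}"

definition B_norm :: "('g \<Rightarrow> real) \<Rightarrow> 'g set \<Rightarrow> ('g \<Rightarrow> real) \<Rightarrow> real" where
  "B_norm b E x = (SUP j\<in>E. \<bar>x j\<bar> / b j)"

definition B_topology :: "('g \<Rightarrow> real) \<Rightarrow> 'g set \<Rightarrow> ('g \<Rightarrow> real) topology" where
  "B_topology b E =
     Metric_space.mtopology (B_space b E) (\<lambda>x y. B_norm b E (\<lambda>j. x j - y j))"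

definition B_borel :: "('g \<Rightarrow> real) \<Rightarrow> 'g set \<Rightarrow> ('g \<Rightarrow> real) measure" where
  "B_borel b E = sigma (B_space b E) {U. openin (B_topology b E) U}"

definition B_dual :: "('g \<Rightarrow> real) \<Rightarrow> 'g set \<Rightarrow> (('g \<Rightarrow> real) \<Rightarrow> real) set" where
  "B_dual b E = {\<phi>.
     (\<forall>x\<in>B_space b E. \<forall>y\<in>B_space b E. \<phi> (\<lambda>j. x j + y j) = \<phi> x + \<phi> y) \<and>
     (\<forall>c. \<forall>x\<in>B_space b E. \<phi> (\<lambda>j. c * x j) = c * \<phi> x) \<and>
     (\<exists>C. \<forall>x\<in>B_space b E. \<bar>\<phi> x\<bar> \<le> C * B_norm b E x)}"

text \<open>
  The embedding of the dual of \<open>B(E)\<close> into \<open>\<ell>\<^sup>2(E,\<real>)\<close>: a functional is identified with the family of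
  its values on the unit vectors.
\<close>

definition dual_coeff :: "(('g \<Rightarrow> real) \<Rightarrow> real) \<Rightarrow> 'g \<Rightarrow> real" where
  "dual_coeff \<phi> j = \<phi> (\<lambda>i. if i = j then 1 else 0)"

text \<open>
  The Gaussian measure, the Segal isomorphisms and the Segal--Bargmann transform are characterized
  by properties that determine them uniquely (for functions valued in \<open>L\<^sup>2\<close>: up to almost everywhere
  equality); each is rendered by the predicate stating its characterization.
\<close>

definition is_gaussian_measure ::
  "('g \<Rightarrow> real) \<Rightarrow> 'g set \<Rightarrow> real \<Rightarrow> ('g \<Rightarrow> real) measure \<Rightarrow> bool" where
  "is_gaussian_measure b E t \<mu> \<longleftrightarrow>
     prob_space \<mu> \<and> sets \<mu> = sets (B_borel b E) \<and>
     (\<forall>(n::nat) f.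
        (\<forall>i<n. f i \<in> B_dual b E) \<and>
        (\<forall>i<n. \<forall>k<n.
           ((\<lambda>j. dual_coeff (f i) j * dual_coeff (f k) j) has_sum (if i = k then 1 else 0)) E)
        \<longrightarrow>
        distr \<mu> (\<Pi>\<^sub>M i\<in>{..<n}. lborel) (\<lambda>x. \<lambda>i\<in>{..<n}. f i x) =
        density (\<Pi>\<^sub>M i\<in>{..<n}. lborel)
          (\<lambda>y. ennreal ((2 * pi * t) powr (- real n / 2) * exp (- (\<Sum>i<n. (y i)\<^sup>2) / (2 * t)))))"


section \<open>Complex \<open>L\<^sup>2\<close> spaces\<close>

text \<open>
  Elements of \<open>L\<^sup>2\<close> are represented by square-integrable functions. A subspace of the quotient by
  almost everywhere equality is represented by the set of all representatives of its elements; the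
  closures and ranges below are saturated in this sense.
\<close>

definition L2 :: "'w measure \<Rightarrow> ('w \<Rightarrow> complex) set" where
  "L2 M = {f \<in> borel_measurable M. integrable M (\<lambda>w. (cmod (f w))\<^sup>2)}"

definition L2_norm :: "'w measure \<Rightarrow> ('w \<Rightarrow> complex) \<Rightarrow> real" where
  "L2_norm M f = sqrt (\<integral>w. (cmod (f w))\<^sup>2 \<partial>M)"

definition L2_inner :: "'w measure \<Rightarrow> ('w \<Rightarrow> complex) \<Rightarrow> ('w \<Rightarrow> complex) \<Rightarrow> complex" where
  "L2_inner M f g = (\<integral>w. f w * cnj (g w) \<partial>M)"

definition L2_closure :: "'w measure \<Rightarrow> ('w \<Rightarrow> complex) set \<Rightarrow> ('w \<Rightarrow> complex) set" where
  "L2_closure M S = {f \<in> L2 M. \<forall>\<epsilon>>0. \<exists>g\<in>S \<inter> L2 M. L2_norm M (\<lambda>w. f w - g w) < \<epsilon>}"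

definition L2_closed_subspace :: "'w measure \<Rightarrow> ('w \<Rightarrow> complex) set \<Rightarrow> bool" where
  "L2_closed_subspace M V \<longleftrightarrow>
     V \<subseteq> L2 M \<and> (\<lambda>w. 0) \<in> V \<and>
     (\<forall>f\<in>V. \<forall>g\<in>V. (\<lambda>w. f w + g w) \<in> V) \<and>
     (\<forall>c. \<forall>f\<in>V. (\<lambda>w. c * f w) \<in> V) \<and>
     L2_closure M V = V"

definition cspan :: "('w \<Rightarrow> complex) set \<Rightarrow> ('w \<Rightarrow> complex) set" where
  "cspan S = {f. \<exists>T c. finite T \<and> T \<subseteq> S \<and> f = (\<lambda>w. \<Sum>g\<in>T. c g * g w)}"


section \<open>Symmetric Fock spaces\<close>

definition ell2 :: "'x set \<Rightarrow> ('x \<Rightarrow> complex) set" where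
  "ell2 X = {u. (\<forall>j. j \<notin> X \<longrightarrow> u j = 0) \<and> (\<lambda>j. (cmod (u j))\<^sup>2) summable_on X}"

definition ell2_norm :: "('x \<Rightarrow> complex) \<Rightarrow> real" where
  "ell2_norm u = sqrt (\<Sum>\<^sub>\<infinity>j. (cmod (u j))\<^sup>2)"

text \<open>
  For \<open>Z = \<ell>\<^sup>2(X)\<close> the Hilbert tensor power \<open>Z\<^sup>\<otimes>\<^sup>n\<close> is \<open>\<ell>\<^sup>2(X\<^sup>n)\<close>, and the Hilbert direct sum of all
  tensor powers is \<open>\<ell>\<^sup>2\<close> of the set of finite lists over \<open>X\<close>. The restriction of an element to the
  lists of length \<open>n\<close> is its component of degree \<open>n\<close>.
\<close>

definition fock :: "'x set \<Rightarrow> ('x list \<Rightarrow> complex) set" where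
  "fock X = {F \<in> ell2 (lists X).
     \<forall>xs \<sigma>. \<sigma> permutes {..<length xs} \<longrightarrow> F (permute_list \<sigma> xs) = F xs}"

definition tensor :: "('x \<Rightarrow> complex) list \<Rightarrow> 'x list \<Rightarrow> complex" where
  "tensor us xs = (if length xs = length us then \<Prod>i<length us. (us ! i) (xs ! i) else 0)"

definition sym_prod :: "('x \<Rightarrow> complex) list \<Rightarrow> 'x list \<Rightarrow> complex" where
  "sym_prod us = (\<lambda>xs. complex_of_real (1 / sqrt (fact (length us))) *
     (\<Sum>\<sigma> | \<sigma> permutes {..<length us}. tensor (permute_list \<sigma> us) xs))"

definition vacuum :: "'x list \<Rightarrow> complex" where
  "vacuum xs = (if xs = [] then 1 else 0)"


section \<open>Segal isomorphisms\<close>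

text \<open>A representative of the almost everywhere defined function \<open>\<ell>\<^sub>a\<close>.\<close>

definition ell :: "'g set \<Rightarrow> ('g \<Rightarrow> real) measure \<Rightarrow> ('g \<Rightarrow> complex) \<Rightarrow> ('g \<Rightarrow> real) \<Rightarrow> complex" where
  "ell E \<mu> a = (SOME f. f \<in> L2 \<mu> \<and>
     (\<forall>F :: nat \<Rightarrow> 'g set. incseq F \<and> (\<forall>n. finite (F n)) \<and> (\<Union>n. F n) = E \<longrightarrow>
        (\<lambda>n. L2_norm \<mu> (\<lambda>x. f x - (\<Sum>j\<in>F n. a j * complex_of_real (x j)))) \<longlonglongrightarrow> 0))"

text \<open>
  For \<open>w\<close> in \<open>\<ell>\<^sup>2\<close> of the disjoint sum \<open>E <+> E\<close>, which stands for \<open>\<ell>\<^sup>2(E,\<complex>)\<^sup>2\<close>, with components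
  \<open>u = w \<circ> Inl\<close> and \<open>v = w \<circ> Inr\<close>, this is \<open>(x,\<xi>) \<mapsto> \<ell>\<^sub>u(x) + \<ell>\<^sub>v(\<xi>)\<close>.
\<close>

definition ell_pair ::
  "'g set \<Rightarrow> ('g \<Rightarrow> real) measure \<Rightarrow> ('g + 'g \<Rightarrow> complex) \<Rightarrow> ('g \<Rightarrow> real) \<times> ('g \<Rightarrow> real) \<Rightarrow> complex"
where
  "ell_pair E \<mu> w = (\<lambda>(x, \<xi>). ell E \<mu> (\<lambda>j. w (Inl j)) x + ell E \<mu> (\<lambda>j. w (Inr j)) \<xi>)"

definition poly_space :: "('w \<Rightarrow> complex) set \<Rightarrow> nat \<Rightarrow> ('w \<Rightarrow> complex) set" where
  "poly_space A n =
     cspan {(\<lambda>w. \<Prod>i<length fs. (fs ! i) w) | fs. set fs \<subseteq> A \<and> length fs \<le> n}"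

text \<open>
  For closed subspaces \<open>V' \<subseteq> V\<close> and \<open>f \<in> V\<close>: \<open>g\<close> is the orthogonal projection of \<open>f\<close> onto the
  orthogonal complement of \<open>V'\<close> in \<open>V\<close>.
\<close>

definition is_proj_compl ::
  "'w measure \<Rightarrow> ('w \<Rightarrow> complex) set \<Rightarrow> ('w \<Rightarrow> complex) set \<Rightarrow>
   ('w \<Rightarrow> complex) \<Rightarrow> ('w \<Rightarrow> complex) \<Rightarrow> bool" where
  "is_proj_compl M V V' f g \<longleftrightarrow>
     f \<in> V \<and> g \<in> V \<and> (\<forall>k\<in>V'. L2_inner M g k = 0) \<and> (\<lambda>w. f w - g w) \<in> V'"

text \<open>
  The common pattern of the two Segal isomorphisms: \<open>J\<close> is a unitary isomorphism of the Fock space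
  over \<open>\<ell>\<^sup>2(X)\<close> onto \<open>L\<^sup>2(M)\<close>, given on the one-particle space by \<open>u \<mapsto> c \<cdot> l u\<close>.
\<close>

definition is_segal_iso ::
  "'w measure \<Rightarrow> 'x set \<Rightarrow> real \<Rightarrow> (('x \<Rightarrow> complex) \<Rightarrow> 'w \<Rightarrow> complex) \<Rightarrow>
   (('x list \<Rightarrow> complex) \<Rightarrow> 'w \<Rightarrow> complex) \<Rightarrow> bool" where
  "is_segal_iso M X c l J \<longleftrightarrow>
     (\<forall>F\<in>fock X. J F \<in> L2 M) \<and>
     (\<forall>F\<in>fock X. \<forall>G\<in>fock X. AE w in M. J (\<lambda>xs. F xs + G xs) w = J F w + J G w) \<and>
     (\<forall>z. \<forall>F\<in>fock X. AE w in M. J (\<lambda>xs. z * F xs) w = z * J F w) \<and>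
     (\<forall>F\<in>fock X. L2_norm M (J F) = ell2_norm F) \<and>
     (\<forall>f\<in>L2 M. \<exists>F\<in>fock X. AE w in M. J F w = f w) \<and>
     (AE w in M. J vacuum w = 1) \<and>
     (\<forall>u\<in>ell2 X. AE w in M. J (sym_prod [u]) w = complex_of_real c * l u w) \<and>
     (\<forall>us. us \<noteq> [] \<and> set us \<subseteq> ell2 X \<longrightarrow>
        is_proj_compl M
          (L2_closure M (poly_space (l ` ell2 X) (length us)))
          (L2_closure M (poly_space (l ` ell2 X) (length us - 1)))
          (\<lambda>w. \<Prod>i<length us. J (sym_prod [us ! i]) w)
          (J (sym_prod us)))"

definition is_segal_iso_K ::
  "'g set \<Rightarrow> real \<Rightarrow> ('g \<Rightarrow> real) measure \<Rightarrow>
   (('g list \<Rightarrow> complex) \<Rightarrow> ('g \<Rightarrow> real) \<Rightarrow> complex) \<Rightarrow> bool" where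
  "is_segal_iso_K E h \<mu> J \<longleftrightarrow> is_segal_iso \<mu> E (sqrt (2 / h)) (ell E \<mu>) J"

definition is_segal_iso_Phi ::
  "'g set \<Rightarrow> real \<Rightarrow> ('g \<Rightarrow> real) measure \<Rightarrow>
   ((('g + 'g) list \<Rightarrow> complex) \<Rightarrow> ('g \<Rightarrow> real) \<times> ('g \<Rightarrow> real) \<Rightarrow> complex) \<Rightarrow> bool" where
  "is_segal_iso_Phi E h \<mu> J \<longleftrightarrow>
     is_segal_iso (\<mu> \<Otimes>\<^sub>M \<mu>) (E <+> E) (h powr (- 1 / 2)) (ell_pair E \<mu>) J"


section \<open>The Segal--Bargmann transform\<close>

definition T_map :: "('g \<Rightarrow> complex) \<Rightarrow> 'g + 'g \<Rightarrow> complex" where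
  "T_map u = case_sum (\<lambda>j. complex_of_real (1 / sqrt 2) * u j)
                      (\<lambda>j. complex_of_real (1 / sqrt 2) * (- \<i> * u j))"

definition is_segal_bargmann ::
  "'g set \<Rightarrow> (('g list \<Rightarrow> complex) \<Rightarrow> ('g + 'g) list \<Rightarrow> complex) \<Rightarrow> bool" where
  "is_segal_bargmann E W \<longleftrightarrow>
     (\<forall>F\<in>fock E. W F \<in> fock (E <+> E)) \<and>
     (\<forall>F\<in>fock E. \<forall>G\<in>fock E. W (\<lambda>xs. F xs + G xs) = (\<lambda>ys. W F ys + W G ys)) \<and>
     (\<forall>z. \<forall>F\<in>fock E. W (\<lambda>xs. z * F xs) = (\<lambda>ys. z * W F ys)) \<and>
     (\<forall>F\<in>fock E. ell2_norm (W F) = ell2_norm F) \<and>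
     W vacuum = vacuum \<and>
     (\<forall>us. us \<noteq> [] \<and> set us \<subseteq> ell2 E \<longrightarrow> W (sym_prod us) = sym_prod (map T_map us))"

text \<open>
  \<open>J\<^sub>\<Phi> \<circ> W \<circ> J\<^sub>K\<^sup>-\<^sup>1\<close>, where the inverse is taken modulo almost everywhere equality.
\<close>

definition theta ::
  "'g set \<Rightarrow> ('g \<Rightarrow> real) measure \<Rightarrow>
   (('g list \<Rightarrow> complex) \<Rightarrow> ('g \<Rightarrow> real) \<Rightarrow> complex) \<Rightarrow>
   (('g list \<Rightarrow> complex) \<Rightarrow> ('g + 'g) list \<Rightarrow> complex) \<Rightarrow>
   ((('g + 'g) list \<Rightarrow> complex) \<Rightarrow> ('g \<Rightarrow> real) \<times> ('g \<Rightarrow> real) \<Rightarrow> complex) \<Rightarrow>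
   (('g \<Rightarrow> real) \<Rightarrow> complex) \<Rightarrow> ('g \<Rightarrow> real) \<times> ('g \<Rightarrow> real) \<Rightarrow> complex" where
  "theta E \<mu>K JK W J\<Phi> g = J\<Phi> (W (THE F. F \<in> fock E \<and> (AE x in \<mu>K. JK F x = g x)))"


section \<open>The four descriptions of \<open>SB(E,h)\<close>\<close>

text \<open>
  Here \<open>\<complex>\<^sup>F\<close>, with \<open>F\<close> finite, is \<open>F \<rightarrow>\<^sub>E UNIV\<close>; the condition is Frechet differentiability at every
  point with a \<open>\<complex>\<close>-antilinear differential.
\<close>

definition antiholomorphic :: "'g set \<Rightarrow> (('g \<Rightarrow> complex) \<Rightarrow> complex) \<Rightarrow> bool" where
  "antiholomorphic F g \<longleftrightarrow>
     (\<forall>z \<in> F \<rightarrow>\<^sub>E UNIV. \<exists>a. \<forall>\<epsilon>>0. \<exists>\<delta>>0. \<forall>w \<in> F \<rightarrow>\<^sub>E UNIV.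
        (\<Sum>j\<in>F. cmod (w j - z j)) < \<delta> \<longrightarrow>
        cmod (g w - g z - (\<Sum>j\<in>F. a j * cnj (w j - z j))) \<le> \<epsilon> * (\<Sum>j\<in>F. cmod (w j - z j)))"

definition cylindrical_antiholomorphic ::
  "'g set \<Rightarrow> (('g \<Rightarrow> real) \<times> ('g \<Rightarrow> real)) measure \<Rightarrow>
   (('g \<Rightarrow> real) \<times> ('g \<Rightarrow> real) \<Rightarrow> complex) set" where
  "cylindrical_antiholomorphic E M = {f \<in> L2 M.
     \<exists>F g. finite F \<and> F \<subseteq> E \<and> antiholomorphic F g \<and>
       (\<forall>(x, \<xi>)\<in>space M. f (x, \<xi>) = g (\<lambda>j\<in>F. Complex (x j) (\<xi> j)))}"

definition S_supp :: "('g \<Rightarrow> nat) \<Rightarrow> 'g set" where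
  "S_supp \<alpha> = {j. \<alpha> j \<ge> 1}"

definition Q_fun ::
  "('g \<Rightarrow> nat) \<Rightarrow> real \<Rightarrow> ('g \<Rightarrow> real) \<times> ('g \<Rightarrow> real) \<Rightarrow> complex" where
  "Q_fun \<alpha> h = (\<lambda>(x, \<xi>).
     complex_of_real ((2 * h) powr (- real (\<Sum>j\<in>S_supp \<alpha>. \<alpha> j) / 2)) *
     (\<Prod>j\<in>S_supp \<alpha>. (complex_of_real (x j) - \<i> * complex_of_real (\<xi> j)) ^ \<alpha> j))"

definition SB_antiholomorphic ::
  "'g set \<Rightarrow> (('g \<Rightarrow> real) \<times> ('g \<Rightarrow> real)) measure \<Rightarrow>
   (('g \<Rightarrow> real) \<times> ('g \<Rightarrow> real) \<Rightarrow> complex) set" where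
  "SB_antiholomorphic E M = L2_closure M (cylindrical_antiholomorphic E M)"

definition SB_polynomial ::
  "'g set \<Rightarrow> real \<Rightarrow> (('g \<Rightarrow> real) \<times> ('g \<Rightarrow> real)) measure \<Rightarrow>
   (('g \<Rightarrow> real) \<times> ('g \<Rightarrow> real) \<Rightarrow> complex) set" where
  "SB_polynomial E h M =
     L2_closure M (cspan {Q_fun \<alpha> h | \<alpha>. finite (S_supp \<alpha>) \<and> S_supp \<alpha> \<subseteq> E})"

text \<open>The range of a map into \<open>L\<^sup>2(M)\<close>, saturated for almost everywhere equality.\<close>

definition L2_range :: "'w measure \<Rightarrow> ('d \<Rightarrow> 'w \<Rightarrow> complex) \<Rightarrow> 'd set \<Rightarrow> ('w \<Rightarrow> complex) set" where
  "L2_range M A D = {f \<in> L2 M. \<exists>d\<in>D. AE w in M. f w = A d w}"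

end

theory Submission
  imports Defs "HOL-Complex_Analysis.Complex_Analysis"
begin

text \<open>
  All four descriptions are compared with the closed span of the monomials \<open>Q\<^sub>\<alpha>\<close>. Under
  \<open>\<mu>\<^sub>\<Phi> = \<mu> \<otimes> \<mu>\<close> the complex coordinates \<open>z\<^sub>j = x\<^sub>j + \<i> \<xi>\<^sub>j\<close> are independent and have the same rotation
  invariant Gaussian law on \<open>\<complex>\<close> (lemma \<open>complex_coord_distr\<close>), and \<open>Q\<^sub>\<alpha>\<close> is a multiple of the monomial
  \<open>\<Prod> cnj z\<^sub>j ^ \<alpha>\<^sub>j\<close>. The moments of this law give \<open>\<parallel>Q\<^sub>\<alpha>\<parallel>\<^sup>2 = \<alpha>!\<close> (lemma \<open>Q_fun_norm\<close>).

  Antiholomorphic functions. The conjugate of a cylindrical antiholomorphic function is an entire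
  function \<open>f\<close> of finitely many Gaussian variables, and it has to be approximated by polynomials in
  \<open>L\<^sup>2\<close> (lemma \<open>entire_in_closure_monomials\<close>). Expand \<open>f = \<Sum>\<^sub>k c\<^sub>k z\<^sub>j\<^sup>k\<close> in the Taylor series in one
  variable. By rotation invariance the integral of \<open>\<bar>f\<bar>\<^sup>2\<close> is unchanged when \<open>\<bar>f\<bar>\<^sup>2\<close> is replaced by its
  averages over the circles \<open>\<bar>z\<^sub>j\<bar> = r\<close>, and by Parseval's identity these averages are the sums
  \<open>\<Sum>\<^sub>k \<bar>c\<^sub>k\<bar>\<^sup>2 r\<^sup>2\<^sup>k\<close>. Therefore the Taylor series converges in \<open>L\<^sup>2\<close> with no assumption on the growth of \<open>f\<close>,
  and its coefficients are entire square-integrable functions of one variable less, to which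
  induction applies. Conversely, polynomials in the \<open>cnj z\<^sub>j\<close> are antiholomorphic.

  The range of \<open>J\<^sub>\<Phi> \<circ> W\<close>. This map is an isometry on a complete space, so that its range is closed. The
  symmetric products \<open>e\<^sub>j\<^sub>1 \<odot> \<dots> \<odot> e\<^sub>j\<^sub>n\<close> of unit vectors span a dense subspace of the Fock space (lemma
  \<open>fock_dense\<close>), and it remains to see that they are mapped to the \<open>Q\<^sub>\<alpha>\<close>, where \<open>\<alpha>\<close> counts the indices
  (lemma \<open>segal_iso_Phi_segal_bargmann_unit_vecs\<close>). By definition the image of a product is the
  projection of the product of the images \<open>(2 h)\<^sup>-\<^sup>1\<^sup>/\<^sup>2 (x\<^sub>j - \<i> \<xi>\<^sub>j)\<close>, which is \<open>Q\<^sub>\<alpha>\<close>, onto the orthogonal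
  complement of the polynomials of lower degree. Orthogonality of \<open>Q\<^sub>\<alpha>\<close> to these need not be computed:
  since \<open>J\<^sub>\<Phi>\<close> and \<open>W\<close> are isometric, the projection has the norm of \<open>e\<^sub>j\<^sub>1 \<odot> \<dots> \<odot> e\<^sub>j\<^sub>n\<close>, whose square is
  \<open>\<alpha>!\<close> as well, and a projection that preserves the norm of an element fixes the element.

  The range of \<open>\<theta>\<close> is the range of \<open>J\<^sub>\<Phi> \<circ> W\<close>, because \<open>J\<^sub>K\<close> is bijective up to almost everywhere
  equality.
\<close>

section \<open>Square-integrable functions\<close>

lemma L2_I: "f \<in> borel_measurable M \<Longrightarrow> integrable M (\<lambda>w. (cmod (f w))\<^sup>2) \<Longrightarrow> f \<in> L2 M"
  by (simp add: L2_def)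

lemma L2_measurable [measurable_dest]: "f \<in> L2 M \<Longrightarrow> f \<in> borel_measurable M"
  by (simp add: L2_def)

lemma L2_integrable: "f \<in> L2 M \<Longrightarrow> integrable M (\<lambda>w. (cmod (f w))\<^sup>2)"
  by (simp add: L2_def)

lemma L2_iff_nn_integral:
  "f \<in> L2 M \<longleftrightarrow> f \<in> borel_measurable M \<and> (\<integral>\<^sup>+w. ennreal ((cmod (f w))\<^sup>2) \<partial>M) < \<infinity>"
  by (auto simp: L2_def integrable_iff_bounded)

lemma L2_norm_nonneg [simp]: "0 \<le> L2_norm M f"
  by (simp add: L2_norm_def)

lemma L2_norm_power2: "(L2_norm M f)\<^sup>2 = (\<integral>w. (cmod (f w))\<^sup>2 \<partial>M)"
  by (simp add: L2_norm_def)

lemma ennreal_L2_norm_power2: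
  "f \<in> L2 M \<Longrightarrow> ennreal ((L2_norm M f)\<^sup>2) = (\<integral>\<^sup>+w. ennreal ((cmod (f w))\<^sup>2) \<partial>M)"
  unfolding L2_norm_power2 by (subst nn_integral_eq_integral) (auto simp: L2_integrable)

lemma norm_add_power2_le:
  fixes a b :: "'a::real_normed_vector"
  assumes "t > 0"
  shows "(norm (a + b))\<^sup>2 \<le> (1 + t) * (norm a)\<^sup>2 + (1 + 1 / t) * (norm b)\<^sup>2"
proof -
  have "(norm (a + b))\<^sup>2 \<le> (norm a + norm b)\<^sup>2"
    by (intro power_mono norm_triangle_ineq) auto
  also have "\<dots> \<le> (1 + t) * (norm a)\<^sup>2 + (1 + 1 / t) * (norm b)\<^sup>2"
  proof -
    have "0 \<le> (sqrt t * norm a - norm b / sqrt t)\<^sup>2" by simp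
    also have "\<dots> = t * (norm a)\<^sup>2 + (norm b)\<^sup>2 / t - 2 * norm a * norm b"
      using assms by (simp add: power2_diff power_mult_distrib power_divide)
    finally show ?thesis by (simp add: algebra_simps power2_sum)
  qed
  finally show ?thesis .
qed

lemma L2_add:
  assumes f: "f \<in> L2 M" and g: "g \<in> L2 M"
  shows "(\<lambda>w. f w + g w) \<in> L2 M"
proof (rule L2_I)
  show m: "(\<lambda>w. f w + g w) \<in> borel_measurable M" using f g by measurable
  show "integrable M (\<lambda>w. (cmod (f w + g w))\<^sup>2)"
  proof (rule Bochner_Integration.integrable_bound)
    show "integrable M (\<lambda>w. 2 * (cmod (f w))\<^sup>2 + 2 * (cmod (g w))\<^sup>2)"
      using f g by (auto simp: L2_def)
    show "AE w in M. norm ((cmod (f w + g w))\<^sup>2) \<le> norm (2 * (cmod (f w))\<^sup>2 + 2 * (cmod (g w))\<^sup>2)"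
      using norm_add_power2_le[of 1] by (intro AE_I2) simp
  qed (use m in measurable)
qed

lemma L2_cmult: "f \<in> L2 M \<Longrightarrow> (\<lambda>w. c * f w) \<in> L2 M"
  by (auto simp: L2_def norm_mult power_mult_distrib)

lemma L2_zero [simp]: "(\<lambda>w. 0) \<in> L2 M"
  by (simp add: L2_def)

lemma L2_diff: "f \<in> L2 M \<Longrightarrow> g \<in> L2 M \<Longrightarrow> (\<lambda>w. f w - g w) \<in> L2 M"
  using L2_add[of f M "\<lambda>w. (-1) * g w"] L2_cmult[of g M "-1"] by simp

lemmas L2_intros = L2_add L2_cmult L2_diff L2_zero

lemma L2_sum:
  "(\<And>i. i \<in> I \<Longrightarrow> f i \<in> L2 M) \<Longrightarrow> (\<lambda>w. \<Sum>i\<in>I. f i w) \<in> L2 M"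
  by (induction I rule: infinite_finite_induct) (auto intro: L2_intros)

lemma L2_norm_cong_AE:
  assumes "f \<in> borel_measurable M" "g \<in> borel_measurable M" "AE w in M. f w = g w"
  shows "L2_norm M f = L2_norm M g"
proof -
  have "(\<integral>w. (cmod (f w))\<^sup>2 \<partial>M) = (\<integral>w. (cmod (g w))\<^sup>2 \<partial>M)"
    using assms by (intro integral_cong_AE) auto
  thus ?thesis by (simp add: L2_norm_def)
qed

lemma L2_norm_cmult: "L2_norm M (\<lambda>w. c * f w) = cmod c * L2_norm M f"
  by (simp add: L2_norm_def norm_mult power_mult_distrib real_sqrt_mult)

lemma L2_norm_minus_commute: "L2_norm M (\<lambda>w. f w - g w) = L2_norm M (\<lambda>w. g w - f w)"
  by (simp add: L2_norm_def norm_minus_commute)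

text \<open>
  The pointwise bound \<open>\<bar>a + b\<bar>\<^sup>2 \<le> (1 + t) \<bar>a\<bar>\<^sup>2 + (1 + 1 / t) \<bar>b\<bar>\<^sup>2\<close> is integrated, and \<open>t\<close> is chosen as
  the ratio of the two norms. Both norms are enlarged by \<open>\<epsilon>\<close> to keep this ratio positive.
\<close>

lemma L2_norm_triangle:
  assumes f: "f \<in> L2 M" and g: "g \<in> L2 M"
  shows "L2_norm M (\<lambda>w. f w + g w) \<le> L2_norm M f + L2_norm M g"
proof (rule field_le_epsilon)
  fix \<epsilon> :: real assume e: "\<epsilon> > 0"
  define A B C where "A = L2_norm M f" and "B = L2_norm M g" and "C = L2_norm M (\<lambda>w. f w + g w)"
  define a b where "a = A + \<epsilon> / 2" and "b = B + \<epsilon> / 2"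
  have ab: "0 \<le> A" "0 \<le> B" "A \<le> a" "B \<le> b" "a > 0" "b > 0"
    using e by (auto simp: a_def b_def A_def B_def add_nonneg_pos)
  have t: "b / a > 0" using ab by simp
  have "C\<^sup>2 \<le> (\<integral>w. (1 + b / a) * (cmod (f w))\<^sup>2 + (1 + 1 / (b / a)) * (cmod (g w))\<^sup>2 \<partial>M)"
    unfolding C_def L2_norm_power2
    by (intro integral_mono L2_integrable L2_add Bochner_Integration.integrable_add
        integrable_mult_right norm_add_power2_le f g t)
  also have "\<dots> = (1 + b / a) * A\<^sup>2 + (1 + 1 / (b / a)) * B\<^sup>2"
    unfolding A_def B_def L2_norm_power2 using f g by (simp add: L2_integrable)
  also have "\<dots> \<le> (1 + b / a) * a\<^sup>2 + (1 + 1 / (b / a)) * b\<^sup>2"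
    using ab by (intro add_mono mult_left_mono power_mono) auto
  also have "\<dots> = (a + b)\<^sup>2" using ab by (simp add: field_simps power2_eq_square)
  finally have "C \<le> a + b" using ab by (intro power2_le_imp_le[of C "a + b"]) auto
  thus "L2_norm M (\<lambda>w. f w + g w) \<le> L2_norm M f + L2_norm M g + \<epsilon>"
    by (simp add: A_def B_def C_def a_def b_def)
qed

lemma L2_norm_triangle3:
  assumes "f \<in> L2 M" "g \<in> L2 M" "k \<in> L2 M"
  shows "L2_norm M (\<lambda>w. f w - k w) \<le> L2_norm M (\<lambda>w. f w - g w) + L2_norm M (\<lambda>w. g w - k w)"
  using L2_norm_triangle[of "\<lambda>w. f w - g w" M "\<lambda>w. g w - k w"] assms by (auto intro: L2_intros)

lemma L2_norm_eq_0_iff: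
  assumes "f \<in> L2 M"
  shows "L2_norm M f = 0 \<longleftrightarrow> (AE w in M. f w = 0)"
  using integral_nonneg_eq_0_iff_AE[OF L2_integrable[OF assms]] by (simp add: L2_norm_def)


section \<open>Closed subspaces of \<open>L\<^sup>2\<close>\<close>

lemma L2_closure_subset: "L2_closure M S \<subseteq> L2 M"
  by (auto simp: L2_closure_def)

lemma subset_L2_closure: "S \<inter> L2 M \<subseteq> L2_closure M S"
proof
  fix f assume "f \<in> S \<inter> L2 M"
  thus "f \<in> L2_closure M S"
    by (auto simp: L2_closure_def L2_norm_def intro!: bexI[of _ f])
qed

lemma L2_closure_mono_closure:
  assumes "S \<inter> L2 M \<subseteq> L2_closure M T"
  shows "L2_closure M S \<subseteq> L2_closure M T"
proof
  fix f assume f: "f \<in> L2_closure M S"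
  have fL: "f \<in> L2 M" using f by (simp add: L2_closure_def)
  have "\<exists>k\<in>T \<inter> L2 M. L2_norm M (\<lambda>w. f w - k w) < \<epsilon>" if e: "\<epsilon> > 0" for \<epsilon>
  proof -
    obtain g where g: "g \<in> S \<inter> L2 M" "L2_norm M (\<lambda>w. f w - g w) < \<epsilon> / 2"
      using f e unfolding L2_closure_def by (auto dest!: spec[of _ "\<epsilon> / 2"])
    then obtain k where k: "k \<in> T \<inter> L2 M" "L2_norm M (\<lambda>w. g w - k w) < \<epsilon> / 2"
      using assms e unfolding L2_closure_def by (auto dest!: subsetD spec[of _ "\<epsilon> / 2"])
    have "L2_norm M (\<lambda>w. f w - k w) < \<epsilon>"
      using L2_norm_triangle3[of f M g k] fL g k by auto
    with k show ?thesis by blast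
  qed
  with fL show "f \<in> L2_closure M T" by (auto simp: L2_closure_def)
qed

lemma L2_closure_idem: "L2_closure M (L2_closure M S) = L2_closure M S"
  using L2_closure_mono_closure[of "L2_closure M S" M S] subset_L2_closure[of "L2_closure M S" M]
    L2_closure_subset[of M S] by auto

lemma L2_closure_AE:
  assumes f: "f \<in> L2_closure M S" and g: "g \<in> L2 M" and "AE w in M. g w = f w"
  shows "g \<in> L2_closure M S"
proof -
  have fL: "f \<in> L2 M" using f by (simp add: L2_closure_def)
  have "L2_norm M (\<lambda>w. g w - k w) = L2_norm M (\<lambda>w. f w - k w)" if "k \<in> L2 M" for k
    using assms(3) by (intro L2_norm_cong_AE L2_measurable L2_diff that fL g) auto
  thus ?thesis using assms unfolding L2_closure_def by fastforce
qed

lemma L2_closed_subspace_closure: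
  assumes zero: "(\<lambda>w. 0) \<in> S"
    and add: "\<And>f g. f \<in> S \<Longrightarrow> g \<in> S \<Longrightarrow> (\<lambda>w. f w + g w) \<in> S"
    and cmult: "\<And>c f. f \<in> S \<Longrightarrow> (\<lambda>w. c * f w) \<in> S"
  shows "L2_closed_subspace M (L2_closure M S)"
  unfolding L2_closed_subspace_def
proof (intro conjI ballI allI)
  show "L2_closure M S \<subseteq> L2 M" by (rule L2_closure_subset)
  show "(\<lambda>w. 0) \<in> L2_closure M S" using zero subset_L2_closure[of S M] by auto
  show "L2_closure M (L2_closure M S) = L2_closure M S" by (rule L2_closure_idem)
next
  fix f g assume f: "f \<in> L2_closure M S" and g: "g \<in> L2_closure M S"
  have fg: "f \<in> L2 M" "g \<in> L2 M" using f g by (auto simp: L2_closure_def)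
  have "\<exists>k\<in>S \<inter> L2 M. L2_norm M (\<lambda>w. (f w + g w) - k w) < \<epsilon>" if e: "\<epsilon> > 0" for \<epsilon>
  proof -
    obtain f' where f': "f' \<in> S \<inter> L2 M" "L2_norm M (\<lambda>w. f w - f' w) < \<epsilon> / 2"
      using f e unfolding L2_closure_def by (auto dest!: spec[of _ "\<epsilon> / 2"])
    obtain g' where g': "g' \<in> S \<inter> L2 M" "L2_norm M (\<lambda>w. g w - g' w) < \<epsilon> / 2"
      using g e unfolding L2_closure_def by (auto dest!: spec[of _ "\<epsilon> / 2"])
    have "L2_norm M (\<lambda>w. (f w + g w) - (f' w + g' w)) =
          L2_norm M (\<lambda>w. (f w - f' w) + (g w - g' w))"
      by (simp add: algebra_simps)
    also have "\<dots> \<le> L2_norm M (\<lambda>w. f w - f' w) + L2_norm M (\<lambda>w. g w - g' w)"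
      using fg f' g' by (intro L2_norm_triangle) (auto intro: L2_intros L2_sum)
    finally have "L2_norm M (\<lambda>w. (f w + g w) - (f' w + g' w)) < \<epsilon>" using f' g' by simp
    with f' g' add show ?thesis by (intro bexI[of _ "\<lambda>w. f' w + g' w"]) (auto intro: L2_intros)
  qed
  with L2_add[OF fg] show "(\<lambda>w. f w + g w) \<in> L2_closure M S" by (auto simp: L2_closure_def)
next
  fix c f assume f: "f \<in> L2_closure M S"
  have fL: "f \<in> L2 M" using f by (auto simp: L2_closure_def)
  have "\<exists>k\<in>S \<inter> L2 M. L2_norm M (\<lambda>w. c * f w - k w) < \<epsilon>" if e: "\<epsilon> > 0" for \<epsilon>
  proof -
    obtain f' where f': "f' \<in> S \<inter> L2 M" "L2_norm M (\<lambda>w. f w - f' w) < \<epsilon> / (cmod c + 1)"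
      using f e unfolding L2_closure_def
      by (auto dest!: spec[of _ "\<epsilon> / (cmod c + 1)"] simp: add_nonneg_pos)
    have "L2_norm M (\<lambda>w. c * f w - c * f' w) = cmod c * L2_norm M (\<lambda>w. f w - f' w)"
      by (subst L2_norm_cmult[symmetric]) (simp add: algebra_simps)
    also have "\<dots> \<le> cmod c * (\<epsilon> / (cmod c + 1))"
      using f' by (intro mult_left_mono) auto
    also have "\<dots> < \<epsilon>"
      using e add_nonneg_pos[of "cmod c" 1] by (simp add: pos_divide_less_eq algebra_simps)
    finally show ?thesis using f' cmult by (intro bexI[of _ "\<lambda>w. c * f' w"]) (auto intro: L2_intros)
  qed
  with fL[THEN L2_cmult] show "(\<lambda>w. c * f w) \<in> L2_closure M S" by (auto simp: L2_closure_def)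
qed

lemma cspan_add:
  assumes "f \<in> cspan S" "g \<in> cspan S"
  shows "(\<lambda>w. f w + g w) \<in> cspan S"
proof -
  obtain T c where T: "finite T" "T \<subseteq> S" "f = (\<lambda>w. \<Sum>g\<in>T. c g * g w)"
    using assms(1) by (auto simp: cspan_def)
  obtain T' c' where T': "finite T'" "T' \<subseteq> S" "g = (\<lambda>w. \<Sum>g\<in>T'. c' g * g w)"
    using assms(2) by (auto simp: cspan_def)
  define d where "d k = (if k \<in> T then c k else 0)" for k
  define d' where "d' k = (if k \<in> T' then c' k else 0)" for k
  have "f w = (\<Sum>g\<in>T \<union> T'. d g * g w)" for w
    unfolding T(3) using T T' by (intro sum.mono_neutral_cong_left) (auto simp: d_def)
  moreover have "g w = (\<Sum>g\<in>T \<union> T'. d' g * g w)" for w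
    unfolding T'(3) using T T' by (intro sum.mono_neutral_cong_left) (auto simp: d'_def)
  ultimately have "(\<lambda>w. f w + g w) = (\<lambda>w. \<Sum>g\<in>T \<union> T'. (d g + d' g) * g w)"
    by (simp add: fun_eq_iff sum.distrib algebra_simps)
  thus ?thesis using T T' unfolding cspan_def
    by (intro CollectI exI[of _ "T \<union> T'"] exI[of _ "\<lambda>g. d g + d' g"]) auto
qed

lemma cspan_cmult: "f \<in> cspan S \<Longrightarrow> (\<lambda>w. c * f w) \<in> cspan S"
  unfolding cspan_def
proof (elim CollectE exE conjE, intro CollectI)
  fix T d assume "finite T" "T \<subseteq> S" "f = (\<lambda>w. \<Sum>g\<in>T. d g * g w)"
  thus "\<exists>T d. finite T \<and> T \<subseteq> S \<and> (\<lambda>w. c * f w) = (\<lambda>w. \<Sum>g\<in>T. d g * g w)"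
    by (intro exI[of _ T] exI[of _ "\<lambda>g. c * d g"]) (auto simp: sum_distrib_left mult.assoc)
qed

lemma cspan_zero: "(\<lambda>w. 0) \<in> cspan S"
  by (auto simp: cspan_def intro!: exI[of _ "{}"])

lemma cspan_base: "f \<in> S \<Longrightarrow> f \<in> cspan S"
  by (auto simp: cspan_def intro!: exI[of _ "{f}"] exI[of _ "\<lambda>_. 1"])

lemma cspan_sum:
  "(\<And>i. i \<in> I \<Longrightarrow> f i \<in> cspan S) \<Longrightarrow> (\<lambda>w. \<Sum>i\<in>I. f i w) \<in> cspan S"
  by (induction I rule: infinite_finite_induct) (auto intro: cspan_add cspan_zero)

lemma L2_closed_subspace_closure_cspan: "L2_closed_subspace M (L2_closure M (cspan S))"
  by (intro L2_closed_subspace_closure cspan_zero cspan_add cspan_cmult)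


section \<open>The complex Gaussian measure\<close>

definition gauss1 :: "real \<Rightarrow> real measure" where
  "gauss1 h = density lborel (\<lambda>x. ennreal (normal_density 0 (sqrt h) x))"

definition gauss_complex :: "real \<Rightarrow> complex measure" where
  "gauss_complex h = distr (gauss1 h \<Otimes>\<^sub>M gauss1 h) borel (\<lambda>(x, y). Complex x y)"

lemma sets_gauss1 [simp, measurable_cong]: "sets (gauss1 h) = sets borel"
  by (simp add: gauss1_def)

lemma space_gauss1 [simp]: "space (gauss1 h) = UNIV"
  by (simp add: gauss1_def)

lemma sets_gauss_complex [simp, measurable_cong]: "sets (gauss_complex h) = sets borel"
  by (simp add: gauss_complex_def)

lemma space_gauss_complex [simp]: "space (gauss_complex h) = UNIV"
  by (simp add: gauss_complex_def)

lemma prob_space_gauss1: "h > 0 \<Longrightarrow> prob_space (gauss1 h)"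
  unfolding gauss1_def by (rule prob_space_normal_density) simp

lemma borel_measurable_Complex [measurable (raw)]:
  assumes [measurable]: "f \<in> borel_measurable M" "g \<in> borel_measurable M"
  shows "(\<lambda>x. Complex (f x) (g x)) \<in> borel_measurable M"
proof -
  have "(\<lambda>x. complex_of_real (f x) + \<i> * complex_of_real (g x)) \<in> borel_measurable M"
    by measurable
  thus ?thesis by (simp add: complex_eq_iff Complex_eq)
qed

lemma prob_space_gauss_complex:
  assumes "h > 0"
  shows "prob_space (gauss_complex h)"
proof -
  interpret prob_space "gauss1 h" by (rule prob_space_gauss1) fact
  interpret pair_prob_space "gauss1 h" "gauss1 h" ..
  show ?thesis unfolding gauss_complex_def by (rule prob_space_distr) measurable
qed

lemma nn_integral_gauss_complex:
  assumes h: "h > 0" and [measurable]: "\<phi> \<in> borel_measurable borel"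
  shows "(\<integral>\<^sup>+z. \<phi> z \<partial>gauss_complex h) = (\<integral>\<^sup>+x. \<integral>\<^sup>+y. \<phi> (Complex x y) \<partial>gauss1 h \<partial>gauss1 h)"
proof -
  interpret prob_space "gauss1 h" by (rule prob_space_gauss1) fact
  have "(\<integral>\<^sup>+z. \<phi> z \<partial>gauss_complex h) =
        (\<integral>\<^sup>+p. \<phi> (Complex (fst p) (snd p)) \<partial>(gauss1 h \<Otimes>\<^sub>M gauss1 h))"
    unfolding gauss_complex_def by (subst nn_integral_distr) (auto simp: case_prod_beta)
  also have "\<dots> = (\<integral>\<^sup>+x. \<integral>\<^sup>+y. \<phi> (Complex x y) \<partial>gauss1 h \<partial>gauss1 h)"
    by (subst nn_integral_fst[symmetric]) auto
  finally show ?thesis .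
qed

lemma nn_integral_gauss_complex_density:
  assumes h: "h > 0" and [measurable]: "\<phi> \<in> borel_measurable borel"
  shows "(\<integral>\<^sup>+z. \<phi> z \<partial>gauss_complex h) =
    (\<integral>\<^sup>+x. \<integral>\<^sup>+y. \<phi> (Complex x y) * ennreal (exp (- (x\<^sup>2 + y\<^sup>2) / (2 * h)) / (2 * pi * h))
       \<partial>lborel \<partial>lborel)"
proof -
  have d: "normal_density 0 (sqrt h) x * normal_density 0 (sqrt h) y =
    exp (- (x\<^sup>2 + y\<^sup>2) / (2 * h)) / (2 * pi * h)" for x y
    using h by (simp add: normal_density_def add_divide_distrib diff_divide_distrib
        flip: exp_add)
  have "(\<integral>\<^sup>+x. \<integral>\<^sup>+y. \<phi> (Complex x y) \<partial>gauss1 h \<partial>gauss1 h) =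
    (\<integral>\<^sup>+x. (\<integral>\<^sup>+y. \<phi> (Complex x y) * ennreal (normal_density 0 (sqrt h) y) \<partial>lborel)
       * ennreal (normal_density 0 (sqrt h) x) \<partial>lborel)"
    unfolding gauss1_def by (simp add: nn_integral_density mult.commute)
  also have "\<dots> = (\<integral>\<^sup>+x. \<integral>\<^sup>+y. \<phi> (Complex x y) * ennreal (normal_density 0 (sqrt h) y)
       * ennreal (normal_density 0 (sqrt h) x) \<partial>lborel \<partial>lborel)"
    by (subst nn_integral_multc) auto
  also have "\<dots> = (\<integral>\<^sup>+x. \<integral>\<^sup>+y. \<phi> (Complex x y) *
       ennreal (exp (- (x\<^sup>2 + y\<^sup>2) / (2 * h)) / (2 * pi * h)) \<partial>lborel \<partial>lborel)"
  proof (intro nn_integral_cong)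
    fix x y :: real
    have "ennreal (normal_density 0 (sqrt h) y) * ennreal (normal_density 0 (sqrt h) x) =
        ennreal (exp (- (x\<^sup>2 + y\<^sup>2) / (2 * h)) / (2 * pi * h))"
      using d[of x y] by (simp add: ennreal_mult'[symmetric] mult.commute)
    thus "\<phi> (Complex x y) * ennreal (normal_density 0 (sqrt h) y) * ennreal (normal_density 0 (sqrt h) x) =
        \<phi> (Complex x y) * ennreal (exp (- (x\<^sup>2 + y\<^sup>2) / (2 * h)) / (2 * pi * h))"
      by (simp only: mult.assoc)
  qed
  finally show ?thesis using nn_integral_gauss_complex[OF assms] by simp
qed

text \<open>
  A planar rotation is a product of three shears, and shears preserve iterated Lebesgue integrals
  because Lebesgue measure on the line is translation invariant.
\<close>

lemma nn_integral_lborel_shear_snd: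
  fixes H :: "real \<Rightarrow> real \<Rightarrow> ennreal"
  assumes [measurable]: "case_prod H \<in> borel_measurable (borel \<Otimes>\<^sub>M borel)"
  shows "(\<integral>\<^sup>+x. \<integral>\<^sup>+y. H x (y + s * x) \<partial>lborel \<partial>lborel) = (\<integral>\<^sup>+x. \<integral>\<^sup>+y. H x y \<partial>lborel \<partial>lborel)"
proof (rule nn_integral_cong)
  fix x :: real
  have "(\<integral>\<^sup>+y. H x y \<partial>lborel) = ennreal \<bar>1\<bar> * (\<integral>\<^sup>+y. H x (s * x + 1 * y) \<partial>lborel)"
    by (rule nn_integral_real_affine) auto
  thus "(\<integral>\<^sup>+y. H x (y + s * x) \<partial>lborel) = (\<integral>\<^sup>+y. H x y \<partial>lborel)"
    by (simp add: add.commute)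
qed

lemma nn_integral_lborel_shear_fst:
  fixes H :: "real \<Rightarrow> real \<Rightarrow> ennreal"
  assumes [measurable]: "case_prod H \<in> borel_measurable (borel \<Otimes>\<^sub>M borel)"
  shows "(\<integral>\<^sup>+x. \<integral>\<^sup>+y. H (x - t * y) y \<partial>lborel \<partial>lborel) = (\<integral>\<^sup>+x. \<integral>\<^sup>+y. H x y \<partial>lborel \<partial>lborel)"
proof -
  have "(\<integral>\<^sup>+x. \<integral>\<^sup>+y. H (x - t * y) y \<partial>lborel \<partial>lborel) =
        (\<integral>\<^sup>+y. \<integral>\<^sup>+x. H (x + (- t) * y) y \<partial>lborel \<partial>lborel)"
    by (subst lborel_pair.Fubini') auto
  also have "\<dots> = (\<integral>\<^sup>+y. \<integral>\<^sup>+x. H x y \<partial>lborel \<partial>lborel)"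
    using nn_integral_lborel_shear_snd[of "\<lambda>y x. H x y" "- t"] by simp
  also have "\<dots> = (\<integral>\<^sup>+x. \<integral>\<^sup>+y. H x y \<partial>lborel \<partial>lborel)"
    by (subst lborel_pair.Fubini') auto
  finally show ?thesis .
qed

lemma nn_integral_lborel_rotation:
  fixes H :: "real \<Rightarrow> real \<Rightarrow> ennreal"
  assumes [measurable]: "case_prod H \<in> borel_measurable (borel \<Otimes>\<^sub>M borel)"
    and cs: "c\<^sup>2 + s\<^sup>2 = 1" "c \<noteq> -1"
  shows "(\<integral>\<^sup>+x. \<integral>\<^sup>+y. H (c * x - s * y) (s * x + c * y) \<partial>lborel \<partial>lborel) =
         (\<integral>\<^sup>+x. \<integral>\<^sup>+y. H x y \<partial>lborel \<partial>lborel)"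
proof -
  define t where "t = s / (1 + c)"
  have c: "1 + c \<noteq> 0" using cs(2) by (simp add: add_eq_0_iff)
  have "s * s = (1 - c) * (1 + c)" using cs(1) by (simp add: power2_eq_square algebra_simps)
  hence st: "s * t = 1 - c" using c by (simp add: t_def field_simps)
  have tc: "t * (1 + c) = s" using c by (simp add: t_def)
  have "(\<integral>\<^sup>+x. \<integral>\<^sup>+y. H x y \<partial>lborel \<partial>lborel) = (\<integral>\<^sup>+x. \<integral>\<^sup>+y. H (x - t * y) y \<partial>lborel \<partial>lborel)"
    by (rule nn_integral_lborel_shear_fst[symmetric]) measurable
  also have "\<dots> = (\<integral>\<^sup>+x. \<integral>\<^sup>+y. H (x - t * (y + s * x)) (y + s * x) \<partial>lborel \<partial>lborel)"
    by (rule nn_integral_lborel_shear_snd[symmetric]) measurable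
  also have "\<dots> = (\<integral>\<^sup>+x. \<integral>\<^sup>+y. H ((x - t * y) - t * (y + s * (x - t * y))) (y + s * (x - t * y))
      \<partial>lborel \<partial>lborel)"
    by (rule nn_integral_lborel_shear_fst[symmetric]) measurable
  also have "\<dots> = (\<integral>\<^sup>+x. \<integral>\<^sup>+y. H (c * x - s * y) (s * x + c * y) \<partial>lborel \<partial>lborel)"
  proof -
    have 1: "y + s * (x - t * y) = s * x + c * y" for x y
    proof -
      have "y + s * (x - t * y) = s * x + (1 - s * t) * y" by (simp add: algebra_simps)
      thus ?thesis by (simp add: st)
    qed
    have 2: "(x - t * y) - t * (s * x + c * y) = c * x - s * y" for x y
    proof -
      have "(x - t * y) - t * (s * x + c * y) = (1 - s * t) * x - (t * (1 + c)) * y"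
        by (simp add: algebra_simps)
      thus ?thesis by (simp add: st tc)
    qed
    show ?thesis by (simp add: 1 2)
  qed
  finally show ?thesis by simp
qed

lemma nn_integral_gauss_complex_rotate:
  assumes h: "h > 0" and \<phi> [measurable]: "\<phi> \<in> borel_measurable borel"
  shows "(\<integral>\<^sup>+z. \<phi> (cis \<theta> * z) \<partial>gauss_complex h) = (\<integral>\<^sup>+z. \<phi> z \<partial>gauss_complex h)"
proof -
  have *: "(\<integral>\<^sup>+z. \<phi> (u * z) \<partial>gauss_complex h) = (\<integral>\<^sup>+z. \<phi> z \<partial>gauss_complex h)"
    if u: "cmod u = 1" "u \<noteq> -1" and [measurable]: "\<phi> \<in> borel_measurable borel" for \<phi> u
  proof -
    define c s where "c = Re u" and "s = Im u"
    have cs: "c\<^sup>2 + s\<^sup>2 = 1" using u(1) by (simp add: c_def s_def cmod_def)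
    have c: "c \<noteq> -1"
    proof
      assume "c = -1"
      moreover from this cs have "s = 0" by simp
      ultimately show False using u(2) by (simp add: c_def s_def complex_eq_iff)
    qed
    have inv: "(c * x - s * y)\<^sup>2 + (s * x + c * y)\<^sup>2 = x\<^sup>2 + y\<^sup>2" for x y
    proof -
      have "(c * x - s * y)\<^sup>2 + (s * x + c * y)\<^sup>2 = (c\<^sup>2 + s\<^sup>2) * (x\<^sup>2 + y\<^sup>2)"
        by (simp add: power2_eq_square algebra_simps)
      thus ?thesis by (simp add: cs)
    qed
    have mult: "u * Complex x y = Complex (c * x - s * y) (s * x + c * y)" for x y
      by (simp add: complex_eq_iff c_def s_def algebra_simps)
    define H where "H x y = \<phi> (Complex x y) * ennreal (exp (- (x\<^sup>2 + y\<^sup>2) / (2 * h)) / (2 * pi * h))"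
      for x y
    have [measurable]: "case_prod H \<in> borel_measurable (borel \<Otimes>\<^sub>M borel)"
      unfolding H_def by measurable
    have "(\<integral>\<^sup>+z. \<phi> (u * z) \<partial>gauss_complex h) =
        (\<integral>\<^sup>+x. \<integral>\<^sup>+y. H (c * x - s * y) (s * x + c * y) \<partial>lborel \<partial>lborel)"
      using h by (subst nn_integral_gauss_complex_density) (auto simp: H_def mult inv)
    also have "\<dots> = (\<integral>\<^sup>+x. \<integral>\<^sup>+y. H x y \<partial>lborel \<partial>lborel)"
      using cs c by (intro nn_integral_lborel_rotation) auto
    also have "\<dots> = (\<integral>\<^sup>+z. \<phi> z \<partial>gauss_complex h)"
      using h by (subst nn_integral_gauss_complex_density) (auto simp: H_def[abs_def])
    finally show ?thesis .
  qed
  \<comment> \<open>The shear decomposition misses the half turn, which is the square of a quarter turn.\<close>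
  show ?thesis
  proof (cases "cis \<theta> = -1")
    case False
    thus ?thesis by (intro *) auto
  next
    case True
    have "(\<integral>\<^sup>+z. \<phi> (\<i> * (\<i> * z)) \<partial>gauss_complex h) = (\<integral>\<^sup>+z. \<phi> (\<i> * z) \<partial>gauss_complex h)"
      by (rule *[of "\<i>" "\<lambda>z. \<phi> (\<i> * z)"]) (auto simp: complex_eq_iff)
    also have "\<dots> = (\<integral>\<^sup>+z. \<phi> z \<partial>gauss_complex h)"
      by (rule *) (auto simp: complex_eq_iff)
    finally show ?thesis by (simp add: True flip: mult.assoc)
  qed
qed

text \<open>
  Up to the factor \<open>(- 4)\<^sup>n\<close> the central binomial coefficients are the coefficients of
  \<open>(1 + x)\<^sup>-\<^sup>1\<^sup>/\<^sup>2\<close>. Vandermonde's identity then expresses their convolution by the coefficients of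
  \<open>(1 + x)\<^sup>-\<^sup>1\<close>.
\<close>

lemma central_binomial_gbinomial:
  "real (2 * n choose n) = (- 4) ^ n * ((- 1 / 2) gchoose n)"
proof (induction n)
  case (Suc n)
  have "(- 1 / 2 :: real) gchoose Suc n = ((- 1 / 2) gchoose n) * ((- 1 / 2 - real n) / real (Suc n))"
    by (simp add: gbinomial_prod_rev field_simps)
  hence "(- 4) ^ Suc n * ((- 1 / 2 :: real) gchoose Suc n) =
      ((- 4) ^ n * ((- 1 / 2) gchoose n)) * (- 4 * ((- 1 / 2 - real n) / real (Suc n)))"
    by (simp only: power_Suc mult_ac)
  also have "\<dots> = real (2 * n choose n) * ((4 * real n + 2) / real (Suc n))"
    unfolding Suc.IH[symmetric] by (simp add: field_simps)
  also have "\<dots> = real (2 * Suc n choose Suc n)"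
  proof -
    have c: "real (2 * m choose m) = fact (2 * m) / (fact m * fact m)" for m
      by (simp add: binomial_fact)
    have f: "(fact (2 * Suc n) :: real) = (2 * real n + 2) * (2 * real n + 1) * fact (2 * n)"
      by (simp add: algebra_simps)
    have "fact (2 * n) / (fact n * fact n) * ((4 * x + 2) / (x + 1)) =
        (2 * x + 2) * (2 * x + 1) * fact (2 * n) / ((x + 1) * fact n * ((x + 1) * fact n))"
      if "x \<ge> 0" for x :: real
      using that by (simp add: divide_simps) (simp add: algebra_simps)
    from this[of "real n"] show ?thesis unfolding c f by (simp add: add.commute)
  qed
  finally show ?case by simp
qed simp

lemma sum_central_binomial:
  "(\<Sum>i\<le>k. real (2 * i choose i) * real (2 * (k - i) choose (k - i))) = 4 ^ k"
proof -
  have "(\<Sum>i\<le>k. real (2 * i choose i) * real (2 * (k - i) choose (k - i))) =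
        (\<Sum>i\<le>k. (- 4) ^ k * (((- 1 / 2) gchoose i) * ((- 1 / 2) gchoose (k - i))))"
  proof (intro sum.cong refl)
    fix i assume "i \<in> {..k}"
    hence "(- 4 :: real) ^ k = (- 4) ^ i * (- 4) ^ (k - i)" by (simp flip: power_add)
    thus "real (2 * i choose i) * real (2 * (k - i) choose (k - i)) =
        (- 4) ^ k * (((- 1 / 2) gchoose i) * ((- 1 / 2) gchoose (k - i)))"
      unfolding central_binomial_gbinomial by (simp only: mult_ac)
  qed
  also have "\<dots> = (- 4) ^ k * ((- 1) gchoose k)"
    using gbinomial_Vandermonde[of "- 1 / 2 :: real" "- 1 / 2" k]
    by (simp add: sum_distrib_left[symmetric] atLeast0AtMost)
  also have "(- 1 :: real) gchoose k = (- 1) ^ k"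
    using gbinomial_negated_upper[of "-1::real" k] by (simp flip: binomial_gbinomial)
  finally show ?thesis by (simp flip: power_mult_distrib)
qed

lemma nn_integral_gauss1_even_moment:
  assumes "h > 0"
  shows "(\<integral>\<^sup>+x. ennreal (x ^ (2 * k)) \<partial>gauss1 h) = ennreal ((h / 2) ^ k * fact (2 * k) / fact k)"
proof -
  have "(\<integral>\<^sup>+x. ennreal (x ^ (2 * k)) \<partial>gauss1 h) =
        (\<integral>\<^sup>+x. ennreal (normal_density 0 (sqrt h) x * (x - 0) ^ (2 * k)) \<partial>lborel)"
    unfolding gauss1_def by (subst nn_integral_density) (auto simp: ennreal_mult normal_density_nonneg)
  also have "\<dots> = ennreal (fact (2 * k) / ((2 / (sqrt h)\<^sup>2) ^ k * fact k))"
    using assms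
    using normal_moment_even[of "sqrt h" 0 k]
    by (subst nn_integral_eq_integral) (auto simp: has_bochner_integral_iff normal_density_nonneg)
  also have "fact (2 * k) / ((2 / (sqrt h)\<^sup>2) ^ k * fact k) = (h / 2) ^ k * fact (2 * k) / fact k"
    using assms by (simp add: power_divide)
  finally show ?thesis .
qed

text \<open>
  The moments of \<open>\<bar>z\<bar>\<^sup>2\<close> are those of an exponential distribution. Expanding \<open>(x\<^sup>2 + y\<^sup>2)\<^sup>k\<close> reduces them
  to the convolution of the central binomial coefficients.
\<close>

lemma nn_integral_gauss_complex_moment:
  assumes h: "h > 0"
  shows "(\<integral>\<^sup>+z. ennreal ((cmod z)\<^sup>2 ^ k) \<partial>gauss_complex h) = ennreal ((2 * h) ^ k * fact k)"
proof -
  define m where "m i = (h / 2) ^ i * fact (2 * i) / fact i" for i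
  have m0: "m i \<ge> 0" for i using h by (simp add: m_def)
  have mom: "(\<integral>\<^sup>+x. ennreal (x ^ (2 * i)) \<partial>gauss1 h) = ennreal (m i)" for i
    using nn_integral_gauss1_even_moment[OF h] by (simp add: m_def)
  have "(\<integral>\<^sup>+z. ennreal ((cmod z)\<^sup>2 ^ k) \<partial>gauss_complex h) =
    (\<integral>\<^sup>+x. \<integral>\<^sup>+y. (\<Sum>i\<le>k. ennreal (k choose i) * ennreal (x ^ (2 * i)) * ennreal (y ^ (2 * (k - i))))
      \<partial>gauss1 h \<partial>gauss1 h)"
  proof (subst nn_integral_gauss_complex[OF h], measurable, intro nn_integral_cong)
    fix x y :: real
    have "(cmod (Complex x y))\<^sup>2 ^ k = (x\<^sup>2 + y\<^sup>2) ^ k" by (simp add: cmod_def)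
    also have "\<dots> = (\<Sum>i\<le>k. real (k choose i) * x ^ (2 * i) * y ^ (2 * (k - i)))"
      by (simp add: binomial_ring power_mult)
    finally show "ennreal ((cmod (Complex x y))\<^sup>2 ^ k) =
      (\<Sum>i\<le>k. ennreal (k choose i) * ennreal (x ^ (2 * i)) * ennreal (y ^ (2 * (k - i))))"
      by (simp add: sum_nonneg ennreal_mult flip: sum_ennreal)
  qed
  also have "\<dots> = (\<Sum>i\<le>k. ennreal (k choose i) * ennreal (m i) * ennreal (m (k - i)))"
    by (simp add: nn_integral_sum nn_integral_cmult nn_integral_multc mom)
  also have "\<dots> = ennreal (\<Sum>i\<le>k. real (k choose i) * m i * m (k - i))"
    by (simp add: m0 ennreal_mult flip: sum_ennreal)
  also have "(\<Sum>i\<le>k. real (k choose i) * m i * m (k - i)) =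
    (\<Sum>i\<le>k. (h / 2) ^ k * fact k * (real (2 * i choose i) * real (2 * (k - i) choose (k - i))))"
  proof (intro sum.cong refl)
    fix i assume "i \<in> {..k}"
    hence i: "i \<le> k" by simp
    have pw: "(h / 2) ^ i * (h / 2) ^ (k - i) = (h / 2) ^ k" using i by (simp flip: power_add)
    have fb: "real (2 * n choose n) = fact (2 * n) / (fact n * fact n)" for n
      by (simp add: binomial_fact)
    have "real (k choose i) * m i * m (k - i) = ((h / 2) ^ i * (h / 2) ^ (k - i)) *
        (fact k / (fact i * fact (k - i)) * (fact (2 * i) / fact i) * (fact (2 * (k - i)) / fact (k - i)))"
      using i by (simp add: m_def binomial_fact)
    also have "\<dots> = (h / 2) ^ k * fact k * (real (2 * i choose i) * real (2 * (k - i) choose (k - i)))"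
      unfolding pw fb by (simp add: mult_ac)
    finally show "real (k choose i) * m i * m (k - i) =
      (h / 2) ^ k * fact k * (real (2 * i choose i) * real (2 * (k - i) choose (k - i)))" .
  qed
  also have "\<dots> = (h / 2) ^ k * fact k * 4 ^ k"
    by (simp add: sum_central_binomial flip: sum_distrib_left)
  also have "\<dots> = (2 * h) ^ k * fact k"
  proof -
    have "(2 * h) ^ k = (h / 2 * 4) ^ k" by simp
    also have "\<dots> = (h / 2) ^ k * 4 ^ k" by (rule power_mult_distrib)
    finally show ?thesis by simp
  qed
  finally show ?thesis .
qed


section \<open>Fourier series on the circle\<close>

text \<open>Angles are measured in full turns.\<close>

definition circle_angle :: "real measure" where
  "circle_angle = uniform_measure lborel {0..1}"

lemma sets_circle_angle [simp, measurable_cong]: "sets circle_angle = sets borel"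
  by (simp add: circle_angle_def)

lemma space_circle_angle [simp]: "space circle_angle = UNIV"
  by (simp add: circle_angle_def)

lemma prob_space_circle_angle: "prob_space circle_angle"
  unfolding circle_angle_def by (rule prob_space_uniform_measure) auto

lemma integral_circle_angle:
  fixes f :: "real \<Rightarrow> complex"
  assumes "continuous_on UNIV f"
  shows "(\<integral>t. f t \<partial>circle_angle) = integral {0..1} f"
proof -
  have m: "f \<in> borel_measurable borel" using assms by (rule borel_measurable_continuous_onI)
  have i: "set_integrable lborel {0..1} f"
    unfolding set_integrable_def
    by (intro borel_integrable_compact) (auto intro: continuous_on_subset[OF assms])
  have "(\<integral>t. f t \<partial>circle_angle) = (\<integral>t. indicator {0..1} t *\<^sub>R f t \<partial>lborel)"
  proof -
    have "circle_angle = density lborel (\<lambda>t. ennreal (indicator {0..1} t))"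
      by (auto simp: circle_angle_def uniform_measure_def indicator_def intro!: density_cong)
    thus ?thesis using m integral_density[of f lborel "indicator {0..1}"] by simp
  qed
  also have "\<dots> = integral {0..1} f"
    using set_borel_integral_eq_integral(2)[OF i] by (simp add: set_lebesgue_integral_def)
  finally show ?thesis .
qed

lemma integral_cis_int:
  "(\<integral>t. cis (2 * pi * of_int m * t) \<partial>circle_angle) = (if m = 0 then 1 else 0)"
proof (cases "m = 0")
  case True
  interpret prob_space circle_angle by (rule prob_space_circle_angle)
  show ?thesis using True prob_space by simp
next
  case False
  define c where "c = 2 * pi * of_int m"
  have c: "c \<noteq> 0" using False by (simp add: c_def)
  have "((\<lambda>t. cis (c * t)) has_integral (cis (c * 1) / (\<i> * c) - cis (c * 0) / (\<i> * c))) {0..1}"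
  proof (rule fundamental_theorem_of_calculus)
    fix t :: real
    show "((\<lambda>t. cis (c * t) / (\<i> * c)) has_vector_derivative cis (c * t)) (at t within {0..1})"
    proof -
      have "((\<lambda>z. exp (\<i> * c * z) / (\<i> * c)) has_field_derivative exp (\<i> * c * t)) (at (of_real t))"
        using c by (auto intro!: derivative_eq_intros)
      from has_vector_derivative_real_field[OF this, of "{0..1}"] show ?thesis
        by (simp add: cis_conv_exp mult_ac)
    qed
  qed auto
  moreover have "cis (c * 1) = 1"
    using cis_multiple_2pi[of "of_int m"] by (simp add: c_def mult_ac)
  ultimately have "integral {0..1} (\<lambda>t. cis (c * t)) = 0" by (simp add: integral_unique)
  thus ?thesis using False
    by (subst integral_circle_angle) (auto simp: c_def intro!: continuous_intros)
qed

text \<open>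
  For finite sums this is the orthogonality of the characters. Absolute convergence bounds all partial
  sums by one constant, so that dominated convergence applies.
\<close>

lemma parseval_circle:
  fixes a :: "nat \<Rightarrow> complex"
  assumes "summable (\<lambda>k. cmod (a k))"
  shows "(\<integral>\<^sup>+t. ennreal ((cmod (\<Sum>k. a k * cis (2 * pi * t) ^ k))\<^sup>2) \<partial>circle_angle) =
    (\<Sum>k. ennreal ((cmod (a k))\<^sup>2))"
proof -
  interpret prob_space circle_angle by (rule prob_space_circle_angle)
  define e where "e k t = cis (2 * pi * t) ^ k" for k :: nat and t
  have e_norm [simp]: "cmod (e k t) = 1" for k t by (simp add: e_def norm_power)
  have e_meas [measurable]: "e k \<in> borel_measurable borel" for k
    unfolding e_def by (intro borel_measurable_continuous_onI continuous_intros)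
  define S where "S N t = (\<Sum>k<N. a k * e k t)" for N t
  define A where "A = (\<Sum>k. cmod (a k))"
  have S_meas [measurable]: "S N \<in> borel_measurable borel" for N unfolding S_def by measurable
  have lim: "(\<lambda>N. S N t) \<longlonglongrightarrow> (\<Sum>k. a k * e k t)" for t
    unfolding S_def by (rule summable_LIMSEQ, rule summable_norm_cancel) (simp add: norm_mult assms)
  have bound: "cmod (S N t) \<le> A" for N t
  proof -
    have "cmod (S N t) \<le> (\<Sum>k<N. cmod (a k))"
      unfolding S_def by (rule sum_norm_le) (simp add: norm_mult)
    also have "\<dots> \<le> A" unfolding A_def by (intro sum_le_suminf assms) auto
    finally show ?thesis .
  qed
  have bound2: "(cmod (S N t))\<^sup>2 \<le> A\<^sup>2" for N t by (intro power_mono bound) auto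
  have lim_meas [measurable]: "(\<lambda>t. \<Sum>k. a k * e k t) \<in> borel_measurable borel"
    by measurable
  have orth: "(\<integral>t. e k t * cnj (e l t) \<partial>circle_angle) = (if k = l then 1 else 0)" for k l
  proof -
    have "e k t * cnj (e l t) = cis (2 * pi * of_int (int k - int l) * t)" for t
      by (simp add: e_def Complex.DeMoivre cis_cnj cis_mult algebra_simps)
    thus ?thesis by (simp only: integral_cis_int) auto
  qed
  have fin: "(\<integral>t. (cmod (S N t))\<^sup>2 \<partial>circle_angle) = (\<Sum>k<N. (cmod (a k))\<^sup>2)" for N
  proof -
    have int: "integrable circle_angle (\<lambda>t. e k t * cnj (e l t))" for k l
    proof (rule integrable_const_bound[where B = 1])
      have "(\<lambda>t. e k t * cnj (e l t)) \<in> borel_measurable borel"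
        unfolding e_def by (intro borel_measurable_continuous_onI continuous_intros)
      thus "(\<lambda>t. e k t * cnj (e l t)) \<in> borel_measurable circle_angle" by simp
    qed (auto simp: norm_mult)
    have "complex_of_real (\<integral>t. (cmod (S N t))\<^sup>2 \<partial>circle_angle) =
      (\<integral>t. (\<Sum>k<N. \<Sum>l<N. a k * cnj (a l) * (e k t * cnj (e l t))) \<partial>circle_angle)"
    proof (subst integral_complex_of_real[symmetric], intro Bochner_Integration.integral_cong refl)
      fix t
      have "complex_of_real ((cmod (S N t))\<^sup>2) = (\<Sum>k<N. a k * e k t) * (\<Sum>l<N. cnj (a l) * cnj (e l t))"
        unfolding complex_norm_square S_def by simp
      also have "\<dots> = (\<Sum>k<N. \<Sum>l<N. a k * cnj (a l) * (e k t * cnj (e l t)))"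
        unfolding sum_product by (simp add: mult_ac)
      finally show "complex_of_real ((cmod (S N t))\<^sup>2) =
        (\<Sum>k<N. \<Sum>l<N. a k * cnj (a l) * (e k t * cnj (e l t)))" .
    qed
    also have "\<dots> = (\<Sum>k<N. \<Sum>l<N. a k * cnj (a l) * (if k = l then 1 else 0))"
      by (simp add: int orth)
    also have "\<dots> = (\<Sum>k<N. complex_of_real ((cmod (a k))\<^sup>2))"
      unfolding complex_norm_square by (simp add: if_distrib cong: if_cong)
    finally have "complex_of_real (\<integral>t. (cmod (S N t))\<^sup>2 \<partial>circle_angle) =
      complex_of_real (\<Sum>k<N. (cmod (a k))\<^sup>2)" by simp
    thus ?thesis by (simp only: of_real_eq_iff)
  qed
  have "(\<lambda>N. \<integral>t. (cmod (S N t))\<^sup>2 \<partial>circle_angle)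
     \<longlonglongrightarrow> (\<integral>t. (cmod (\<Sum>k. a k * e k t))\<^sup>2 \<partial>circle_angle)"
    by (rule integral_dominated_convergence[where w = "\<lambda>_. A\<^sup>2"])
       (auto intro!: tendsto_intros lim bound2)
  hence sums: "(\<lambda>k. (cmod (a k))\<^sup>2) sums (\<integral>t. (cmod (\<Sum>k. a k * e k t))\<^sup>2 \<partial>circle_angle)"
    by (simp add: fin sums_def)
  have limbound: "(cmod (\<Sum>k. a k * e k t))\<^sup>2 \<le> A\<^sup>2" for t
    by (rule LIMSEQ_le_const2[OF tendsto_power[OF tendsto_norm[OF lim]]]) (use bound2 in auto)
  have "(\<integral>\<^sup>+t. ennreal ((cmod (\<Sum>k. a k * e k t))\<^sup>2) \<partial>circle_angle) =
    ennreal (\<integral>t. (cmod (\<Sum>k. a k * e k t))\<^sup>2 \<partial>circle_angle)"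
    by (intro nn_integral_eq_integral integrable_const_bound[where B = "A\<^sup>2"]) (auto simp: limbound)
  also have "\<dots> = (\<Sum>k. ennreal ((cmod (a k))\<^sup>2))"
    using sums by (subst suminf_ennreal2) (auto simp: sums_iff)
  finally show ?thesis by (simp add: e_def)
qed


section \<open>Taylor coefficients in one of several variables\<close>

text \<open>
  Cauchy's formula on a unit circle. In this form the Taylor coefficient is an integral that depends
  on the function through its values, and hence continuously on parameters.
\<close>

lemma taylor_coefficient_integral:
  assumes u: "u holomorphic_on UNIV"
  shows "(deriv ^^ k) u w / fact k =
    integral {0..1} (\<lambda>t. u (w + cis (2 * pi * t)) * cis (- (2 * pi * real k * t)))"
proof -
  have cp: "circlepath w 1 t = w + cis (2 * pi * t)" for t
    by (simp add: circlepath cis_conv_exp mult_ac)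
  have "((\<lambda>z. u z / (z - w) ^ Suc k) has_contour_integral
      ((2 * pi * \<i>) / (fact k) * (deriv ^^ k) u w)) (circlepath w 1)"
    by (rule Cauchy_has_contour_integral_higher_derivative_circlepath)
       (auto intro!: holomorphic_on_imp_continuous_on holomorphic_on_subset[OF u])
  hence "((\<lambda>t. u (w + cis (2 * pi * t)) / cis (2 * pi * t) ^ Suc k * (2 * pi * \<i> * cis (2 * pi * t)))
     has_integral ((2 * pi * \<i>) / (fact k) * (deriv ^^ k) u w)) {0..1}"
    unfolding has_contour_integral_def
    by (rule has_integral_eq[rotated])
       (auto simp: cp vector_derivative_circlepath01 cis_conv_exp mult_ac)
  from has_integral_mult_right[OF this, of "1 / (2 * pi * \<i>)"]
  have "((\<lambda>t. u (w + cis (2 * pi * t)) * cis (- (2 * pi * real k * t)))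
     has_integral ((deriv ^^ k) u w / fact k)) {0..1}"
  proof (rule has_integral_eq_rhs[OF has_integral_eq[rotated]])
    fix t :: real
    have "cis (- (2 * pi * real k * t)) = inverse (cis (2 * pi * t) ^ k)"
      by (simp add: Complex.DeMoivre mult_ac flip: cis_inverse)
    thus "1 / (2 * pi * \<i>) * (u (w + cis (2 * pi * t)) / cis (2 * pi * t) ^ Suc k *
        (2 * pi * \<i> * cis (2 * pi * t))) = u (w + cis (2 * pi * t)) * cis (- (2 * pi * real k * t))"
      by (simp add: field_simps)
  qed simp
  thus ?thesis by (simp add: integral_unique)
qed

text \<open>
  Differentiation under the integral sign, where Cauchy's formula provides the continuity of the
  derivative in both variables.
\<close>

lemma holomorphic_integral_parameter:
  fixes \<phi> :: "complex \<Rightarrow> real \<Rightarrow> complex"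
  assumes cont: "continuous_on UNIV (\<lambda>(w, t). \<phi> w t)"
    and hol: "\<And>t. (\<lambda>w. \<phi> w t) holomorphic_on UNIV"
  shows "(\<lambda>w. integral {0..1} (\<phi> w)) holomorphic_on UNIV"
proof -
  have c: "continuous_on A (\<lambda>x. \<phi> (g x) (h x))" if "continuous_on A g" "continuous_on A h"
    for A :: "'b::topological_space set" and g h
    using continuous_on_compose2[OF cont continuous_on_Pair[OF that]] by simp
  have "(\<lambda>w. integral (cbox 0 1) (\<phi> w)) holomorphic_on UNIV"
  proof (rule leibniz_rule_holomorphic)
    define \<psi> where "\<psi> w t = deriv (\<lambda>w. \<phi> w t) w" for w t
    show "((\<lambda>w. \<phi> w t) has_field_derivative \<psi> w t) (at w within UNIV)" for w t
      using hol[of t] by (simp add: \<psi>_def holomorphic_derivI)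
    show "\<phi> w integrable_on cbox 0 1" for w
      by (intro integrable_continuous c continuous_intros)
    have "continuous_on UNIV (\<lambda>p. integral (cbox 0 1)
        (\<lambda>s. \<phi> (fst p + cis (2 * pi * s)) (snd p) * cis (- (2 * pi * s))))"
      by (rule integral_continuous_on_param)
         (auto simp: case_prod_beta intro!: continuous_intros c)
    moreover have "\<psi> w t = integral (cbox 0 1) (\<lambda>s. \<phi> (w + cis (2 * pi * s)) t * cis (- (2 * pi * s)))"
      for w t
      using taylor_coefficient_integral[OF hol[of t], of 1 w] by (simp add: \<psi>_def)
    ultimately show "continuous_on (UNIV \<times> cbox 0 1) (\<lambda>(w, t). \<psi> w t)"
      by (simp add: case_prod_beta) (rule continuous_on_subset, auto)
  qed simp
  thus ?thesis by simp
qed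

text \<open>
  By Osgood's lemma, joint continuity together with holomorphy in each variable describes the entire
  functions of several variables. The arguments range over all families, so that functions of
  different finite sets of variables live on the same space; the variables that occur are recorded by
  \<open>depends_on\<close>.
\<close>

definition entire :: "(('g \<Rightarrow> complex) \<Rightarrow> complex) \<Rightarrow> bool" where
  "entire f \<longleftrightarrow> continuous_on UNIV f \<and> (\<forall>z j. (\<lambda>\<zeta>. f (z(j := \<zeta>))) holomorphic_on UNIV)"

definition depends_on :: "'g set \<Rightarrow> (('g \<Rightarrow> complex) \<Rightarrow> 'b) \<Rightarrow> bool" where
  "depends_on F f \<longleftrightarrow> (\<forall>z z'. (\<forall>j\<in>F. z j = z' j) \<longrightarrow> f z = f z')"

definition taylor_coeff :: "'g \<Rightarrow> nat \<Rightarrow> (('g \<Rightarrow> complex) \<Rightarrow> complex) \<Rightarrow> ('g \<Rightarrow> complex) \<Rightarrow> complex" where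
  "taylor_coeff j k f z = (deriv ^^ k) (\<lambda>\<zeta>. f (z(j := \<zeta>))) 0 / fact k"

lemma taylor_coeff_integral:
  assumes "entire f"
  shows "taylor_coeff j k f z =
    integral {0..1} (\<lambda>t. f (z(j := cis (2 * pi * t))) * cis (- (2 * pi * real k * t)))"
  using taylor_coefficient_integral[of "\<lambda>\<zeta>. f (z(j := \<zeta>))" k 0] assms
  by (simp add: entire_def taylor_coeff_def)

lemma entire_taylor_coeff:
  assumes f: "entire f"
  shows "entire (taylor_coeff j k f)"
proof -
  have cf: "continuous_on UNIV f" using f by (simp add: entire_def)
  have upd: "continuous_on A (\<lambda>x. (g x)(j := h x))"
    if "continuous_on A g" "continuous_on A h"
    for A :: "'b::topological_space set" and g :: "'b \<Rightarrow> 'a \<Rightarrow> complex" and h and j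
  proof (rule continuous_on_coordinatewise_then_product)
    fix i
    have "continuous_on A (\<lambda>x. g x i)"
      using that(1) by (rule continuous_on_product_then_coordinatewise)
    thus "continuous_on A (\<lambda>x. ((g x)(j := h x)) i)"
      using that(2) by (cases "i = j") auto
  qed
  show ?thesis unfolding entire_def
  proof (intro conjI allI)
    have "continuous_on UNIV (\<lambda>z. integral (cbox 0 1)
        (\<lambda>t. f (z(j := cis (2 * pi * t))) * cis (- (2 * pi * real k * t))))"
    proof (rule integral_continuous_on_param)
      have "continuous_on (UNIV \<times> cbox 0 1) (f \<circ> (\<lambda>p. (fst p)(j := cis (2 * pi * snd p))))"
        by (intro continuous_on_compose upd continuous_intros continuous_on_subset[OF cf]) auto
      thus "continuous_on (UNIV \<times> cbox 0 1)
        (\<lambda>(z, t). f (z(j := cis (2 * pi * t))) * cis (- (2 * pi * real k * t)))"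
        by (auto simp: case_prod_beta comp_def intro!: continuous_intros)
    qed
    thus "continuous_on UNIV (taylor_coeff j k f)"
      by (simp add: taylor_coeff_integral[OF f, abs_def])
  next
    fix z i
    show "(\<lambda>\<zeta>. taylor_coeff j k f (z(i := \<zeta>))) holomorphic_on UNIV"
    proof (cases "i = j")
      case True
      thus ?thesis by (simp add: taylor_coeff_def)
    next
      case False
      have "(\<lambda>\<zeta>. integral {0..1} (\<lambda>t. f (z(i := \<zeta>, j := cis (2 * pi * t))) *
          cis (- (2 * pi * real k * t)))) holomorphic_on UNIV"
      proof (rule holomorphic_integral_parameter)
        have "continuous_on UNIV (f \<circ> (\<lambda>p. z(i := fst p, j := cis (2 * pi * snd p))))"
          by (intro continuous_on_compose upd continuous_intros continuous_on_subset[OF cf]) auto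
        thus "continuous_on UNIV (\<lambda>(\<zeta>, t). f (z(i := \<zeta>, j := cis (2 * pi * t))) *
          cis (- (2 * pi * real k * t)))"
          by (auto simp: case_prod_beta comp_def intro!: continuous_intros)
        show "(\<lambda>\<zeta>. f (z(i := \<zeta>, j := cis (2 * pi * t))) * cis (- (2 * pi * real k * t)))
          holomorphic_on UNIV" for t
        proof -
          have "(\<lambda>\<zeta>. f ((z(j := cis (2 * pi * t)))(i := \<zeta>))) holomorphic_on UNIV"
            using f unfolding entire_def by blast
          thus ?thesis using False by (auto simp: fun_upd_twist intro!: holomorphic_intros)
        qed
      qed
      thus ?thesis by (simp add: taylor_coeff_integral[OF f])
    qed
  qed
qed

lemma depends_on_taylor_coeff:
  assumes "depends_on (insert j F) f"
  shows "depends_on F (taylor_coeff j k f)"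
  unfolding depends_on_def
proof (intro allI impI)
  fix z z' :: "'a \<Rightarrow> complex" assume "\<forall>i\<in>F. z i = z' i"
  hence "f (z(j := \<zeta>)) = f (z'(j := \<zeta>))" for \<zeta>
    using assms unfolding depends_on_def by auto
  thus "taylor_coeff j k f z = taylor_coeff j k f z'" by (simp add: taylor_coeff_def)
qed

lemma taylor_coeff_sums:
  assumes "entire f"
  shows "(\<lambda>k. taylor_coeff j k f z * \<zeta> ^ k) sums f (z(j := \<zeta>))"
proof -
  have "(\<lambda>\<zeta>. f (z(j := \<zeta>))) holomorphic_on ball 0 (cmod \<zeta> + 1)"
    using assms by (auto simp: entire_def intro: holomorphic_on_subset)
  from holomorphic_power_series[OF this, of \<zeta>] show ?thesis by (simp add: taylor_coeff_def)
qed

lemma taylor_coeff_summable: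
  assumes "entire f"
  shows "summable (\<lambda>k. cmod (taylor_coeff j k f z * \<zeta> ^ k))"
proof (rule powser_insidea)
  show "summable (\<lambda>k. taylor_coeff j k f z * (complex_of_real (cmod \<zeta> + 1)) ^ k)"
    using taylor_coeff_sums[OF assms] by (rule sums_summable)
  show "cmod \<zeta> < cmod (complex_of_real (cmod \<zeta> + 1))" 
    unfolding norm_of_real by simp
qed

text \<open>Finitely many variables are transported to a countable index type, where product
  measurability and Borel measurability agree.\<close>

lemma borel_measurable_depends_on:
  fixes f :: "('g \<Rightarrow> complex) \<Rightarrow> complex"
  assumes "finite F" and cont: "continuous_on UNIV f" and dep: "depends_on F f"
  shows "f \<in> borel_measurable (PiM F (\<lambda>_. borel))"
proof -
  obtain e :: "nat \<Rightarrow> 'g" and n where e: "bij_betw e {..<n} F"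
    using ex_bij_betw_nat_finite[OF assms(1)] by (auto simp: atLeast0LessThan)
  define d where "d = the_inv_into {..<n} e"
  have d: "d j < n" "e (d j) = j" if "j \<in> F" for j
    using e that the_inv_into_into[of e "{..<n}" j "{..<n}"] f_the_inv_into_f[of e "{..<n}" j]
    by (auto simp: d_def bij_betw_def)
  define enc where "enc z i = (if i < n then z (e i) else (0 :: complex))" for z :: "'g \<Rightarrow> complex" and i :: nat
  define dec where "dec y j = (if j \<in> F then y (d j) else (0 :: complex))" for y :: "nat \<Rightarrow> complex" and j
  have "continuous_on UNIV dec"
  proof (rule continuous_on_coordinatewise_then_product)
    show "continuous_on UNIV (\<lambda>y. dec y j)" for j
      by (cases "j \<in> F") (simp_all add: dec_def continuous_on_product_coordinates)
  qed
  hence "continuous_on UNIV (f \<circ> dec)"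
    by (intro continuous_on_compose continuous_on_subset[OF cont]) auto
  hence [measurable]: "f \<circ> dec \<in> borel_measurable borel" by (rule borel_measurable_continuous_onI)
  have [measurable]: "enc \<in> borel_measurable (PiM F (\<lambda>_. borel))"
  proof (rule measurable_coordinatewise_then_product)
    fix i
    show "(\<lambda>z. enc z i) \<in> borel_measurable (PiM F (\<lambda>_. borel))"
    proof (cases "i < n")
      case True
      hence "e i \<in> F" using e by (auto simp: bij_betw_def)
      thus ?thesis using True by (simp add: enc_def)
    qed (simp add: enc_def)
  qed
  have "f z = (f \<circ> dec) (enc z)" for z
    using dep unfolding depends_on_def comp_def by (auto simp: dec_def enc_def d)
  hence "f = (f \<circ> dec) \<circ> enc" by (auto simp: fun_eq_iff)
  moreover have "(f \<circ> dec) \<circ> enc \<in> borel_measurable (PiM F (\<lambda>_. borel))"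
    by (rule measurable_comp[of _ _ borel]) measurable
  ultimately show ?thesis by simp
qed


section \<open>Density of polynomials among entire functions\<close>

abbreviation gauss_prod :: "real \<Rightarrow> 'g set \<Rightarrow> ('g \<Rightarrow> complex) measure" where
  "gauss_prod h F \<equiv> PiM F (\<lambda>_. gauss_complex h)"

lemma sets_gauss_prod: "sets (gauss_prod h F) = sets (PiM F (\<lambda>_. borel))"
  by (intro sets_PiM_cong) auto

lemma borel_measurable_coordinate:
  assumes "j \<in> F"
  shows "(\<lambda>z. z j) \<in> borel_measurable (gauss_prod h F)"
  using measurable_component_singleton[OF assms, of "\<lambda>_. gauss_complex h"]
  by (simp add: measurable_cong_sets[OF refl sets_gauss_complex])

lemma borel_measurable_gauss_prod:
  fixes f :: "('g \<Rightarrow> complex) \<Rightarrow> complex"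
  assumes "finite F" "continuous_on UNIV f" "depends_on F f"
  shows "f \<in> borel_measurable (gauss_prod h F)"
  using borel_measurable_depends_on[OF assms] measurable_cong_sets[OF sets_gauss_prod refl] by blast

lemma depends_on_mono: "depends_on F f \<Longrightarrow> F \<subseteq> F' \<Longrightarrow> depends_on F' f"
  unfolding depends_on_def by blast

lemma product_sigma_finite_gauss: "h > 0 \<Longrightarrow> product_sigma_finite (\<lambda>_. gauss_complex h)"
  by (simp add: product_sigma_finite_def prob_space_gauss_complex prob_space_imp_sigma_finite)

text \<open>
  Rotation invariance in one variable, averaged over all angles, reduces integrals over that variable
  to integrals over circles.
\<close>

lemma nn_integral_gauss_prod_average:
  assumes h: "h > 0" and F: "finite F" "j \<in> F"
    and [measurable]: "\<phi> \<in> borel_measurable (gauss_prod h F)"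
  shows "(\<integral>\<^sup>+z. \<phi> z \<partial>gauss_prod h F) =
    (\<integral>\<^sup>+z. \<integral>\<^sup>+t. \<phi> (z(j := cis (2 * pi * t) * z j)) \<partial>circle_angle \<partial>gauss_prod h F)"
proof -
  interpret product_sigma_finite "\<lambda>_. gauss_complex h" using h by (rule product_sigma_finite_gauss)
  interpret C: prob_space circle_angle by (rule prob_space_circle_angle)
  interpret finite_product_sigma_finite "\<lambda>_. gauss_complex h" F by standard fact
  interpret pair_sigma_finite "gauss_prod h F" circle_angle ..
  have [measurable]: "(\<lambda>t. cis (2 * pi * t)) \<in> borel_measurable borel"
    by (intro borel_measurable_continuous_onI continuous_intros)
  have upd: "(\<lambda>(z, t). z(j := cis (2 * pi * t) * z j)) \<in>
      measurable (gauss_prod h F \<Otimes>\<^sub>M circle_angle) (gauss_prod h F)"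
    unfolding case_prod_beta
  proof (rule measurable_fun_upd[where J = F])
    show "F = F \<union> {j}" using F by auto
    have "(\<lambda>x. fst x j) \<in> borel_measurable (gauss_prod h F \<Otimes>\<^sub>M circle_angle)"
      by (rule measurable_compose[OF measurable_fst borel_measurable_coordinate[OF F(2)]])
    thus "(\<lambda>x. cis (2 * pi * snd x) * fst x j) \<in>
        measurable (gauss_prod h F \<Otimes>\<^sub>M circle_angle) (gauss_complex h)"
      by (simp add: measurable_cong_sets[OF refl sets_gauss_complex]) 
  qed simp
  have inner: "(\<integral>\<^sup>+z. \<phi> (z(j := cis \<theta> * z j)) \<partial>gauss_prod h F) = (\<integral>\<^sup>+z. \<phi> z \<partial>gauss_prod h F)"
    for \<theta>
  proof -
    define F' where "F' = F - {j}"
    have F': "finite F'" "j \<notin> F'" "F = insert j F'" using F by (auto simp: F'_def)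
    have meas: "(\<lambda>z. \<phi> (z(j := cis \<theta> * z j))) \<in> borel_measurable (gauss_prod h F)"
      using measurable_compose[OF measurable_compose[OF measurable_Pair2' upd], of "\<theta> / (2 * pi)" \<phi>]
      by simp
    have "(\<integral>\<^sup>+z. \<phi> (z(j := cis \<theta> * z j)) \<partial>gauss_prod h F) =
      (\<integral>\<^sup>+z. \<integral>\<^sup>+\<zeta>. \<phi> (z(j := cis \<theta> * \<zeta>)) \<partial>gauss_complex h \<partial>gauss_prod h F')"
      using product_nn_integral_insert[OF F'(1,2), folded F'(3), OF meas] by simp
    also have "\<dots> = (\<integral>\<^sup>+z. \<integral>\<^sup>+\<zeta>. \<phi> (z(j := \<zeta>)) \<partial>gauss_complex h \<partial>gauss_prod h F')"
    proof (rule nn_integral_cong, rule nn_integral_gauss_complex_rotate[OF h])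
      fix z assume z: "z \<in> space (gauss_prod h F')"
      have "(\<lambda>\<zeta>. z(j := \<zeta>)) \<in> measurable (gauss_complex h) (gauss_prod h F)"
        using measurable_component_update[OF z F'(2)] by (simp add: F'(3))
      hence "(\<lambda>\<zeta>. \<phi> (z(j := \<zeta>))) \<in> borel_measurable (gauss_complex h)" by measurable
      thus "(\<lambda>\<zeta>. \<phi> (z(j := \<zeta>))) \<in> borel_measurable borel"
        using measurable_cong_sets[OF sets_gauss_complex refl] by blast
    qed
    also have "\<dots> = (\<integral>\<^sup>+z. \<phi> z \<partial>gauss_prod h F)"
      using product_nn_integral_insert[OF F'(1,2), folded F'(3)] by simp
    finally show ?thesis .
  qed
  have "(\<integral>\<^sup>+z. \<integral>\<^sup>+t. \<phi> (z(j := cis (2 * pi * t) * z j)) \<partial>circle_angle \<partial>gauss_prod h F) =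
    (\<integral>\<^sup>+t. \<integral>\<^sup>+z. \<phi> (z(j := cis (2 * pi * t) * z j)) \<partial>gauss_prod h F \<partial>circle_angle)"
    by (rule Fubini'[symmetric]) (use measurable_compose[OF upd, of \<phi> borel] in \<open>simp add: case_prod_beta\<close>)
  also have "\<dots> = (\<integral>\<^sup>+z. \<phi> z \<partial>gauss_prod h F)"
    by (simp add: inner C.emeasure_space_1[simplified])
  finally show ?thesis by simp
qed

text \<open>Parseval's identity on each circle, integrated over all circles.\<close>

lemma nn_integral_taylor_tail:
  assumes h: "h > 0" and F: "finite F" "j \<in> F" and f: "entire f" "depends_on F f"
  shows "(\<integral>\<^sup>+z. ennreal ((cmod (f z - (\<Sum>k<N. taylor_coeff j k f z * z j ^ k)))\<^sup>2) \<partial>gauss_prod h F) =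
    (\<Sum>k. if k < N then 0 else
      (\<integral>\<^sup>+z. ennreal ((cmod (taylor_coeff j k f z * z j ^ k))\<^sup>2) \<partial>gauss_prod h F))"
proof -
  have coord: "(\<lambda>z. z j) \<in> borel_measurable (gauss_prod h F)"
    by (rule borel_measurable_coordinate[OF F(2)])
  have fm: "f \<in> borel_measurable (gauss_prod h F)"
    using F f by (intro borel_measurable_gauss_prod) (auto simp: entire_def)
  have cm: "taylor_coeff j k f \<in> borel_measurable (gauss_prod h F)" for k
  proof (rule borel_measurable_gauss_prod[OF F(1)])
    show "continuous_on UNIV (taylor_coeff j k f)"
      using entire_taylor_coeff[OF f(1)] by (simp add: entire_def)
    show "depends_on F (taylor_coeff j k f)"
      by (rule depends_on_taylor_coeff, rule depends_on_mono[OF f(2)]) auto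
  qed
  note [measurable] = coord fm cm
  define R where "R z = f z - (\<Sum>k<N. taylor_coeff j k f z * z j ^ k)" for z
  have [measurable]: "R \<in> borel_measurable (gauss_prod h F)" unfolding R_def by measurable
  have "(\<integral>\<^sup>+z. ennreal ((cmod (R z))\<^sup>2) \<partial>gauss_prod h F) =
    (\<integral>\<^sup>+z. \<integral>\<^sup>+t. ennreal ((cmod (R (z(j := cis (2 * pi * t) * z j))))\<^sup>2) \<partial>circle_angle \<partial>gauss_prod h F)"
    by (rule nn_integral_gauss_prod_average[OF h F]) measurable
  also have "\<dots> = (\<integral>\<^sup>+z. (\<Sum>k. if k < N then 0 else
      ennreal ((cmod (taylor_coeff j k f z * z j ^ k))\<^sup>2)) \<partial>gauss_prod h F)"
  proof (rule nn_integral_cong)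
    fix z
    define a where "a k = (if k < N then 0 else taylor_coeff j k f z * z j ^ k)" for k
    have summ: "summable (\<lambda>k. cmod (a k))"
      by (rule summable_comparison_test'[OF taylor_coeff_summable[OF f(1), of j z "z j"], of 0])
         (simp add: a_def)
    have R: "R (z(j := cis \<theta> * z j)) = (\<Sum>k. a k * cis \<theta> ^ k)" for \<theta>
    proof -
      define b where "b k = taylor_coeff j k f z * (cis \<theta> * z j) ^ k" for k
      have upd: "taylor_coeff j k f (z(j := \<zeta>)) = taylor_coeff j k f z" for k \<zeta>
        by (simp add: taylor_coeff_def)
      have "b sums f (z(j := cis \<theta> * z j))"
        unfolding b_def by (rule taylor_coeff_sums[OF f(1)])
      moreover have "(\<lambda>k. if k \<in> {..<N} then b k else 0) sums (\<Sum>k<N. b k)"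
        by (rule sums_If_finite_set) simp
      ultimately have "(\<lambda>k. b k - (if k \<in> {..<N} then b k else 0)) sums R (z(j := cis \<theta> * z j))"
        unfolding R_def upd fun_upd_same b_def[symmetric] by (rule sums_diff)
      also have "(\<lambda>k. b k - (if k \<in> {..<N} then b k else 0)) = (\<lambda>k. a k * cis \<theta> ^ k)"
        by (auto simp: fun_eq_iff a_def b_def power_mult_distrib mult_ac)
      finally show ?thesis by (rule sums_unique)
    qed
    show "(\<integral>\<^sup>+t. ennreal ((cmod (R (z(j := cis (2 * pi * t) * z j))))\<^sup>2) \<partial>circle_angle) =
      (\<Sum>k. if k < N then 0 else ennreal ((cmod (taylor_coeff j k f z * z j ^ k))\<^sup>2))"
      unfolding R parseval_circle[OF summ] by (intro suminf_cong) (auto simp: a_def)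
  qed
  also have "\<dots> = (\<Sum>k. \<integral>\<^sup>+z. (if k < N then 0 else
      ennreal ((cmod (taylor_coeff j k f z * z j ^ k))\<^sup>2)) \<partial>gauss_prod h F)"
    by (rule nn_integral_suminf) measurable
  finally show ?thesis unfolding R_def by (simp add: if_distrib[of "\<lambda>g. integral\<^sup>N _ g"] cong: if_cong)
     (intro suminf_cong, auto)
qed

definition monomials :: "'g set \<Rightarrow> (('g \<Rightarrow> complex) \<Rightarrow> complex) set" where
  "monomials F = {\<lambda>z. \<Prod>j\<in>F. z j ^ \<alpha> j |\<alpha>. True}"

text \<open>
  A power of a further variable multiplies the integral by a constant, which is positive and finite;
  hence the product and the first factor are square integrable at the same time.
\<close>

lemma nn_integral_times_coordinate_power:
  assumes h: "h > 0" and F: "finite F" "j \<notin> F" and q: "depends_on F q"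
    and m: "q \<in> borel_measurable (gauss_prod h F)" "q \<in> borel_measurable (gauss_prod h (insert j F))"
  shows "(\<integral>\<^sup>+z. ennreal ((cmod (q z * z j ^ k))\<^sup>2) \<partial>gauss_prod h (insert j F)) =
    (\<integral>\<^sup>+z. ennreal ((cmod (q z))\<^sup>2) \<partial>gauss_prod h F) * ennreal ((2 * h) ^ k * fact k)"
proof -
  interpret product_sigma_finite "\<lambda>_. gauss_complex h" using h by (rule product_sigma_finite_gauss)
  have norm_meas: "(\<lambda>\<zeta>. ennreal ((cmod \<zeta>)\<^sup>2 ^ k)) \<in> borel_measurable (gauss_complex h)"
    by measurable
  have [measurable]: "(\<lambda>z. z j) \<in> borel_measurable (gauss_prod h (insert j F))"
    by (rule borel_measurable_coordinate) simp
  note m [measurable]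
  have qu: "q (z(j := \<zeta>)) = q z" for z \<zeta>
    using q F unfolding depends_on_def by (metis fun_upd_other)
  have "(\<integral>\<^sup>+z. ennreal ((cmod (q z * z j ^ k))\<^sup>2) \<partial>gauss_prod h (insert j F)) =
    (\<integral>\<^sup>+z. \<integral>\<^sup>+\<zeta>. ennreal ((cmod (q z * \<zeta> ^ k))\<^sup>2) \<partial>gauss_complex h \<partial>gauss_prod h F)"
    by (subst product_nn_integral_insert[OF F]) (auto simp: qu)
  also have "\<dots> = (\<integral>\<^sup>+z. ennreal ((cmod (q z))\<^sup>2) * (\<integral>\<^sup>+\<zeta>. ennreal ((cmod \<zeta>)\<^sup>2 ^ k) \<partial>gauss_complex h)
      \<partial>gauss_prod h F)"
  proof (intro nn_integral_cong)
    fix z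
    have "(cmod (q z * \<zeta> ^ k))\<^sup>2 = (cmod (q z))\<^sup>2 * (cmod \<zeta>)\<^sup>2 ^ k" for \<zeta>
      by (simp only: norm_mult norm_power power_mult_distrib power_mult[symmetric] mult.commute)
    thus "(\<integral>\<^sup>+\<zeta>. ennreal ((cmod (q z * \<zeta> ^ k))\<^sup>2) \<partial>gauss_complex h) =
        ennreal ((cmod (q z))\<^sup>2) * (\<integral>\<^sup>+\<zeta>. ennreal ((cmod \<zeta>)\<^sup>2 ^ k) \<partial>gauss_complex h)"
      by (simp add: ennreal_mult nn_integral_cmult norm_meas)
  qed
  also have "\<dots> = (\<integral>\<^sup>+z. ennreal ((cmod (q z))\<^sup>2) \<partial>gauss_prod h F) * ennreal ((2 * h) ^ k * fact k)"
    by (simp add: nn_integral_gauss_complex_moment[OF h] nn_integral_multc)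
  finally show ?thesis .
qed

lemma cspan_monomials_measurable:
  assumes "finite F" "F \<subseteq> F'" "p \<in> cspan (monomials F)"
  shows "p \<in> borel_measurable (gauss_prod h F')" "depends_on F p"
proof -
  obtain T c where T: "finite T" "T \<subseteq> monomials F" "p = (\<lambda>z. \<Sum>g\<in>T. c g * g z)"
    using assms(3) by (auto simp: cspan_def)
  have co: "(\<lambda>z. z j) \<in> borel_measurable (gauss_prod h F')" if "j \<in> F" for j
    using that assms(2) by (intro borel_measurable_coordinate) auto
  have "g \<in> borel_measurable (gauss_prod h F') \<and> depends_on F g" if gT: "g \<in> T" for g
  proof -
    obtain \<alpha> where g: "g = (\<lambda>z. \<Prod>j\<in>F. z j ^ \<alpha> j)" using gT T(2) unfolding monomials_def by blast
    show ?thesis unfolding g depends_on_def using co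
      by (auto intro!: borel_measurable_prod borel_measurable_power prod.cong)
  qed
  note g = this
  show "p \<in> borel_measurable (gauss_prod h F')"
    unfolding T(3) using g by (intro borel_measurable_sum borel_measurable_times) auto
  show "depends_on F p"
    unfolding T(3) depends_on_def using g
    by (auto simp: depends_on_def intro!: sum.cong)
qed

lemma cspan_monomials_insert:
  assumes "finite F" "j \<notin> F" "p \<in> cspan (monomials F)"
  shows "(\<lambda>z. p z * z j ^ k) \<in> cspan (monomials (insert j F))"
proof -
  obtain T c where T: "finite T" "T \<subseteq> monomials F" "p = (\<lambda>z. \<Sum>g\<in>T. c g * g z)"
    using assms(3) by (auto simp: cspan_def)
  have "(\<lambda>z. g z * z j ^ k) \<in> monomials (insert j F)" if gT: "g \<in> T" for g
  proof -
    obtain \<alpha> where g: "g = (\<lambda>z. \<Prod>j\<in>F. z j ^ \<alpha> j)" using gT T(2) unfolding monomials_def by blast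
    have "(\<Prod>i\<in>F. z i ^ (\<alpha>(j := k)) i) = g z" for z
      unfolding g using assms(2) by (intro prod.cong) auto
    hence "(\<lambda>z. g z * z j ^ k) = (\<lambda>z. \<Prod>i\<in>insert j F. z i ^ (\<alpha>(j := k)) i)"
      using assms(1,2) by (simp add: fun_eq_iff mult.commute)
    thus ?thesis unfolding monomials_def by blast
  qed
  hence "(\<lambda>z. \<Sum>g\<in>T. c g * (g z * z j ^ k)) \<in> cspan (monomials (insert j F))"
    by (intro cspan_sum cspan_cmult cspan_base) auto
  thus ?thesis by (simp add: T(3) sum_distrib_right mult.assoc)
qed

lemma L2_times_coordinate_power:
  assumes h: "h > 0" and F: "finite F" "j \<notin> F" and q: "depends_on F q"
    and qL: "q \<in> L2 (gauss_prod h F)" and m: "q \<in> borel_measurable (gauss_prod h (insert j F))"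
  shows "(\<lambda>z. q z * z j ^ k) \<in> L2 (gauss_prod h (insert j F))"
    and "L2_norm (gauss_prod h (insert j F)) (\<lambda>z. q z * z j ^ k) =
      L2_norm (gauss_prod h F) q * sqrt ((2 * h) ^ k * fact k)"
proof -
  have [measurable]: "(\<lambda>z. z j) \<in> borel_measurable (gauss_prod h (insert j F))"
    by (rule borel_measurable_coordinate) simp
  note m [measurable]
  have eq: "(\<integral>\<^sup>+z. ennreal ((cmod (q z * z j ^ k))\<^sup>2) \<partial>gauss_prod h (insert j F)) =
    ennreal ((L2_norm (gauss_prod h F) q)\<^sup>2 * ((2 * h) ^ k * fact k))"
    using nn_integral_times_coordinate_power[OF h F q _ m, of k] qL h
    by (simp add: L2_measurable ennreal_L2_norm_power2[symmetric] ennreal_mult)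
  show L: "(\<lambda>z. q z * z j ^ k) \<in> L2 (gauss_prod h (insert j F))"
    unfolding L2_iff_nn_integral eq by (auto simp: ennreal_less_top)
  have "(L2_norm (gauss_prod h (insert j F)) (\<lambda>z. q z * z j ^ k))\<^sup>2 =
      (L2_norm (gauss_prod h F) q * sqrt ((2 * h) ^ k * fact k))\<^sup>2"
    using eq h unfolding ennreal_L2_norm_power2[OF L, symmetric]
    by (simp add: power_mult_distrib)
  thus "L2_norm (gauss_prod h (insert j F)) (\<lambda>z. q z * z j ^ k) =
      L2_norm (gauss_prod h F) q * sqrt ((2 * h) ^ k * fact k)"
    using h by (subst (asm) power2_eq_iff_nonneg) auto
qed

text \<open>
  Expand in the Taylor series of one of the variables: by Parseval's identity on circles the partial
  sums converge in \<open>L\<^sup>2\<close>, and the coefficients are entire square-integrable functions of one variable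
  less.
\<close>

theorem entire_in_closure_monomials:
  assumes h: "h > 0" and "finite F"
    and "entire f" "depends_on F f" "f \<in> L2 (gauss_prod h F)"
  shows "f \<in> L2_closure (gauss_prod h F) (cspan (monomials F))"
  using assms(2-)
proof (induction F arbitrary: f rule: finite_induct)
  case empty
  define g :: "('a \<Rightarrow> complex) \<Rightarrow> complex" where "g = (\<lambda>z. \<Prod>j\<in>{}. z j ^ undefined j)"
  have "g \<in> monomials {}" unfolding g_def monomials_def by blast
  hence "(\<lambda>z. f (\<lambda>_. 0) * g z) \<in> cspan (monomials {})" by (intro cspan_cmult cspan_base)
  moreover have "(\<lambda>z. f (\<lambda>_. 0) * g z) = f"
    using empty.prems(2) by (auto simp: g_def depends_on_def fun_eq_iff)
  ultimately show ?case using empty.prems(3) subset_L2_closure by fastforce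
next
  case (insert j F)
  note f = insert.prems
  let ?M = "gauss_prod h (insert j F)"
  let ?V = "L2_closure ?M (cspan (monomials (insert j F)))"
  define c where "c k = taylor_coeff j k f" for k
  define I where "I k = (\<integral>\<^sup>+z. ennreal ((cmod (c k z * z j ^ k))\<^sup>2) \<partial>?M)" for k
  have fin: "finite (insert j F)" "j \<in> insert j F" using insert.hyps by auto
  have V: "L2_closed_subspace ?M ?V" by (rule L2_closed_subspace_closure_cspan)
  have tail: "(\<integral>\<^sup>+z. ennreal ((cmod (f z - (\<Sum>k<N. c k z * z j ^ k)))\<^sup>2) \<partial>?M) =
      (\<Sum>k. if k < N then 0 else I k)" for N
    unfolding c_def I_def by (rule nn_integral_taylor_tail[OF h fin f(1,2)])
  have total: "(\<Sum>k. I k) < \<infinity>"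
    using tail[of 0] f(3) by (simp add: L2_iff_nn_integral)
  have I_fin: "I k < \<infinity>" for k
  proof -
    have "I k \<le> (\<Sum>k. I k)" using sum_le_suminf[of I "{k}"] by simp
    thus ?thesis using total by simp
  qed
  define r where "r k = enn2real (I k)" for k
  have Ir: "I k = ennreal (r k)" and r0: "r k \<ge> 0" for k using I_fin[of k] by (auto simp: r_def)
  have summ: "summable r"
    using total summable_suminf_not_top[of r] r0 by (simp add: Ir less_top)
  have c_entire: "entire (c k)" for k unfolding c_def by (rule entire_taylor_coeff[OF f(1)])
  have c_dep: "depends_on F (c k)" for k unfolding c_def by (rule depends_on_taylor_coeff[OF f(2)])
  have c_meas: "c k \<in> borel_measurable (gauss_prod h F)" "c k \<in> borel_measurable ?M" for k
    using c_entire[of k] insert.hyps c_dep[of k]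
    by (auto intro!: borel_measurable_gauss_prod simp: entire_def intro: depends_on_mono)
  have c_L2: "c k \<in> L2 (gauss_prod h F)" for k
  proof -
    have "(\<integral>\<^sup>+z. ennreal ((cmod (c k z))\<^sup>2) \<partial>gauss_prod h F) * ennreal ((2 * h) ^ k * fact k) < \<infinity>"
      using nn_integral_times_coordinate_power[OF h insert.hyps(1,2) c_dep c_meas, of k k] I_fin[of k]
      by (simp add: I_def)
    hence "(\<integral>\<^sup>+z. ennreal ((cmod (c k z))\<^sup>2) \<partial>gauss_prod h F) < \<infinity>"
      using h by (auto simp: ennreal_mult_less_top)
    thus ?thesis using c_meas by (simp add: L2_iff_nn_integral)
  qed
  have term_V: "(\<lambda>z. c k z * z j ^ k) \<in> ?V" for k
    unfolding L2_closure_def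
  proof (intro CollectI conjI allI impI)
    show "(\<lambda>z. c k z * z j ^ k) \<in> L2 ?M"
      by (rule L2_times_coordinate_power[OF h insert.hyps(1,2) c_dep c_L2 c_meas(2)])
    fix \<epsilon> :: real assume e: "\<epsilon> > 0"
    define m where "m = sqrt ((2 * h) ^ k * fact k)"
    have m: "m > 0" using h by (simp add: m_def)
    obtain p where p: "p \<in> cspan (monomials F)" "p \<in> L2 (gauss_prod h F)"
      "L2_norm (gauss_prod h F) (\<lambda>z. c k z - p z) < \<epsilon> / m"
      using insert.IH[OF c_entire c_dep c_L2, of k] e m unfolding L2_closure_def
      by (auto dest!: spec[of _ "\<epsilon> / m"])
    have pm: "p \<in> borel_measurable ?M"
      by (rule cspan_monomials_measurable(1)[OF insert.hyps(1) _ p(1)]) auto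
    have pd: "depends_on F p"
      by (rule cspan_monomials_measurable(2)[OF insert.hyps(1) order_refl p(1)])
    have dd: "depends_on F (\<lambda>z. c k z - p z)"
      using c_dep[of k] pd unfolding depends_on_def by metis
    have "L2_norm ?M (\<lambda>z. (c k z - p z) * z j ^ k) =
        L2_norm (gauss_prod h F) (\<lambda>z. c k z - p z) * m" unfolding m_def
      using c_meas pm
      by (intro L2_times_coordinate_power[OF h insert.hyps(1,2) dd] L2_diff c_L2 p(2)
            borel_measurable_diff)
    also have "\<dots> < \<epsilon>" using p(3) m by (simp add: pos_less_divide_eq)
    finally have "L2_norm ?M (\<lambda>z. c k z * z j ^ k - p z * z j ^ k) < \<epsilon>"
      by (simp add: left_diff_distrib)
    thus "\<exists>g\<in>cspan (monomials (insert j F)) \<inter> L2 ?M. L2_norm ?M (\<lambda>z. c k z * z j ^ k - g z) < \<epsilon>"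
      using cspan_monomials_insert[OF insert.hyps(1,2) p(1), of k]
        L2_times_coordinate_power(1)[OF h insert.hyps(1,2) pd p(2) pm, of k]
      by (intro bexI[of _ "\<lambda>z. p z * z j ^ k"]) auto
  qed
  have sum_V: "(\<lambda>z. \<Sum>k<N. c k z * z j ^ k) \<in> ?V" for N
  proof (induction N)
    case 0
    thus ?case using V by (simp add: L2_closed_subspace_def)
  next
    case (Suc N)
    thus ?case using V term_V[of N] by (simp add: L2_closed_subspace_def)
  qed
  have "f \<in> L2_closure ?M ?V"
    unfolding L2_closure_def[of ?M ?V]
  proof (intro CollectI conjI allI impI f(3))
    fix \<epsilon> :: real assume e: "\<epsilon> > 0"
    obtain N where N: "norm (\<Sum>k. r (k + N)) < \<epsilon>\<^sup>2"
      using suminf_exist_split[OF _ summ, of "\<epsilon>\<^sup>2"] e by auto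
    define S where "S = (\<lambda>z. \<Sum>k<N. c k z * z j ^ k)"
    have S: "S \<in> ?V" unfolding S_def by (rule sum_V)
    hence SL: "S \<in> L2 ?M" by (simp add: L2_closure_def)
    have "ennreal ((L2_norm ?M (\<lambda>z. f z - S z))\<^sup>2) = (\<Sum>k. if k < N then 0 else I k)"
      using L2_diff[OF f(3) SL] by (simp add: ennreal_L2_norm_power2 tail S_def)
    also have "\<dots> = (\<Sum>k. I (k + N))"
      by (subst suminf_offset[of _ N]) auto
    also have "\<dots> = ennreal (\<Sum>k. r (k + N))"
      unfolding Ir using r0 summ by (intro suminf_ennreal2) (auto simp: summable_iff_shift)
    finally have "(L2_norm ?M (\<lambda>z. f z - S z))\<^sup>2 = (\<Sum>k. r (k + N))"
      using r0 summ by (subst (asm) ennreal_inj) (auto intro!: suminf_nonneg simp: summable_iff_shift)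
    also have "\<dots> < \<epsilon>\<^sup>2" using N by simp
    finally have "L2_norm ?M (\<lambda>z. f z - S z) < \<epsilon>" using e by (simp add: power2_less_imp_less)
    thus "\<exists>g\<in>?V \<inter> L2 ?M. L2_norm ?M (\<lambda>z. f z - g z) < \<epsilon>" using S SL by blast
  qed
  thus ?case by (simp add: L2_closure_idem)
qed


section \<open>Symmetric Fock spaces\<close>

lemma ell2_add:
  assumes "u \<in> ell2 X" "v \<in> ell2 X"
  shows "(\<lambda>j. u j + v j) \<in> ell2 X"
proof -
  have "(\<lambda>j. 2 * (cmod (u j))\<^sup>2 + 2 * (cmod (v j))\<^sup>2) summable_on X"
    using assms by (intro summable_on_add summable_on_cmult_right) (auto simp: ell2_def)
  hence "(\<lambda>j. (cmod (u j + v j))\<^sup>2) summable_on X"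
    by (rule summable_on_comparison_test) (use norm_add_power2_le[of 1] in auto)
  thus ?thesis using assms by (auto simp: ell2_def)
qed

lemma ell2_cmult: "u \<in> ell2 X \<Longrightarrow> (\<lambda>j. c * u j) \<in> ell2 X"
  by (auto simp: ell2_def norm_mult power_mult_distrib intro!: summable_on_cmult_right)

lemma fock_add: "F \<in> fock X \<Longrightarrow> G \<in> fock X \<Longrightarrow> (\<lambda>xs. F xs + G xs) \<in> fock X"
  by (auto simp: fock_def intro: ell2_add)

lemma fock_cmult: "F \<in> fock X \<Longrightarrow> (\<lambda>xs. c * F xs) \<in> fock X"
  by (auto simp: fock_def intro: ell2_cmult)

lemma fock_zero: "(\<lambda>xs. 0) \<in> fock X"
  by (auto simp: fock_def ell2_def)

lemma fock_diff: "F \<in> fock X \<Longrightarrow> G \<in> fock X \<Longrightarrow> (\<lambda>xs. F xs - G xs) \<in> fock X"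
  using fock_add[of F X "\<lambda>xs. (-1) * G xs"] fock_cmult[of G X "-1"] by simp

lemma fock_sum:
  "(\<And>i. i \<in> I \<Longrightarrow> F i \<in> fock X) \<Longrightarrow> (\<lambda>xs. \<Sum>i\<in>I. F i xs) \<in> fock X"
  by (induction I rule: infinite_finite_induct) (auto intro: fock_add fock_zero)

lemma fock_summable_on: "F \<in> fock X \<Longrightarrow> (\<lambda>xs. (cmod (F xs))\<^sup>2) summable_on UNIV"
proof -
  assume "F \<in> fock X"
  hence "F xs = 0" if "xs \<notin> lists X" for xs
    using that unfolding fock_def ell2_def by blast
  moreover have "(\<lambda>xs. (cmod (F xs))\<^sup>2) summable_on lists X"
    using \<open>F \<in> fock X\<close> unfolding fock_def ell2_def by blast
  ultimately show ?thesis
    using summable_on_cong_neutral[of UNIV "lists X" "\<lambda>xs. (cmod (F xs))\<^sup>2" "\<lambda>xs. (cmod (F xs))\<^sup>2"]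
    by auto
qed

lemma fockI:
  assumes "(\<lambda>xs. (cmod (F xs))\<^sup>2) summable_on UNIV" "\<And>xs. xs \<notin> lists X \<Longrightarrow> F xs = 0"
    and "\<And>xs \<sigma>. \<sigma> permutes {..<length xs} \<Longrightarrow> F (permute_list \<sigma> xs) = F xs"
  shows "F \<in> fock X"
  using assms summable_on_subset_banach[OF assms(1), of "lists X"] unfolding fock_def ell2_def by auto

lemma ell2_norm_nonneg: "0 \<le> ell2_norm u"
  by (simp add: ell2_norm_def infsum_nonneg)

lemma ell2_norm_power2: "(ell2_norm u)\<^sup>2 = (\<Sum>\<^sub>\<infinity>j. (cmod (u j))\<^sup>2)"
  by (simp add: ell2_norm_def infsum_nonneg)

lemma sum_le_fock_norm:
  assumes "F \<in> fock X" "finite B"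
  shows "(\<Sum>xs\<in>B. (cmod (F xs))\<^sup>2) \<le> (ell2_norm F)\<^sup>2"
  unfolding ell2_norm_power2 using assms
  by (intro finite_sum_le_infsum fock_summable_on) auto

lemma norm_le_fock_norm:
  assumes "F \<in> fock X"
  shows "cmod (F xs) \<le> ell2_norm F"
  using sum_le_fock_norm[OF assms, of "{xs}"] ell2_norm_nonneg[of F]
  by (auto intro: power2_le_imp_le)

lemma fock_norm_le:
  assumes "F \<in> fock X" "\<And>B. finite B \<Longrightarrow> (\<Sum>xs\<in>B. (cmod (F xs))\<^sup>2) \<le> c\<^sup>2" "c \<ge> 0"
  shows "ell2_norm F \<le> c"
proof -
  have "(ell2_norm F)\<^sup>2 \<le> c\<^sup>2" unfolding ell2_norm_power2
    using assms by (intro infsum_le_finite_sums fock_summable_on[of F X]) auto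
  thus ?thesis using assms(3) by (rule power2_le_imp_le)
qed

lemma fock_norm_eq_0: "F \<in> fock X \<Longrightarrow> ell2_norm F = 0 \<Longrightarrow> F = (\<lambda>_. 0)"
  using norm_le_fock_norm[of F X] by (fastforce simp: fun_eq_iff)

text \<open>A Cauchy sequence converges entrywise, and the uniform bounds on finite partial sums of the
  differences survive the passage to the limit.\<close>

lemma fock_complete:
  fixes F :: "nat \<Rightarrow> 'x list \<Rightarrow> complex"
  assumes F: "\<And>n. F n \<in> fock X"
    and cauchy: "\<And>\<epsilon>. \<epsilon> > 0 \<Longrightarrow> \<exists>N. \<forall>m\<ge>N. \<forall>n\<ge>N. ell2_norm (\<lambda>xs. F m xs - F n xs) < \<epsilon>"
  shows "\<exists>G\<in>fock X. \<forall>\<epsilon>>0. \<exists>N. \<forall>n\<ge>N. ell2_norm (\<lambda>xs. F n xs - G xs) \<le> \<epsilon>"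
proof -
  have "Cauchy (\<lambda>n. F n xs)" for xs
  proof (rule metric_CauchyI)
    fix \<epsilon> :: real assume "\<epsilon> > 0"
    then obtain N where "\<forall>m\<ge>N. \<forall>n\<ge>N. ell2_norm (\<lambda>xs. F m xs - F n xs) < \<epsilon>" using cauchy by blast
    moreover have "dist (F m xs) (F n xs) \<le> ell2_norm (\<lambda>xs. F m xs - F n xs)" for m n
      using norm_le_fock_norm[OF fock_diff[OF F[of m] F[of n]], of xs] by (simp add: dist_norm)
    ultimately show "\<exists>N. \<forall>m\<ge>N. \<forall>n\<ge>N. dist (F m xs) (F n xs) < \<epsilon>"
      by (meson le_less_trans)
  qed
  hence "\<exists>l. (\<lambda>n. F n xs) \<longlonglongrightarrow> l" for xs by (simp add: Cauchy_convergent_iff convergent_def)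
  then obtain G where G: "\<And>xs. (\<lambda>n. F n xs) \<longlonglongrightarrow> G xs" by metis
  have bound: "(\<Sum>xs\<in>B. (cmod (F n xs - G xs))\<^sup>2) \<le> \<epsilon>\<^sup>2"
    if N: "\<forall>m\<ge>N. \<forall>n\<ge>N. ell2_norm (\<lambda>xs. F m xs - F n xs) < \<epsilon>" and n: "n \<ge> N" and B: "finite B"
    for N n \<epsilon> B
  proof (rule LIMSEQ_le_const2)
    show "(\<lambda>m. \<Sum>xs\<in>B. (cmod (F n xs - F m xs))\<^sup>2) \<longlonglongrightarrow> (\<Sum>xs\<in>B. (cmod (F n xs - G xs))\<^sup>2)"
      by (intro tendsto_intros G)
    have "(\<Sum>xs\<in>B. (cmod (F n xs - F m xs))\<^sup>2) \<le> \<epsilon>\<^sup>2" if "m \<ge> N" for m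
    proof -
      have "(\<Sum>xs\<in>B. (cmod (F n xs - F m xs))\<^sup>2) \<le> (ell2_norm (\<lambda>xs. F n xs - F m xs))\<^sup>2"
        by (rule sum_le_fock_norm[OF fock_diff[OF F F] B])
      also have "\<dots> \<le> \<epsilon>\<^sup>2"
        using N n that by (intro power_mono ell2_norm_nonneg) (auto intro: less_imp_le)
      finally show ?thesis .
    qed
    thus "\<exists>N. \<forall>m\<ge>N. (\<Sum>xs\<in>B. (cmod (F n xs - F m xs))\<^sup>2) \<le> \<epsilon>\<^sup>2" by blast
  qed
  have lists: "G xs = 0" if "xs \<notin> lists X" for xs
  proof -
    have "F n xs = 0" for n using F[of n] that unfolding fock_def ell2_def by blast
    thus ?thesis using LIMSEQ_unique[OF G[of xs], of 0] by simp
  qed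
  have sym: "G (permute_list \<sigma> xs) = G xs" if "\<sigma> permutes {..<length xs}" for \<sigma> xs
  proof -
    have "F n (permute_list \<sigma> xs) = F n xs" for n using F[of n] that unfolding fock_def by blast
    thus ?thesis using LIMSEQ_unique[OF G[of "permute_list \<sigma> xs"], of "G xs"] G[of xs] by simp
  qed
  have diff: "(\<lambda>xs. F n xs - G xs) \<in> fock X"
    if N: "\<forall>m\<ge>N. \<forall>n\<ge>N. ell2_norm (\<lambda>xs. F m xs - F n xs) < \<epsilon>" and n: "n \<ge> N" for N n \<epsilon>
  proof (rule fockI)
    show "(\<lambda>xs. (cmod (F n xs - G xs))\<^sup>2) summable_on UNIV"
      by (rule nonneg_bdd_above_summable_on) (auto intro!: bdd_aboveI bound[OF N n])
    show "F n xs - G xs = 0" if "xs \<notin> lists X" for xs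
      using lists[OF that] F[of n] that unfolding fock_def ell2_def by auto
    show "F n (permute_list \<sigma> xs) - G (permute_list \<sigma> xs) = F n xs - G xs"
      if "\<sigma> permutes {..<length xs}" for xs \<sigma>
      using sym[OF that] F[of n] that unfolding fock_def by auto
  qed
  have "G \<in> fock X"
  proof -
    obtain N where N: "\<forall>m\<ge>N. \<forall>n\<ge>N. ell2_norm (\<lambda>xs. F m xs - F n xs) < 1" using cauchy[of 1] by auto
    from fock_diff[OF F[of N] diff[OF N order_refl]] show ?thesis by simp
  qed
  moreover have "\<exists>N. \<forall>n\<ge>N. ell2_norm (\<lambda>xs. F n xs - G xs) \<le> \<epsilon>" if e: "\<epsilon> > 0" for \<epsilon>
  proof -
    obtain N where N: "\<forall>m\<ge>N. \<forall>n\<ge>N. ell2_norm (\<lambda>xs. F m xs - F n xs) < \<epsilon>"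
      using cauchy[OF e] by blast
    have "ell2_norm (\<lambda>xs. F n xs - G xs) \<le> \<epsilon>" if "n \<ge> N" for n
      using bound[OF N that] e by (intro fock_norm_le[OF diff[OF N that]]) auto
    thus ?thesis by blast
  qed
  ultimately show ?thesis by blast
qed

definition unit_vec :: "'x \<Rightarrow> 'x \<Rightarrow> complex" where
  "unit_vec j i = (if i = j then 1 else 0)"

definition rearrangements :: "'x list \<Rightarrow> 'x list \<Rightarrow> (nat \<Rightarrow> nat) set" where
  "rearrangements xs ys = {\<sigma>. \<sigma> permutes {..<length xs} \<and> permute_list \<sigma> xs = ys}"

lemma unit_vec_ell2: "j \<in> X \<Longrightarrow> unit_vec j \<in> ell2 X"
proof -
  assume j: "j \<in> X"
  have "(\<lambda>i. (cmod (unit_vec j i))\<^sup>2) summable_on {j}" by simp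
  also have "?this \<longleftrightarrow> (\<lambda>i. (cmod (unit_vec j i))\<^sup>2) summable_on X"
    by (rule summable_on_cong_neutral) (use j in \<open>auto simp: unit_vec_def\<close>)
  finally have "(\<lambda>i. (cmod (unit_vec j i))\<^sup>2) summable_on X" .
  thus ?thesis using j by (auto simp: ell2_def unit_vec_def)
qed

lemma finite_rearrangements: "finite (rearrangements xs ys)"
  by (rule finite_subset[OF _ finite_permutations[of "{..<length xs}"]]) (auto simp: rearrangements_def)

lemma rearrangements_mset: "\<sigma> \<in> rearrangements xs ys \<Longrightarrow> mset ys = mset xs"
  by (auto simp: rearrangements_def)

lemma sym_prod_unit_vecs:
  "sym_prod (map unit_vec xs) ys =
    complex_of_real (1 / sqrt (fact (length xs))) * of_nat (card (rearrangements xs ys))"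
proof -
  have "tensor (permute_list \<sigma> (map unit_vec xs)) ys = (if permute_list \<sigma> xs = ys then 1 else 0)"
    if "\<sigma> permutes {..<length xs}" for \<sigma>
  proof -
    define zs where "zs = permute_list \<sigma> xs"
    have "permute_list \<sigma> (map unit_vec xs) = map unit_vec zs"
      using that by (simp add: zs_def permute_list_map)
    moreover have "tensor (map unit_vec zs) ys = (if zs = ys then 1 else 0)"
    proof (cases "zs = ys")
      case True
      thus ?thesis by (simp add: tensor_def unit_vec_def)
    next
      case False
      show ?thesis
      proof (cases "length ys = length zs")
        case True
        with False obtain i where "i < length zs" "zs ! i \<noteq> ys ! i"
          by (auto simp: list_eq_iff_nth_eq)
        hence "\<exists>i\<in>{..<length zs}. (map unit_vec zs ! i) (ys ! i) = 0"
          by (intro bexI[of _ i]) (auto simp: unit_vec_def)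
        thus ?thesis using False by (auto simp: tensor_def intro!: prod_zero)
      qed (auto simp: tensor_def)
    qed
    ultimately show ?thesis by (simp add: zs_def)
  qed
  hence "(\<Sum>\<sigma> | \<sigma> permutes {..<length xs}. tensor (permute_list \<sigma> (map unit_vec xs)) ys) =
      (\<Sum>\<sigma> | \<sigma> permutes {..<length xs}. if permute_list \<sigma> xs = ys then 1 else 0)"
    by (intro sum.cong) auto
  also have "\<dots> = of_nat (card (rearrangements xs ys))"
    by (simp add: rearrangements_def sum.If_cases finite_permutations Collect_conj_eq)
  finally show ?thesis by (simp add: sym_prod_def)
qed

lemma card_rearrangements_permute_le:
  assumes \<tau>: "\<tau> permutes {..<length ys}"
  shows "card (rearrangements xs ys) \<le> card (rearrangements xs (permute_list \<tau> ys))"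
proof (rule card_inj_on_le[where f = "\<lambda>\<sigma>. \<sigma> \<circ> \<tau>", OF _ _ finite_rearrangements])
  show "inj_on (\<lambda>\<sigma>. \<sigma> \<circ> \<tau>) (rearrangements xs ys)"
    by (intro inj_onI) (metis comp_assoc comp_id permutes_inv_o(1)[OF \<tau>])
  show "(\<lambda>\<sigma>. \<sigma> \<circ> \<tau>) ` rearrangements xs ys \<subseteq> rearrangements xs (permute_list \<tau> ys)"
  proof
    fix \<rho> assume "\<rho> \<in> (\<lambda>\<sigma>. \<sigma> \<circ> \<tau>) ` rearrangements xs ys"
    then obtain \<sigma> where \<sigma>: "\<sigma> permutes {..<length xs}" "permute_list \<sigma> xs = ys" "\<rho> = \<sigma> \<circ> \<tau>"
      by (auto simp: rearrangements_def)
    have \<tau>': "\<tau> permutes {..<length xs}" using \<tau> \<sigma>(2) by auto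
    have "permute_list \<rho> xs = permute_list \<tau> ys"
      unfolding \<sigma>(3) \<sigma>(2)[symmetric] using \<tau>' by (rule permute_list_compose)
    moreover have "\<rho> permutes {..<length xs}"
      unfolding \<sigma>(3) by (rule permutes_compose[OF \<tau>' \<sigma>(1)])
    ultimately show "\<rho> \<in> rearrangements xs (permute_list \<tau> ys)" by (simp add: rearrangements_def)
  qed
qed

lemma card_rearrangements_permute:
  assumes \<tau>: "\<tau> permutes {..<length ys}"
  shows "card (rearrangements xs (permute_list \<tau> ys)) = card (rearrangements xs ys)"
proof (rule antisym)
  have "permute_list (inv \<tau>) (permute_list \<tau> ys) = permute_list (\<tau> \<circ> inv \<tau>) ys"
    by (rule permute_list_compose[symmetric, OF permutes_inv[OF \<tau>]])
  thus "card (rearrangements xs (permute_list \<tau> ys)) \<le> card (rearrangements xs ys)"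
    using card_rearrangements_permute_le[of "inv \<tau>" "permute_list \<tau> ys" xs] permutes_inv[OF \<tau>]
    by (simp add: permutes_inv_o(1)[OF \<tau>])
qed (rule card_rearrangements_permute_le[OF \<tau>])

text \<open>
  Every rearrangement of a list arises from equally many permutations, namely from as many as fix the
  list. Counting all permutations gives that number.
\<close>

lemma card_rearrangements:
  assumes "mset ys = mset xs"
  shows "card (rearrangements xs ys) = (\<Prod>x\<in>set xs. fact (count (mset xs) x))"
proof -
  define P where "P = permutations_of_multiset (mset xs)"
  have const: "card (rearrangements xs ys) = card (rearrangements xs xs)" if ys: "ys \<in> P" for ys
  proof -
    obtain \<tau> where "\<tau> permutes {..<length xs}" "permute_list \<tau> xs = ys"
      using ys mset_eq_permutation[of ys xs] by (auto simp: P_def permutations_of_multiset_def)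
    thus ?thesis using card_rearrangements_permute[of \<tau> xs xs] by simp
  qed
  have "fact (length xs) = card {\<sigma>. \<sigma> permutes {..<length xs}}"
    by (simp add: card_permutations)
  also have "{\<sigma>. \<sigma> permutes {..<length xs}} = (\<Union>ys\<in>P. rearrangements xs ys)"
    by (auto simp: rearrangements_def P_def permutations_of_multiset_def)
  also have "card \<dots> = (\<Sum>ys\<in>P. card (rearrangements xs ys))"
    by (rule card_UN_disjoint) (simp add: P_def, simp add: finite_rearrangements, auto simp: rearrangements_def)
  also have "\<dots> = card P * card (rearrangements xs xs)" by (simp add: const)
  finally have "card P * card (rearrangements xs xs) =
      card P * (\<Prod>x\<in>set xs. fact (count (mset xs) x))"
    using card_permutations_of_multiset_aux[of "mset xs"] by (simp add: P_def)
  moreover have "card P > 0" by (simp add: P_def card_gt_0_iff)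
  ultimately have "card (rearrangements xs xs) = (\<Prod>x\<in>set xs. fact (count (mset xs) x))" by simp
  moreover have "ys \<in> P" using assms by (simp add: P_def permutations_of_multiset_def)
  ultimately show ?thesis using const by simp
qed

lemma rearrangements_empty: "mset ys \<noteq> mset xs \<Longrightarrow> rearrangements xs ys = {}"
  using rearrangements_mset by fastforce

lemma card_permutations_of_mset:
  "card (permutations_of_multiset (mset xs)) * (\<Prod>x\<in>set xs. fact (count (mset xs) x)) =
    (fact (length xs) :: nat)"
  using card_permutations_of_multiset_aux[of "mset xs"] by simp

lemma sym_prod_unit_vecs_fock:
  assumes "set xs \<subseteq> X"
  shows "sym_prod (map unit_vec xs) \<in> fock X"
proof (rule fockI)
  define F where "F = sym_prod (map unit_vec xs)"
  have "F ys = 0" if "ys \<notin> permutations_of_multiset (mset xs)" for ys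
    using that rearrangements_empty[of ys xs]
    by (auto simp: F_def sym_prod_unit_vecs permutations_of_multiset_def)
  hence "(\<lambda>ys. (cmod (F ys))\<^sup>2) summable_on UNIV \<longleftrightarrow>
      (\<lambda>ys. (cmod (F ys))\<^sup>2) summable_on permutations_of_multiset (mset xs)"
    by (intro summable_on_cong_neutral) auto
  thus "(\<lambda>ys. (cmod (sym_prod (map unit_vec xs) ys))\<^sup>2) summable_on UNIV" by (simp add: F_def)
next
  fix ys :: "'a list" assume "ys \<notin> lists X"
  hence "mset ys \<noteq> mset xs" using assms mset_eq_setD[of ys xs] by auto
  thus "sym_prod (map unit_vec xs) ys = 0" by (simp add: sym_prod_unit_vecs rearrangements_empty)
next
  fix ys :: "'a list" and \<sigma> assume "\<sigma> permutes {..<length ys}"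
  thus "sym_prod (map unit_vec xs) (permute_list \<sigma> ys) = sym_prod (map unit_vec xs) ys"
    by (simp add: sym_prod_unit_vecs card_rearrangements_permute)
qed

lemma norm_sym_prod_unit_vecs:
  "(ell2_norm (sym_prod (map unit_vec xs)))\<^sup>2 = (\<Prod>x\<in>set xs. fact (count (mset xs) x))"
proof -
  define P where "P = permutations_of_multiset (mset xs)"
  define c :: nat where "c = (\<Prod>x\<in>set xs. fact (count (mset xs) x))"
  define F where "F = sym_prod (map unit_vec xs)"
  have F: "F ys = (if ys \<in> P then complex_of_real (real c / sqrt (fact (length xs))) else 0)" for ys
    using card_rearrangements[of ys xs] rearrangements_empty[of ys xs]
    by (auto simp: F_def sym_prod_unit_vecs P_def permutations_of_multiset_def c_def)
  have "(ell2_norm F)\<^sup>2 = (\<Sum>\<^sub>\<infinity>ys. (cmod (F ys))\<^sup>2)" by (rule ell2_norm_power2)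
  also have "\<dots> = (\<Sum>\<^sub>\<infinity>ys\<in>P. (cmod (F ys))\<^sup>2)" by (rule infsum_cong_neutral) (auto simp: F)
  also have "\<dots> = (\<Sum>ys\<in>P. (real c)\<^sup>2 / fact (length xs))"
    by (subst infsum_finite) (auto simp: P_def F norm_divide power_divide intro!: sum.cong)
  also have "\<dots> = real (card P * c) * real c / fact (length xs)"
    by (simp add: power2_eq_square)
  also have "card P * c = fact (length xs)"
    unfolding P_def c_def by (rule card_permutations_of_mset)
  finally show ?thesis by (simp add: F_def c_def)
qed

text \<open>
  A symmetric family supported on finitely many lists is a combination of products of unit vectors:
  all rearrangements of a list contribute equally to the value there. Truncation to finite sets that
  are closed under rearrangement therefore approximates every element of the Fock space.
\<close>

lemma fock_dense:
  assumes F: "F \<in> fock X" and e: "\<epsilon> > 0"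
  shows "\<exists>A c. finite A \<and> A \<subseteq> lists X \<and>
    ell2_norm (\<lambda>ys. F ys - (\<Sum>xs\<in>A. c xs * sym_prod (map unit_vec xs) ys)) < \<epsilon>"
proof -
  define g where "g xs = (cmod (F xs))\<^sup>2" for xs
  have summ: "g summable_on UNIV" unfolding g_def using F by (rule fock_summable_on)
  have F0: "F xs = 0" if "xs \<notin> lists X" for xs
    using F that unfolding fock_def ell2_def by blast
  have Fperm: "F ys = F xs" if m: "mset ys = mset xs" for xs ys
  proof -
    obtain \<tau> where "\<tau> permutes {..<length xs}" "permute_list \<tau> xs = ys"
      using mset_eq_permutation[OF m] by auto
    thus ?thesis using F unfolding fock_def by blast
  qed
  have "(g has_sum (\<Sum>\<^sub>\<infinity>xs. g xs)) UNIV" using summ by simp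
  hence "eventually (\<lambda>B. dist (sum g B) (\<Sum>\<^sub>\<infinity>xs. g xs) < \<epsilon>\<^sup>2) (finite_subsets_at_top UNIV)"
    using e unfolding has_sum_def by (intro tendstoD) auto
  then obtain B where B: "finite B" "dist (sum g B) (\<Sum>\<^sub>\<infinity>xs. g xs) < \<epsilon>\<^sup>2"
    by (auto simp: eventually_finite_subsets_at_top)
  define A where "A = (\<Union>xs\<in>B \<inter> lists X. permutations_of_multiset (mset xs))"
  have A: "finite A" "A \<subseteq> lists X"
  proof -
    show "finite A" using B(1) by (simp add: A_def)
    show "A \<subseteq> lists X" unfolding A_def permutations_of_multiset_def
      using mset_eq_setD by fastforce
  qed
  have A_closed: "permutations_of_multiset (mset ys) \<subseteq> A" if "ys \<in> A" for ys
    using that unfolding A_def permutations_of_multiset_def by auto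
  define c where "c xs = F xs / complex_of_real (sqrt (fact (length xs)))" for xs
  define G where "G ys = (\<Sum>xs\<in>A. c xs * sym_prod (map unit_vec xs) ys)" for ys
  have G: "G ys = (if ys \<in> A then F ys else 0)" for ys
  proof -
    define P where "P = permutations_of_multiset (mset ys)"
    define d :: nat where "d = (\<Prod>x\<in>set ys. fact (count (mset ys) x))"
    have t: "c xs * sym_prod (map unit_vec xs) ys =
        (if xs \<in> P then F ys * of_nat d / fact (length ys) else 0)" for xs
    proof (cases "xs \<in> P")
      case True
      hence m: "mset ys = mset xs" by (simp add: P_def permutations_of_multiset_def)
      have l: "length xs = length ys" using m by (metis size_mset)
      have "card (rearrangements xs ys) = d"
        using card_rearrangements[OF m] m mset_eq_setD[OF m] by (simp add: d_def)
      moreover have "complex_of_real (sqrt (fact (length ys))) * complex_of_real (sqrt (fact (length ys))) = fact (length ys)"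
        by (simp flip: of_real_mult)
      ultimately show ?thesis using True Fperm[OF m] l
        by (simp add: c_def sym_prod_unit_vecs)
    next
      case False
      hence "mset ys \<noteq> mset xs" by (auto simp: P_def permutations_of_multiset_def)
      thus ?thesis using False by (simp add: sym_prod_unit_vecs rearrangements_empty)
    qed
    show ?thesis
    proof (cases "ys \<in> A")
      case True
      have "G ys = (\<Sum>xs\<in>P. F ys * of_nat d / fact (length ys))"
        unfolding G_def t using A(1) A_closed[OF True]
        by (simp add: sum.If_cases P_def Int_absorb1)
      also have "\<dots> = F ys * of_nat (card P * d) / fact (length ys)" by simp
      also have "card P * d = fact (length ys)"
        unfolding P_def d_def by (rule card_permutations_of_mset)
      finally show ?thesis using True by simp
    next
      case False
      hence "xs \<notin> P" if "xs \<in> A" for xs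
        using A_closed[OF that] by (auto simp: P_def permutations_of_multiset_def)
      thus ?thesis using False by (simp add: G_def t)
    qed
  qed
  have "(ell2_norm (\<lambda>ys. F ys - G ys))\<^sup>2 = (\<Sum>\<^sub>\<infinity>ys\<in>- A. g ys)"
    unfolding ell2_norm_power2 by (rule infsum_cong_neutral) (auto simp: G g_def)
  also have "\<dots> = (\<Sum>\<^sub>\<infinity>ys. g ys) - sum g A"
    using infsum_Diff[of g UNIV A] summ A(1) by (simp add: Compl_eq_Diff_UNIV)
  also have "sum g A \<ge> sum g B"
  proof -
    have "sum g B = sum g (B \<inter> lists X)"
      using B(1) by (intro sum.mono_neutral_right) (auto simp: g_def F0)
    also have "\<dots> \<le> sum g A"
      using A(1) by (intro sum_mono2) (auto simp: A_def permutations_of_multiset_def g_def)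
    finally show ?thesis .
  qed
  hence "(\<Sum>\<^sub>\<infinity>ys. g ys) - sum g A < \<epsilon>\<^sup>2" using B(2) by (auto simp: dist_real_def)
  finally have "ell2_norm (\<lambda>ys. F ys - G ys) < \<epsilon>"
    using e by (auto intro: power2_less_imp_less)
  thus ?thesis using A unfolding G_def by blast
qed


section \<open>Isometries from a Fock space into \<open>L\<^sup>2\<close>\<close>

text \<open>
  The values are representatives of elements of \<open>L\<^sup>2\<close>, so that linearity is required almost everywhere
  only.
\<close>

definition fock_isometry ::
  "'w measure \<Rightarrow> 'x set \<Rightarrow> (('x list \<Rightarrow> complex) \<Rightarrow> 'w \<Rightarrow> complex) \<Rightarrow> bool" where
  "fock_isometry M X A \<longleftrightarrow>
     (\<forall>F\<in>fock X. A F \<in> L2 M) \<and>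
     (\<forall>F\<in>fock X. \<forall>G\<in>fock X. AE w in M. A (\<lambda>xs. F xs + G xs) w = A F w + A G w) \<and>
     (\<forall>z. \<forall>F\<in>fock X. AE w in M. A (\<lambda>xs. z * F xs) w = z * A F w) \<and>
     (\<forall>F\<in>fock X. L2_norm M (A F) = ell2_norm F)"

lemma
  assumes "fock_isometry M X A"
  shows fock_isometry_L2: "F \<in> fock X \<Longrightarrow> A F \<in> L2 M"
    and fock_isometry_add: "F \<in> fock X \<Longrightarrow> G \<in> fock X \<Longrightarrow>
      AE w in M. A (\<lambda>xs. F xs + G xs) w = A F w + A G w"
    and fock_isometry_cmult: "F \<in> fock X \<Longrightarrow> AE w in M. A (\<lambda>xs. z * F xs) w = z * A F w"
    and fock_isometry_norm: "F \<in> fock X \<Longrightarrow> L2_norm M (A F) = ell2_norm F"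
  using assms by (simp_all add: fock_isometry_def)

lemma fock_isometry_zero:
  assumes "fock_isometry M X A"
  shows "AE w in M. A (\<lambda>_. 0) w = 0"
proof -
  show ?thesis using fock_isometry_cmult[OF assms fock_zero, of 0] by simp
qed

lemma fock_isometry_sum:
  assumes A: "fock_isometry M X A" and "finite I" and "\<And>i. i \<in> I \<Longrightarrow> F i \<in> fock X"
  shows "AE w in M. A (\<lambda>xs. \<Sum>i\<in>I. c i * F i xs) w = (\<Sum>i\<in>I. c i * A (F i) w)"
  using assms(2,3)
proof (induction I rule: finite_induct)
  case empty
  thus ?case using fock_isometry_zero[OF A] by simp
next
  case (insert i I)
  have 1: "AE w in M. A (\<lambda>xs. \<Sum>i\<in>I. c i * F i xs) w = (\<Sum>i\<in>I. c i * A (F i) w)"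
    using insert by auto
  have 2: "AE w in M. A (\<lambda>xs. c i * F i xs) w = c i * A (F i) w"
    by (rule fock_isometry_cmult[OF A]) (simp add: insert.prems)
  have "(\<lambda>xs. c i * F i xs) \<in> fock X" "(\<lambda>xs. \<Sum>i\<in>I. c i * F i xs) \<in> fock X"
    using insert.prems by (auto intro!: fock_sum fock_cmult)
  hence 3: "AE w in M. A (\<lambda>xs. c i * F i xs + (\<Sum>i\<in>I. c i * F i xs)) w =
      A (\<lambda>xs. c i * F i xs) w + A (\<lambda>xs. \<Sum>i\<in>I. c i * F i xs) w"
    by (rule fock_isometry_add[OF A])
  from 1 2 3 show ?case by eventually_elim (use insert.hyps in simp)
qed

lemma fock_isometry_diff:
  assumes A: "fock_isometry M X A" and F: "F \<in> fock X" "G \<in> fock X"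
  shows "AE w in M. A (\<lambda>xs. F xs - G xs) w = A F w - A G w"
    and "L2_norm M (\<lambda>w. A F w - A G w) = ell2_norm (\<lambda>xs. F xs - G xs)"
proof -
  have 1: "AE w in M. A (\<lambda>xs. (-1) * G xs) w = (-1) * A G w"
    by (rule fock_isometry_cmult[OF A F(2)])
  have 2: "AE w in M. A (\<lambda>xs. F xs + (-1) * G xs) w = A F w + A (\<lambda>xs. (-1) * G xs) w"
    by (rule fock_isometry_add[OF A F(1) fock_cmult[OF F(2)]])
  from 1 2 show *: "AE w in M. A (\<lambda>xs. F xs - G xs) w = A F w - A G w"
    by eventually_elim simp
  have L: "A F \<in> L2 M" "A G \<in> L2 M" "A (\<lambda>xs. F xs - G xs) \<in> L2 M"
    by (intro fock_isometry_L2[OF A] F fock_diff)+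
  have "L2_norm M (\<lambda>w. A F w - A G w) = L2_norm M (A (\<lambda>xs. F xs - G xs))"
    using * by (intro L2_norm_cong_AE L2_measurable L2_diff L) auto
  also have "\<dots> = ell2_norm (\<lambda>xs. F xs - G xs)"
    by (rule fock_isometry_norm[OF A fock_diff[OF F]])
  finally show "L2_norm M (\<lambda>w. A F w - A G w) = ell2_norm (\<lambda>xs. F xs - G xs)" .
qed

lemma fock_isometry_inject:
  assumes A: "fock_isometry M X A" and F: "F \<in> fock X" "G \<in> fock X"
    and eq: "AE w in M. A F w = A G w"
  shows "F = G"
proof -
  have L: "(\<lambda>w. A F w - A G w) \<in> L2 M"
    by (intro L2_diff fock_isometry_L2[OF A] F)
  have "L2_norm M (\<lambda>w. A F w - A G w) = 0"
    using eq by (subst L2_norm_eq_0_iff[OF L]) auto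
  hence "(\<lambda>xs. F xs - G xs) = (\<lambda>_. 0)"
    using fock_isometry_diff(2)[OF A F] fock_norm_eq_0[OF fock_diff[OF F]] by simp
  thus ?thesis by (auto simp: fun_eq_iff)
qed

text \<open>Fock spaces are complete, so the range of an isometry is closed.\<close>

lemma L2_closure_range_fock_isometry:
  assumes A: "fock_isometry M X A"
  shows "L2_closure M (L2_range M A (fock X)) = L2_range M A (fock X)"
proof
  show "L2_range M A (fock X) \<subseteq> L2_closure M (L2_range M A (fock X))"
    using subset_L2_closure[of "L2_range M A (fock X)" M] by (auto simp: L2_range_def)
  have AL: "A F \<in> L2 M" if "F \<in> fock X" for F using fock_isometry_L2[OF A that] .
  show "L2_closure M (L2_range M A (fock X)) \<subseteq> L2_range M A (fock X)"
  proof
    fix f assume f: "f \<in> L2_closure M (L2_range M A (fock X))"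
    hence fL: "f \<in> L2 M" by (simp add: L2_closure_def)
    have "\<exists>F\<in>fock X. L2_norm M (\<lambda>w. f w - A F w) < 1 / Suc n" for n
    proof -
      obtain g where g: "g \<in> L2_range M A (fock X)" "L2_norm M (\<lambda>w. f w - g w) < 1 / Suc n"
        using f unfolding L2_closure_def by (auto dest!: spec[of _ "1 / Suc n"])
      then obtain F where F: "F \<in> fock X" "AE w in M. g w = A F w" "g \<in> L2 M"
        by (auto simp: L2_range_def)
      have "L2_norm M (\<lambda>w. f w - A F w) = L2_norm M (\<lambda>w. f w - g w)"
        using F(2) by (intro L2_norm_cong_AE L2_measurable L2_diff AL F fL) auto
      thus ?thesis using g(2) F(1) by (intro bexI[of _ F]) simp_all
    qed
    then obtain F where F: "\<And>n. F n \<in> fock X"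
      "\<And>n. L2_norm M (\<lambda>w. f w - A (F n) w) < 1 / Suc n" by metis
    have small: "\<exists>N. \<forall>n\<ge>N. L2_norm M (\<lambda>w. f w - A (F n) w) < \<epsilon>" if e: "\<epsilon> > 0" for \<epsilon>
    proof -
      obtain N where N: "1 / Suc N < \<epsilon>" using nat_approx_posE[OF e] by blast
      have "L2_norm M (\<lambda>w. f w - A (F n) w) < \<epsilon>" if "n \<ge> N" for n
      proof -
        have "1 / real (Suc n) \<le> 1 / real (Suc N)" using that by (intro divide_left_mono) auto
        thus ?thesis using F(2)[of n] N by linarith
      qed
      thus ?thesis by blast
    qed
    have "\<exists>G\<in>fock X. \<forall>\<epsilon>>0. \<exists>N. \<forall>n\<ge>N. ell2_norm (\<lambda>xs. F n xs - G xs) \<le> \<epsilon>"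
    proof (rule fock_complete[OF F(1)])
      fix \<epsilon> :: real assume "\<epsilon> > 0"
      then obtain N where N: "\<forall>n\<ge>N. L2_norm M (\<lambda>w. f w - A (F n) w) < \<epsilon> / 2"
        using small[of "\<epsilon> / 2"] by auto
      have "ell2_norm (\<lambda>xs. F m xs - F n xs) < \<epsilon>" if "m \<ge> N" "n \<ge> N" for m n
      proof -
        have "L2_norm M (\<lambda>w. A (F m) w - A (F n) w) \<le>
            L2_norm M (\<lambda>w. A (F m) w - f w) + L2_norm M (\<lambda>w. f w - A (F n) w)"
          by (intro L2_norm_triangle3 AL F(1) fL)
        also have "\<dots> < \<epsilon> / 2 + \<epsilon> / 2"
          using N that by (subst L2_norm_minus_commute) (intro add_strict_mono, auto)
        finally show ?thesis by (simp add: fock_isometry_diff(2)[OF A F(1) F(1)])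
      qed
      thus "\<exists>N. \<forall>m\<ge>N. \<forall>n\<ge>N. ell2_norm (\<lambda>xs. F m xs - F n xs) < \<epsilon>" by blast
    qed
    then obtain G where G: "G \<in> fock X"
      "\<And>\<epsilon>. \<epsilon> > 0 \<Longrightarrow> \<exists>N. \<forall>n\<ge>N. ell2_norm (\<lambda>xs. F n xs - G xs) \<le> \<epsilon>" by blast
    have "L2_norm M (\<lambda>w. f w - A G w) \<le> 0 + \<epsilon>" if e: "\<epsilon> > 0" for \<epsilon>
    proof -
      obtain N where N: "\<forall>n\<ge>N. L2_norm M (\<lambda>w. f w - A (F n) w) < \<epsilon> / 2"
        using small[of "\<epsilon> / 2"] e by auto
      obtain N' where N': "\<forall>n\<ge>N'. ell2_norm (\<lambda>xs. F n xs - G xs) \<le> \<epsilon> / 2"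
        using G(2)[of "\<epsilon> / 2"] e by auto
      define n where "n = max N N'"
      have "L2_norm M (\<lambda>w. f w - A G w) \<le>
          L2_norm M (\<lambda>w. f w - A (F n) w) + L2_norm M (\<lambda>w. A (F n) w - A G w)"
        by (intro L2_norm_triangle3 AL F(1) fL G(1))
      also have "L2_norm M (\<lambda>w. A (F n) w - A G w) \<le> \<epsilon> / 2"
        using N' by (simp add: fock_isometry_diff(2)[OF A F(1) G(1)] n_def)
      also have "L2_norm M (\<lambda>w. f w - A (F n) w) \<le> \<epsilon> / 2"
        using N by (auto simp: n_def intro: less_imp_le)
      finally show ?thesis by simp
    qed
    hence "L2_norm M (\<lambda>w. f w - A G w) = 0"
      using field_le_epsilon[of "L2_norm M (\<lambda>w. f w - A G w)" 0]
      by (intro antisym) auto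
    hence "AE w in M. f w = A G w"
      by (subst (asm) L2_norm_eq_0_iff) (auto intro!: L2_diff fL AL G(1))
    thus "f \<in> L2_range M A (fock X)" using fL G(1) by (auto simp: L2_range_def)
  qed
qed

text \<open>
  An isometry is determined by the images of the products of unit vectors, because these have dense
  span in the Fock space.
\<close>

lemma L2_range_fock_isometry:
  assumes A: "fock_isometry M X A"
    and S: "S = {q xs |xs. set xs \<subseteq> X}"
    and q: "\<And>xs. set xs \<subseteq> X \<Longrightarrow> q xs \<in> L2 M"
    and Aq: "\<And>xs. set xs \<subseteq> X \<Longrightarrow> AE w in M. A (sym_prod (map unit_vec xs)) w = q xs w"
  shows "L2_range M A (fock X) = L2_closure M (cspan S)"
proof
  have AL: "A F \<in> L2 M" if "F \<in> fock X" for F using fock_isometry_L2[OF A that] .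
  have "cspan S \<inter> L2 M \<subseteq> L2_range M A (fock X)"
  proof
    fix f assume f: "f \<in> cspan S \<inter> L2 M"
    then obtain T c where T: "finite T" "T \<subseteq> S" "f = (\<lambda>w. \<Sum>g\<in>T. c g * g w)"
      by (auto simp: cspan_def)
    have "\<exists>F. \<forall>g\<in>T. F g \<in> fock X \<and> (AE w in M. g w = A (F g) w)"
    proof (rule bchoice, rule ballI)
      fix g assume "g \<in> T"
      then obtain xs where xs: "set xs \<subseteq> X" "g = q xs" using T(2) S by auto
      show "\<exists>F. F \<in> fock X \<and> (AE w in M. g w = A F w)"
        using Aq[OF xs(1)] sym_prod_unit_vecs_fock[OF xs(1)] xs(2)
        by (intro exI[of _ "sym_prod (map unit_vec xs)"]) auto
    qed
    then obtain F where F: "\<And>g. g \<in> T \<Longrightarrow> F g \<in> fock X"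
      "\<And>g. g \<in> T \<Longrightarrow> AE w in M. g w = A (F g) w" by blast
    have "AE w in M. \<forall>g\<in>T. g w = A (F g) w" using T(1) F(2) by (simp add: AE_finite_all)
    moreover have "AE w in M. A (\<lambda>xs. \<Sum>g\<in>T. c g * F g xs) w = (\<Sum>g\<in>T. c g * A (F g) w)"
      by (rule fock_isometry_sum[OF A T(1) F(1)])
    ultimately have "AE w in M. f w = A (\<lambda>xs. \<Sum>g\<in>T. c g * F g xs) w"
      by eventually_elim (simp add: T(3))
    moreover have "(\<lambda>xs. \<Sum>g\<in>T. c g * F g xs) \<in> fock X" by (intro fock_sum fock_cmult F(1))
    ultimately show "f \<in> L2_range M A (fock X)" using f by (auto simp: L2_range_def)
  qed
  hence "L2_closure M (cspan S) \<subseteq> L2_closure M (L2_range M A (fock X))"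
    by (intro L2_closure_mono_closure) (simp add: L2_closure_range_fock_isometry[OF A])
  thus "L2_closure M (cspan S) \<subseteq> L2_range M A (fock X)"
    by (simp add: L2_closure_range_fock_isometry[OF A])
  show "L2_range M A (fock X) \<subseteq> L2_closure M (cspan S)"
  proof
    fix f assume "f \<in> L2_range M A (fock X)"
    then obtain F where F: "F \<in> fock X" "AE w in M. f w = A F w" and fL: "f \<in> L2 M"
      by (auto simp: L2_range_def)
    have "A F \<in> L2_closure M (cspan S)"
      unfolding L2_closure_def
    proof (intro CollectI conjI allI impI AL F(1))
      fix \<epsilon> :: real assume e: "\<epsilon> > 0"
      obtain B c where B: "finite B" "B \<subseteq> lists X"
        "ell2_norm (\<lambda>ys. F ys - (\<Sum>xs\<in>B. c xs * sym_prod (map unit_vec xs) ys)) < \<epsilon>"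
        using fock_dense[OF F(1) e] by (elim exE conjE)
      define G where "G = (\<lambda>ys. \<Sum>xs\<in>B. c xs * sym_prod (map unit_vec xs) ys)"
      define g where "g = (\<lambda>w. \<Sum>xs\<in>B. c xs * q xs w)"
      have Bf: "sym_prod (map unit_vec xs) \<in> fock X" if "xs \<in> B" for xs
        using B(2) that by (intro sym_prod_unit_vecs_fock) auto
      have G: "G \<in> fock X" unfolding G_def by (intro fock_sum fock_cmult Bf)
      have gL: "g \<in> L2 M" unfolding g_def using B(2) by (intro L2_sum L2_cmult q) auto
      have gS: "g \<in> cspan S" unfolding g_def using B(2) S
        by (intro cspan_sum cspan_cmult cspan_base) auto
      have "AE w in M. \<forall>xs\<in>B. A (sym_prod (map unit_vec xs)) w = q xs w"
      proof (subst AE_finite_all[OF B(1)], rule ballI)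
        fix xs assume "xs \<in> B"
        hence "set xs \<subseteq> X" using B(2) by auto
        thus "AE w in M. A (sym_prod (map unit_vec xs)) w = q xs w" by (rule Aq)
      qed
      moreover have "AE w in M. A G w = (\<Sum>xs\<in>B. c xs * A (sym_prod (map unit_vec xs)) w)"
        unfolding G_def by (rule fock_isometry_sum[OF A B(1) Bf])
      ultimately have "AE w in M. A G w = g w" by eventually_elim (simp add: g_def)
      hence "L2_norm M (\<lambda>w. A F w - g w) = L2_norm M (\<lambda>w. A F w - A G w)"
        by (intro L2_norm_cong_AE L2_measurable L2_diff AL F(1) G gL) auto
      also have "\<dots> = ell2_norm (\<lambda>xs. F xs - G xs)" by (rule fock_isometry_diff(2)[OF A F(1) G])
      also have "\<dots> < \<epsilon>" using B(3) by (simp add: G_def)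
      finally show "\<exists>g\<in>cspan S \<inter> L2 M. L2_norm M (\<lambda>w. A F w - g w) < \<epsilon>" using gL gS by blast
    qed
    thus "f \<in> L2_closure M (cspan S)" using fL F(2) by (rule L2_closure_AE)
  qed
qed


section \<open>The joint law of finitely many coordinates\<close>

text \<open>
  The Gaussian measure is characterized by prescribed image measures. An image measure of total mass
  \<open>1\<close> forces measurability: a set or its complement has positive mass, so that one of the two
  preimages is not assigned the default value \<open>0\<close> and thus is measurable.
\<close>

lemma measurable_if_prob_space_distr:
  assumes f: "f \<in> space M \<rightarrow> space N" and "prob_space (distr M N f)"
  shows "f \<in> measurable M N"
proof (rule measurableI)
  interpret D: prob_space "distr M N f" by fact
  have pos: "f -` A \<inter> space M \<in> sets M" if "emeasure (distr M N f) A \<noteq> 0" for A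
  proof -
    have "emeasure (distr M N f) A \<in> {0, emeasure M (f -` A \<inter> space M)}"
      unfolding distr_def emeasure_measure_of_conv by auto
    thus ?thesis using that emeasure_notin_sets[of "f -` A \<inter> space M" M] by auto
  qed
  show "f x \<in> space N" if "x \<in> space M" for x using f that by auto
  show "f -` A \<inter> space M \<in> sets M" if A: "A \<in> sets N" for A
  proof (cases "emeasure (distr M N f) A = 0")
    case True
    have "emeasure (distr M N f) (space N - A) = 1"
      using D.emeasure_space_1 A True by (subst emeasure_compl[of A "distr M N f", simplified]) auto
    hence "f -` (space N - A) \<inter> space M \<in> sets M" by (intro pos) simp
    hence "space M - (f -` (space N - A) \<inter> space M) \<in> sets M" by (rule sets.compl_sets)
    moreover have "space M - (f -` (space N - A) \<inter> space M) = f -` A \<inter> space M"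
      using f by auto
    ultimately show ?thesis by simp
  qed (rule pos)
qed

lemma coordinate_B_dual:
  assumes b: "\<forall>j\<in>E. b j > 0" and i: "i \<in> E"
  shows "(\<lambda>x. x i) \<in> B_dual b E"
proof -
  have "\<bar>x i\<bar> \<le> b i * B_norm b E x" if x: "x \<in> B_space b E" for x
  proof -
    have "finite {j \<in> E. 1 \<le> \<bar>x j\<bar> / b j}" using x unfolding B_space_def by (auto dest: spec[of _ 1])
    hence "bdd_above ((\<lambda>j. \<bar>x j\<bar> / b j) ` {j \<in> E. 1 \<le> \<bar>x j\<bar> / b j} \<union> {..1})"
      by (simp add: bdd_above_finite)
    hence "bdd_above ((\<lambda>j. \<bar>x j\<bar> / b j) ` E)" by (rule bdd_above_mono) auto
    hence "\<bar>x i\<bar> / b i \<le> B_norm b E x" unfolding B_norm_def using i by (rule cSUP_upper2) simp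
    thus ?thesis using b i by (simp add: field_simps)
  qed
  thus ?thesis unfolding B_dual_def by auto
qed

lemma indicator_PiE:
  assumes "finite F" "y \<in> extensional F"
  shows "(indicator (Pi\<^sub>E F A) y :: ennreal) = (\<Prod>j\<in>F. indicator (A j) (y j))"
proof (cases "\<forall>j\<in>F. y j \<in> A j")
  case False
  then obtain j where j: "j \<in> F" "y j \<notin> A j" by blast
  hence "(\<Prod>j\<in>F. indicator (A j) (y j) :: ennreal) = 0"
    using assms(1) by (intro prod_zero bexI[of _ j]) auto
  moreover have "y \<notin> Pi\<^sub>E F A" using j by (auto simp: PiE_iff)
  ultimately show ?thesis by (metis indicator_simps(2))
qed (use assms(2) in \<open>simp add: PiE_iff\<close>)

lemma density_normal_PiM:
  assumes t: "t > 0"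
  shows "density (\<Pi>\<^sub>M i\<in>{..<n}. lborel)
      (\<lambda>y. ennreal ((2 * pi * t) powr (- real n / 2) * exp (- (\<Sum>i<n. (y i)\<^sup>2) / (2 * t)))) =
    (\<Pi>\<^sub>M i\<in>{..<n}. gauss1 t)"
proof -
  interpret G: product_sigma_finite "\<lambda>_::nat. gauss1 t"
    by (simp add: product_sigma_finite_def prob_space_gauss1 prob_space_imp_sigma_finite t)
  interpret L: product_sigma_finite "\<lambda>_::nat. lborel :: real measure"
    by (simp add: product_sigma_finite_def lborel.sigma_finite_measure_axioms)
  have eq: "(2 * pi * t) powr (- real n / 2) * exp (- (\<Sum>i<n. (y i)\<^sup>2) / (2 * t)) =
      (\<Prod>i<n. normal_density 0 (sqrt t) (y i))" for y :: "nat \<Rightarrow> real"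
  proof -
    have "(\<Prod>i<n. normal_density 0 (sqrt t) (y i)) =
        (1 / sqrt (2 * pi * t)) ^ n * (\<Prod>i<n. exp (- (y i)\<^sup>2 / (2 * t)))"
      using t by (simp add: normal_density_def prod_dividef power_one_over)
    also have "(\<Prod>i<n. exp (- (y i)\<^sup>2 / (2 * t))) = exp (- (\<Sum>i<n. (y i)\<^sup>2) / (2 * t))"
      by (simp add: exp_sum[symmetric] sum_negf[symmetric] sum_divide_distrib)
    also have "(1 / sqrt (2 * pi * t)) ^ n = (2 * pi * t) powr (- real n / 2)"
      using t by (simp add: powr_minus_divide powr_half_sqrt[symmetric] powr_realpow[symmetric] powr_powr power_one_over)
    finally show ?thesis by simp
  qed
  show ?thesis
  proof (rule G.PiM_eqI)
    fix A assume A: "\<And>i. i \<in> {..<n} \<Longrightarrow> A i \<in> sets (gauss1 t)"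
    have [measurable]: "A i \<in> sets borel" if "i < n" for i using A[of i] that by simp
    have box: "Pi\<^sub>E {..<n} A \<in> sets (\<Pi>\<^sub>M i\<in>{..<n}. lborel)"
      using A by (intro sets_PiM_I_finite) auto
    have "emeasure (density (\<Pi>\<^sub>M i\<in>{..<n}. lborel)
        (\<lambda>y. ennreal (\<Prod>i<n. normal_density 0 (sqrt t) (y i)))) (Pi\<^sub>E {..<n} A) =
      (\<integral>\<^sup>+y. ennreal (\<Prod>i<n. normal_density 0 (sqrt t) (y i)) * indicator (Pi\<^sub>E {..<n} A) y
        \<partial>(\<Pi>\<^sub>M i\<in>{..<n}. lborel))"
      by (rule emeasure_density[OF _ box]) measurable
    also have "\<dots> = (\<integral>\<^sup>+y. (\<Prod>i<n. ennreal (normal_density 0 (sqrt t) (y i)) * indicator (A i) (y i))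
        \<partial>(\<Pi>\<^sub>M i\<in>{..<n}. lborel))"
    proof (rule nn_integral_cong)
      fix y assume y: "y \<in> space (\<Pi>\<^sub>M i\<in>{..<n}. lborel :: real measure)"
      hence "(indicator (Pi\<^sub>E {..<n} A) y :: ennreal) = (\<Prod>i<n. indicator (A i) (y i))"
        by (intro indicator_PiE) (auto simp: space_PiM PiE_def)
      thus "ennreal (\<Prod>i<n. normal_density 0 (sqrt t) (y i)) * indicator (Pi\<^sub>E {..<n} A) y =
        (\<Prod>i<n. ennreal (normal_density 0 (sqrt t) (y i)) * indicator (A i) (y i))"
        by (simp add: prod.distrib prod_ennreal normal_density_nonneg)
    qed
    also have "\<dots> = (\<Prod>i<n. \<integral>\<^sup>+y. ennreal (normal_density 0 (sqrt t) y) * indicator (A i) y \<partial>lborel)"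
      by (rule L.product_nn_integral_prod) (auto simp: measurable_lborel1)
    also have "\<dots> = (\<Prod>i<n. emeasure (gauss1 t) (A i))"
      by (intro prod.cong refl) (simp add: gauss1_def emeasure_density)
    finally show "emeasure (density (\<Pi>\<^sub>M i\<in>{..<n}. lborel)
      (\<lambda>y. ennreal ((2 * pi * t) powr (- real n / 2) * exp (- (\<Sum>i<n. (y i)\<^sup>2) / (2 * t)))))
        (Pi\<^sub>E {..<n} A) = (\<Prod>i<n. emeasure (gauss1 t) (A i))"
      unfolding eq .
  qed (auto intro!: sets_PiM_cong)
qed

text \<open>Distinct coordinates are orthonormal functionals, because their coefficient families are
  distinct unit vectors.\<close>

lemma gaussian_measure_coordinates_enum:
  fixes e :: "nat \<Rightarrow> 'a"
  assumes \<mu>: "is_gaussian_measure b E t \<mu>" and t: "t > 0"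
    and b: "\<forall>j\<in>E. b j > 0"
    and e: "inj_on e {..<n}" "e ` {..<n} \<subseteq> E"
  shows "distr \<mu> (\<Pi>\<^sub>M i\<in>{..<n}. lborel) (\<lambda>x. \<lambda>i\<in>{..<n}. x (e i)) = (\<Pi>\<^sub>M i\<in>{..<n}. gauss1 t)"
    and "(\<lambda>x. \<lambda>i\<in>{..<n}. x (e i)) \<in> measurable \<mu> (\<Pi>\<^sub>M i\<in>{..<n}. lborel)"
proof -
  define f where "f i x = x (e i)" for i and x :: "'a \<Rightarrow> real"
  have "f i \<in> B_dual b E" if "i < n" for i
    unfolding f_def using e(2) that by (intro coordinate_B_dual b) auto
  moreover have "((\<lambda>j. dual_coeff (f i) j * dual_coeff (f k) j) has_sum (if i = k then 1 else 0)) E"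
    if "i < n" "k < n" for i k
  proof -
    have ek: "e i \<in> E" "e i = e k \<longleftrightarrow> i = k" using that e by (auto simp: inj_on_def)
    have "((\<lambda>j. dual_coeff (f i) j * dual_coeff (f k) j) has_sum (if i = k then 1 else 0)) {e i}"
      using ek by (intro has_sum_finiteI) (auto simp: dual_coeff_def f_def)
    also have "?this \<longleftrightarrow> ?thesis"
      using ek by (intro has_sum_cong_neutral) (auto simp: dual_coeff_def f_def)
    finally show ?thesis .
  qed
  ultimately have "distr \<mu> (\<Pi>\<^sub>M i\<in>{..<n}. lborel) (\<lambda>x. \<lambda>i\<in>{..<n}. f i x) =
    density (\<Pi>\<^sub>M i\<in>{..<n}. lborel)
      (\<lambda>y. ennreal ((2 * pi * t) powr (- real n / 2) * exp (- (\<Sum>i<n. (y i)\<^sup>2) / (2 * t))))"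
    using \<mu> unfolding is_gaussian_measure_def by blast
  thus *: "distr \<mu> (\<Pi>\<^sub>M i\<in>{..<n}. lborel) (\<lambda>x. \<lambda>i\<in>{..<n}. x (e i)) = (\<Pi>\<^sub>M i\<in>{..<n}. gauss1 t)"
    unfolding density_normal_PiM[OF t] f_def .
  have "prob_space (\<Pi>\<^sub>M i\<in>{..<n}. gauss1 t)" by (rule prob_space_PiM) (rule prob_space_gauss1[OF t])
  thus "(\<lambda>x. \<lambda>i\<in>{..<n}. x (e i)) \<in> measurable \<mu> (\<Pi>\<^sub>M i\<in>{..<n}. lborel)"
    by (intro measurable_if_prob_space_distr) (auto simp: * space_PiM)
qed

lemma gaussian_measure_coordinate_measurable:
  assumes "is_gaussian_measure b E t \<mu>" "t > 0" "\<forall>j\<in>E. b j > 0" and j: "j \<in> E"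
  shows "(\<lambda>x. x j) \<in> borel_measurable \<mu>"
proof -
  have "(\<lambda>x. \<lambda>i\<in>{..<1::nat}. x j) \<in> measurable \<mu> (\<Pi>\<^sub>M i\<in>{..<1::nat}. lborel)"
    by (rule gaussian_measure_coordinates_enum(2)[OF assms(1-3), where e = "\<lambda>_. j"])
       (use j in \<open>auto simp: inj_on_def\<close>)
  from measurable_compose[OF this measurable_component_singleton[of 0 "{..<1}"]] show ?thesis by simp
qed

lemma nn_integral_gaussian_prod:
  assumes \<mu>: "is_gaussian_measure b E t \<mu>" and t: "t > 0" and b: "\<forall>j\<in>E. b j > 0"
    and F: "finite F" "F \<subseteq> E" and k: "\<And>j. j \<in> F \<Longrightarrow> k j \<in> borel_measurable borel"
  shows "(\<integral>\<^sup>+x. (\<Prod>j\<in>F. k j (x j)) \<partial>\<mu>) = (\<Prod>j\<in>F. \<integral>\<^sup>+r. k j r \<partial>gauss1 t)"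
proof -
  obtain e and n :: nat where e: "bij_betw e {..<n} F"
    using ex_bij_betw_nat_finite[OF F(1)] by (auto simp: atLeast0LessThan)
  hence e': "inj_on e {..<n}" "e ` {..<n} = F" by (auto simp: bij_betw_def)
  have k': "k (e i) \<in> borel_measurable borel" if "i \<in> {..<n}" for i using k e'(2) that by auto
  let ?L = "\<Pi>\<^sub>M i\<in>{..<n}. (lborel :: real measure)"
  note law = gaussian_measure_coordinates_enum[OF \<mu> t b e'(1) F(2)[folded e'(2)]]
  interpret G: product_sigma_finite "\<lambda>_::nat. gauss1 t"
    by (simp add: product_sigma_finite_def prob_space_gauss1 prob_space_imp_sigma_finite t)
  have "(\<lambda>y. k (e i) (y i)) \<in> borel_measurable ?L" if "i \<in> {..<n}" for i
    by (rule measurable_compose[OF measurable_component_singleton[OF that]]) (simp add: k'[OF that])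
  hence "(\<lambda>y. \<Prod>i<n. k (e i) (y i)) \<in> borel_measurable ?L"
    by (rule borel_measurable_prod_ennreal)
  hence m: "(\<lambda>y. \<Prod>i<n. k (e i) (y i)) \<in> borel_measurable (distr \<mu> ?L (\<lambda>x. \<lambda>i\<in>{..<n}. x (e i)))"
    by (simp only: measurable_distr_eq1)
  have "(\<integral>\<^sup>+x. (\<Prod>j\<in>F. k j (x j)) \<partial>\<mu>) = (\<integral>\<^sup>+x. (\<Prod>i<n. k (e i) ((\<lambda>i\<in>{..<n}. x (e i)) i)) \<partial>\<mu>)"
    unfolding prod.reindex_bij_betw[OF e, symmetric] by (intro nn_integral_cong prod.cong) auto
  also have "\<dots> = (\<integral>\<^sup>+y. (\<Prod>i<n. k (e i) (y i)) \<partial>distr \<mu> ?L (\<lambda>x. \<lambda>i\<in>{..<n}. x (e i)))"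
    by (rule nn_integral_distr[OF law(2) m, symmetric])
  also have "\<dots> = (\<Prod>i<n. \<integral>\<^sup>+r. k (e i) r \<partial>gauss1 t)"
    unfolding law(1) using k' by (intro G.product_nn_integral_prod) auto
  also have "\<dots> = (\<Prod>j\<in>F. \<integral>\<^sup>+r. k j r \<partial>gauss1 t)"
    by (rule prod.reindex_bij_betw[OF e])
  finally show ?thesis .
qed

lemma gaussian_measure_coordinate_distr:
  assumes \<mu>: "is_gaussian_measure b E t \<mu>" and t: "t > 0"
    and b: "\<forall>j\<in>E. b j > 0" and j: "j \<in> E"
  shows "distr \<mu> borel (\<lambda>x. x j) = gauss1 t"
proof (rule measure_eqI)
  fix A assume "A \<in> sets (distr \<mu> borel (\<lambda>x. x j))"
  hence A: "A \<in> sets borel" by simp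
  note m = gaussian_measure_coordinate_measurable[OF \<mu> t b j]
  have "emeasure (distr \<mu> borel (\<lambda>x. x j)) A = (\<integral>\<^sup>+x. indicator A (x j) \<partial>\<mu>)"
    using A m by (subst nn_integral_distr[OF m, symmetric]) auto
  also have "\<dots> = emeasure (gauss1 t) A"
    using nn_integral_gaussian_prod[OF \<mu> t b, of "{j}" "\<lambda>_. indicator A"] j A by simp
  finally show "emeasure (distr \<mu> borel (\<lambda>x. x j)) A = emeasure (gauss1 t) A" .
qed simp

definition complex_coord :: "'g set \<Rightarrow> ('g \<Rightarrow> real) \<times> ('g \<Rightarrow> real) \<Rightarrow> 'g \<Rightarrow> complex" where
  "complex_coord F p = (\<lambda>j\<in>F. Complex (fst p j) (snd p j))"

text \<open>
  The measure of a box of complex sets is an iterated integral of a product of one factor for each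
  coordinate. Integration over the second and then over the first variable factorizes it.
\<close>

lemma
  assumes \<mu>: "is_gaussian_measure b E h \<mu>" and h: "h > 0"
    and b: "\<forall>j\<in>E. b j > 0" and F: "finite F" "F \<subseteq> E"
  shows complex_coord_measurable:
      "complex_coord F \<in> measurable (\<mu> \<Otimes>\<^sub>M \<mu>) (PiM F (\<lambda>_. borel))"
    and complex_coord_distr:
      "distr (\<mu> \<Otimes>\<^sub>M \<mu>) (PiM F (\<lambda>_. borel)) (complex_coord F) = gauss_prod h F"
proof -
  let ?M = "\<mu> \<Otimes>\<^sub>M \<mu>" and ?C = "PiM F (\<lambda>_. borel :: complex measure)"
  interpret \<mu>: prob_space \<mu> using \<mu> by (simp add: is_gaussian_measure_def)
  interpret N: prob_space "gauss1 h" by (rule prob_space_gauss1[OF h])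
  interpret G: product_sigma_finite "\<lambda>_. gauss_complex h" using h by (rule product_sigma_finite_gauss)
  have z: "(\<lambda>p. Complex (fst p j) (snd p j)) \<in> borel_measurable ?M" if "j \<in> F" for j
  proof -
    have coord: "(\<lambda>x. x j) \<in> borel_measurable \<mu>"
      using F(2) that by (intro gaussian_measure_coordinate_measurable[OF \<mu> h b]) auto
    show ?thesis
      by (intro borel_measurable_Complex measurable_compose[OF measurable_fst coord]
          measurable_compose[OF measurable_snd coord])
  qed
  show meas: "complex_coord F \<in> measurable ?M ?C"
    unfolding complex_coord_def[abs_def] by (intro measurable_restrict z)
  show "distr ?M ?C (complex_coord F) = gauss_prod h F"
  proof (rule G.PiM_eqI[OF F(1)])
    show "sets (distr ?M ?C (complex_coord F)) = sets (gauss_prod h F)" by (simp add: sets_gauss_prod)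
    fix A :: "'a \<Rightarrow> complex set" assume "\<And>j. j \<in> F \<Longrightarrow> A j \<in> sets (gauss_complex h)"
    hence A: "A j \<in> sets borel" if "j \<in> F" for j using that by simp
    have box: "Pi\<^sub>E F A \<in> sets ?C" using F(1) A by (rule sets_PiM_I_finite)
    define I where "I j \<zeta> = (indicator (A j) \<zeta> :: ennreal)" for j \<zeta>
    have I: "I j \<in> borel_measurable borel" if "j \<in> F" for j
      unfolding I_def[abs_def] using A[OF that] by (rule borel_measurable_indicator)
    have ind: "indicator (complex_coord F -` Pi\<^sub>E F A \<inter> space ?M) p =
        (\<Prod>j\<in>F. I j (Complex (fst p j) (snd p j)))" if "p \<in> space ?M" for p
      using indicator_PiE[OF F(1), of "complex_coord F p" A] that
      by (simp add: I_def complex_coord_def indicator_def cong: prod.cong)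
    have pm: "(\<lambda>(r, s). I j (Complex r s)) \<in> borel_measurable (borel \<Otimes>\<^sub>M borel)" if "j \<in> F" for j
      unfolding case_prod_beta by (rule measurable_compose[OF _ I[OF that]]) measurable
    have sec: "(\<lambda>s. I j (Complex r s)) \<in> borel_measurable borel" if "j \<in> F" for j r
      by (rule measurable_compose[OF _ I[OF that]]) measurable
    have inner: "(\<lambda>r. \<integral>\<^sup>+s. I j (Complex r s) \<partial>gauss1 h) \<in> borel_measurable borel" if "j \<in> F" for j
      using pm[OF that] by (intro N.borel_measurable_nn_integral) (simp cong: measurable_cong_sets)
    have "emeasure (distr ?M ?C (complex_coord F)) (Pi\<^sub>E F A) =
        (\<integral>\<^sup>+p. (\<Prod>j\<in>F. I j (Complex (fst p j) (snd p j))) \<partial>?M)"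
      using measurable_sets[OF meas box]
      by (simp add: emeasure_distr[OF meas box] ind flip: nn_integral_indicator cong: nn_integral_cong)
    also have "\<dots> = (\<integral>\<^sup>+x. \<integral>\<^sup>+\<xi>. (\<Prod>j\<in>F. I j (Complex (x j) (\<xi> j))) \<partial>\<mu> \<partial>\<mu>)"
      by (subst \<mu>.nn_integral_fst[symmetric])
         (auto intro!: borel_measurable_prod_ennreal measurable_compose[OF z I])
    also have "\<dots> = (\<integral>\<^sup>+x. (\<Prod>j\<in>F. \<integral>\<^sup>+s. I j (Complex (x j) s) \<partial>gauss1 h) \<partial>\<mu>)"
      by (intro nn_integral_cong nn_integral_gaussian_prod[OF \<mu> h b F] sec)
    also have "\<dots> = (\<Prod>j\<in>F. \<integral>\<^sup>+r. \<integral>\<^sup>+s. I j (Complex r s) \<partial>gauss1 h \<partial>gauss1 h)"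
      by (intro nn_integral_gaussian_prod[OF \<mu> h b F] inner)
    also have "\<dots> = (\<Prod>j\<in>F. emeasure (gauss_complex h) (A j))"
      using A by (intro prod.cong refl, subst nn_integral_gauss_complex[OF h I, symmetric])
        (auto simp: I_def[abs_def])
    finally show "emeasure (distr ?M ?C (complex_coord F)) (Pi\<^sub>E F A) =
        (\<Prod>j\<in>F. emeasure (gauss_complex h) (A j))" .
  qed
qed

lemma
  assumes X: "X \<in> measurable M N" and f: "f \<in> borel_measurable N"
  shows L2_distr_iff: "(\<lambda>w. f (X w)) \<in> L2 M \<longleftrightarrow> f \<in> L2 (distr M N X)"
    and L2_norm_distr: "L2_norm M (\<lambda>w. f (X w)) = L2_norm (distr M N X) f"
proof -
  note [measurable] = X f
  show "(\<lambda>w. f (X w)) \<in> L2 M \<longleftrightarrow> f \<in> L2 (distr M N X)"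
    by (simp add: L2_iff_nn_integral nn_integral_distr)
  show "L2_norm M (\<lambda>w. f (X w)) = L2_norm (distr M N X) f"
    by (simp add: L2_norm_def integral_distr)
qed


section \<open>The normalized antiholomorphic monomials\<close>

definition Q_const :: "('g \<Rightarrow> nat) \<Rightarrow> real \<Rightarrow> complex" where
  "Q_const \<alpha> h = complex_of_real ((2 * h) powr (- real (\<Sum>j\<in>S_supp \<alpha>. \<alpha> j) / 2))"

lemma Q_const_nonzero: "h > 0 \<Longrightarrow> Q_const \<alpha> h \<noteq> 0"
  by (simp add: Q_const_def)

lemma Q_fun_complex_coord:
  assumes "finite F" "S_supp \<alpha> \<subseteq> F"
  shows "Q_fun \<alpha> h p = Q_const \<alpha> h * (\<Prod>j\<in>F. cnj (complex_coord F p j) ^ \<alpha> j)"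
proof -
  have "(\<Prod>j\<in>F. cnj (complex_coord F p j) ^ \<alpha> j) = (\<Prod>j\<in>S_supp \<alpha>. cnj (complex_coord F p j) ^ \<alpha> j)"
    using assms by (intro prod.mono_neutral_right) (auto simp: S_supp_def Suc_le_eq)
  also have "\<dots> = (\<Prod>j\<in>S_supp \<alpha>. (complex_of_real (fst p j) - \<i> * complex_of_real (snd p j)) ^ \<alpha> j)"
  proof (intro prod.cong refl)
    fix j assume "j \<in> S_supp \<alpha>"
    hence "j \<in> F" using assms(2) by auto
    hence "cnj (complex_coord F p j) = complex_of_real (fst p j) - \<i> * complex_of_real (snd p j)"
      by (simp add: complex_coord_def complex_eq_iff)
    thus "cnj (complex_coord F p j) ^ \<alpha> j =
        (complex_of_real (fst p j) - \<i> * complex_of_real (snd p j)) ^ \<alpha> j" by simp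
  qed
  finally show ?thesis by (simp add: Q_fun_def Q_const_def case_prod_beta)
qed

lemma S_supp_count: "S_supp (count (mset xs)) = set xs"
  by (auto simp: S_supp_def Suc_le_eq count_greater_zero_iff)

lemma sum_count_mset: "(\<Sum>j\<in>set xs. count (mset xs) j) = length xs"
  using size_multiset_overloaded_eq[of "mset xs"] by simp

text \<open>Finitely supported multi-indices are the multiplicity functions of lists, which index the
  products of unit vectors in the Fock space.\<close>

lemma multi_indices_eq_counts:
  "{Q_fun \<alpha> h |\<alpha>. finite (S_supp \<alpha>) \<and> S_supp \<alpha> \<subseteq> E} = {Q_fun (count (mset xs)) h |xs. set xs \<subseteq> E}"
proof (intro equalityI subsetI)
  fix q assume "q \<in> {Q_fun \<alpha> h |\<alpha>. finite (S_supp \<alpha>) \<and> S_supp \<alpha> \<subseteq> E}"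
  then obtain \<alpha> where \<alpha>: "q = Q_fun \<alpha> h" "finite (S_supp \<alpha>)" "S_supp \<alpha> \<subseteq> E" by blast
  have "finite {x. 0 < \<alpha> x}" using \<alpha>(2) by (simp add: S_supp_def Suc_le_eq)
  hence c: "count (Abs_multiset \<alpha>) = \<alpha>" by (rule count_Abs_multiset)
  obtain xs where xs: "mset xs = Abs_multiset \<alpha>" using ex_mset by blast
  have "count (mset xs) = \<alpha>" using c xs by simp
  moreover from this have "set xs \<subseteq> E" using \<alpha>(3) S_supp_count[of xs] by simp
  ultimately show "q \<in> {Q_fun (count (mset xs)) h |xs. set xs \<subseteq> E}" using \<alpha>(1) by blast
next
  fix q assume "q \<in> {Q_fun (count (mset xs)) h |xs. set xs \<subseteq> E}"
  then obtain xs where "q = Q_fun (count (mset xs)) h" "set xs \<subseteq> E" by blast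
  thus "q \<in> {Q_fun \<alpha> h |\<alpha>. finite (S_supp \<alpha>) \<and> S_supp \<alpha> \<subseteq> E}"
    using S_supp_count[of xs] by (intro CollectI exI[of _ "count (mset xs)"]) auto
qed

lemma Q_fun_list:
  assumes "h > 0"
  shows "Q_fun (count (mset xs)) h p = (\<Prod>i<length xs. complex_of_real ((2 * h) powr (- 1 / 2)) *
     (complex_of_real (fst p (xs ! i)) - \<i> * complex_of_real (snd p (xs ! i))))"
proof -
  define g where "g j = complex_of_real (fst p j) - \<i> * complex_of_real (snd p j)" for j
  have "(\<Prod>j\<in>set xs. g j ^ count (mset xs) j) = prod_list (map g xs)"
    using image_prod_mset_multiplicity[of g "mset xs"] by (simp flip: prod_mset_prod_list)
  also have "\<dots> = (\<Prod>i<length xs. g (xs ! i))"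
    by (simp add: prod.list_conv_set_nth atLeast0LessThan)
  finally have g: "(\<Prod>j\<in>set xs. g j ^ count (mset xs) j) = (\<Prod>i<length xs. g (xs ! i))" .
  have "(2 * h) powr (- real (length xs) / 2) = ((2 * h) powr (- 1 / 2)) ^ length xs"
    using assms by (simp add: powr_power)
  thus ?thesis
    by (simp add: Q_fun_def case_prod_beta S_supp_count sum_count_mset prod.distrib
        flip: g_def g)
qed

lemma
  assumes \<mu>: "is_gaussian_measure b E h \<mu>" and h: "h > 0" and b: "\<forall>j\<in>E. b j > 0"
    and xs: "set xs \<subseteq> E"
  shows Q_fun_L2: "Q_fun (count (mset xs)) h \<in> L2 (\<mu> \<Otimes>\<^sub>M \<mu>)"
    and Q_fun_norm: "(L2_norm (\<mu> \<Otimes>\<^sub>M \<mu>) (Q_fun (count (mset xs)) h))\<^sup>2 =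
      (\<Prod>x\<in>set xs. fact (count (mset xs) x))"
proof -
  define F where "F = set xs"
  define \<alpha> where "\<alpha> = count (mset xs)"
  have F: "finite F" "F \<subseteq> E" using xs by (auto simp: F_def)
  interpret G: product_sigma_finite "\<lambda>_::'a. gauss_complex h" using h by (rule product_sigma_finite_gauss)
  note zm = complex_coord_measurable[OF \<mu> h b F]
  note zd = complex_coord_distr[OF \<mu> h b F]
  define g where "g z = Q_const \<alpha> h * (\<Prod>j\<in>F. cnj (z j) ^ \<alpha> j)" for z
  have Q: "Q_fun \<alpha> h = (\<lambda>p. g (complex_coord F p))"
    by (rule ext, unfold g_def, rule Q_fun_complex_coord) (use F in \<open>auto simp: \<alpha>_def S_supp_count F_def\<close>)
  have [measurable]: "cnj \<in> borel_measurable borel"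
    by (intro borel_measurable_continuous_onI continuous_intros)
  have gm: "g \<in> borel_measurable (PiM F (\<lambda>_. borel))"
    unfolding g_def by measurable
  have K: "(cmod (Q_const \<alpha> h))\<^sup>2 = 1 / (2 * h) ^ length xs"
  proof -
    have "(cmod (Q_const \<alpha> h))\<^sup>2 = ((2 * h) powr (- real (length xs) / 2)) ^ 2"
      by (simp add: Q_const_def \<alpha>_def S_supp_count sum_count_mset)
    also have "\<dots> = (2 * h) powr (- real (length xs))"
      by (simp add: power2_eq_square flip: powr_add)
    finally show ?thesis using h by (simp add: powr_minus_divide powr_realpow)
  qed
  have "(\<integral>\<^sup>+z. ennreal ((cmod (g z))\<^sup>2) \<partial>gauss_prod h F) =
    (\<integral>\<^sup>+z. ennreal (1 / (2 * h) ^ length xs) * (\<Prod>j\<in>F. ennreal ((cmod (z j))\<^sup>2 ^ \<alpha> j)) \<partial>gauss_prod h F)"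
  proof (rule nn_integral_cong)
    fix z
    have "(cmod (g z))\<^sup>2 = 1 / (2 * h) ^ length xs * (\<Prod>j\<in>F. (cmod (z j))\<^sup>2 ^ \<alpha> j)"
    proof -
      have "(cmod (\<Prod>j\<in>F. cnj (z j) ^ \<alpha> j))\<^sup>2 = (\<Prod>j\<in>F. (cmod (z j) ^ \<alpha> j)\<^sup>2)"
        by (simp add: norm_power prod_norm[symmetric] prod_power_distrib)
      also have "\<dots> = (\<Prod>j\<in>F. (cmod (z j))\<^sup>2 ^ \<alpha> j)"
        by (simp only: power_mult[symmetric] mult.commute)
      finally show ?thesis unfolding g_def norm_mult power_mult_distrib K by simp
    qed
    thus "ennreal ((cmod (g z))\<^sup>2) =
        ennreal (1 / (2 * h) ^ length xs) * (\<Prod>j\<in>F. ennreal ((cmod (z j))\<^sup>2 ^ \<alpha> j))"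
      using h by (simp add: ennreal_mult'[symmetric] prod_ennreal prod_nonneg)
  qed
  also have "\<dots> = ennreal (1 / (2 * h) ^ length xs) *
      (\<integral>\<^sup>+z. (\<Prod>j\<in>F. ennreal ((cmod (z j))\<^sup>2 ^ \<alpha> j)) \<partial>gauss_prod h F)"
    by (rule nn_integral_cmult) measurable
  also have "(\<integral>\<^sup>+z. (\<Prod>j\<in>F. ennreal ((cmod (z j))\<^sup>2 ^ \<alpha> j)) \<partial>gauss_prod h F) =
      (\<Prod>j\<in>F. \<integral>\<^sup>+\<zeta>. ennreal ((cmod \<zeta>)\<^sup>2 ^ \<alpha> j) \<partial>gauss_complex h)"
    by (rule G.product_nn_integral_prod[OF F(1)]) measurable
  also have "\<dots> = ennreal ((2 * h) ^ length xs * (\<Prod>j\<in>F. fact (\<alpha> j)))"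
  proof -
    have "(\<Prod>j\<in>F. (2 * h) ^ \<alpha> j) = (2 * h) ^ length xs"
      by (simp only: power_sum[symmetric] F_def \<alpha>_def sum_count_mset)
    thus ?thesis using h
      by (simp add: nn_integral_gauss_complex_moment[OF h] prod_ennreal prod.distrib)
  qed
  also have "ennreal (1 / (2 * h) ^ length xs) * \<dots> = ennreal (\<Prod>j\<in>F. fact (\<alpha> j))"
    using h by (simp add: ennreal_mult'[symmetric])
  finally have int: "(\<integral>\<^sup>+z. ennreal ((cmod (g z))\<^sup>2) \<partial>gauss_prod h F) = ennreal (\<Prod>j\<in>F. fact (\<alpha> j))" .
  have "g \<in> borel_measurable (gauss_prod h F)"
    using gm measurable_cong_sets[OF sets_gauss_prod refl] by blast
  hence gL: "g \<in> L2 (gauss_prod h F)"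
    using int by (simp add: L2_iff_nn_integral)
  show Q2: "Q_fun (count (mset xs)) h \<in> L2 (\<mu> \<Otimes>\<^sub>M \<mu>)"
    using L2_distr_iff[OF zm gm] gL by (simp add: zd Q \<alpha>_def[symmetric])
  have "ennreal ((L2_norm (gauss_prod h F) g)\<^sup>2) = ennreal (\<Prod>j\<in>F. fact (\<alpha> j))"
    by (simp add: ennreal_L2_norm_power2[OF gL] int)
  hence "(L2_norm (gauss_prod h F) g)\<^sup>2 = (\<Prod>j\<in>F. fact (\<alpha> j))"
    by (subst (asm) ennreal_inj) (auto intro: prod_nonneg)
  moreover have "L2_norm (\<mu> \<Otimes>\<^sub>M \<mu>) (Q_fun \<alpha> h) = L2_norm (gauss_prod h F) g"
    using L2_norm_distr[OF zm gm] by (simp add: zd Q)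
  ultimately show "(L2_norm (\<mu> \<Otimes>\<^sub>M \<mu>) (Q_fun (count (mset xs)) h))\<^sup>2 =
      (\<Prod>x\<in>set xs. fact (count (mset xs) x))"
    by (simp add: \<alpha>_def F_def)
qed


section \<open>Cylindrical antiholomorphic functions\<close>

text \<open>The coefficients of the differential in the definition of antiholomorphy.\<close>

definition antilinear_derivative ::
  "'g set \<Rightarrow> (('g \<Rightarrow> complex) \<Rightarrow> complex) \<Rightarrow> ('g \<Rightarrow> complex) \<Rightarrow> ('g \<Rightarrow> complex) \<Rightarrow> bool" where
  "antilinear_derivative F g z a \<longleftrightarrow> (\<forall>\<epsilon>>0. \<exists>\<delta>>0. \<forall>w \<in> F \<rightarrow>\<^sub>E UNIV.
     (\<Sum>j\<in>F. cmod (w j - z j)) < \<delta> \<longrightarrow>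
     cmod (g w - g z - (\<Sum>j\<in>F. a j * cnj (w j - z j))) \<le> \<epsilon> * (\<Sum>j\<in>F. cmod (w j - z j)))"

lemma antiholomorphic_iff:
  "antiholomorphic F g \<longleftrightarrow> (\<forall>z \<in> F \<rightarrow>\<^sub>E UNIV. \<exists>a. antilinear_derivative F g z a)"
  by (simp add: antiholomorphic_def antilinear_derivative_def)

lemma antilinear_derivativeE:
  assumes "antilinear_derivative F g z a" "\<epsilon> > 0"
  obtains \<delta> where "\<delta> > 0" "\<And>w. w \<in> F \<rightarrow>\<^sub>E UNIV \<Longrightarrow> (\<Sum>j\<in>F. cmod (w j - z j)) < \<delta> \<Longrightarrow>
    cmod (g w - g z - (\<Sum>j\<in>F. a j * cnj (w j - z j))) \<le> \<epsilon> * (\<Sum>j\<in>F. cmod (w j - z j))"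
  using assms unfolding antilinear_derivative_def by blast

lemma antiholomorphic_const: "antiholomorphic F (\<lambda>_. c)"
proof -
  have "antilinear_derivative F (\<lambda>_. c) z (\<lambda>_. 0)" for z
    unfolding antilinear_derivative_def
    by (intro allI impI exI[of _ 1]) (auto intro!: mult_nonneg_nonneg sum_nonneg)
  thus ?thesis unfolding antiholomorphic_iff by blast
qed

lemma antiholomorphic_cnj_coord:
  assumes "finite F" "i \<in> F"
  shows "antiholomorphic F (\<lambda>w. cnj (w i))"
proof -
  have "(\<Sum>j\<in>F. (if j = i then 1 else 0) * cnj (w j - z j)) = cnj (w i) - cnj (z i)" for w z
    using assms by (simp add: if_distrib[of "\<lambda>a. a * _"] cong: if_cong)
  hence "antilinear_derivative F (\<lambda>w. cnj (w i)) z (\<lambda>j. if j = i then 1 else 0)" for z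
    unfolding antilinear_derivative_def
    by (intro allI impI exI[of _ 1]) (auto intro!: mult_nonneg_nonneg sum_nonneg)
  thus ?thesis unfolding antiholomorphic_iff by blast
qed

lemma antilinear_derivative_add:
  assumes f: "antilinear_derivative F f z a" and g: "antilinear_derivative F g z a'"
  shows "antilinear_derivative F (\<lambda>w. f w + g w) z (\<lambda>j. a j + a' j)"
  unfolding antilinear_derivative_def
proof (intro allI impI)
  let ?D = "\<lambda>w. \<Sum>j\<in>F. cmod (w j - z j)"
  fix \<epsilon> :: real assume "\<epsilon> > 0"
  hence e: "\<epsilon> / 2 > 0" by simp
  obtain \<delta> where d: "\<delta> > 0" "\<And>w. w \<in> F \<rightarrow>\<^sub>E UNIV \<Longrightarrow> ?D w < \<delta> \<Longrightarrow>
    cmod (f w - f z - (\<Sum>j\<in>F. a j * cnj (w j - z j))) \<le> \<epsilon> / 2 * ?D w"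
    using antilinear_derivativeE[OF f e] by blast
  obtain \<delta>' where d': "\<delta>' > 0" "\<And>w. w \<in> F \<rightarrow>\<^sub>E UNIV \<Longrightarrow> ?D w < \<delta>' \<Longrightarrow>
    cmod (g w - g z - (\<Sum>j\<in>F. a' j * cnj (w j - z j))) \<le> \<epsilon> / 2 * ?D w"
    using antilinear_derivativeE[OF g e] by blast
  have "cmod (f w + g w - (f z + g z) - (\<Sum>j\<in>F. (a j + a' j) * cnj (w j - z j))) \<le> \<epsilon> * ?D w"
    if w: "w \<in> F \<rightarrow>\<^sub>E UNIV" "?D w < min \<delta> \<delta>'" for w
  proof -
    have "f w + g w - (f z + g z) - (\<Sum>j\<in>F. (a j + a' j) * cnj (w j - z j)) =
      (f w - f z - (\<Sum>j\<in>F. a j * cnj (w j - z j))) + (g w - g z - (\<Sum>j\<in>F. a' j * cnj (w j - z j)))"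
      by (simp add: ring_distribs sum.distrib sum_subtractf)
    also have "cmod \<dots> \<le> \<epsilon> / 2 * ?D w + \<epsilon> / 2 * ?D w"
      using w by (intro norm_triangle_mono d(2) d'(2)) auto
    finally show ?thesis by simp
  qed
  thus "\<exists>\<delta>>0. \<forall>w \<in> F \<rightarrow>\<^sub>E UNIV. ?D w < \<delta> \<longrightarrow>
      cmod (f w + g w - (f z + g z) - (\<Sum>j\<in>F. (a j + a' j) * cnj (w j - z j))) \<le> \<epsilon> * ?D w"
    using d(1) d'(1) by (intro exI[of _ "min \<delta> \<delta>'"]) auto
qed

lemma antiholomorphic_add:
  assumes "antiholomorphic F f" "antiholomorphic F g"
  shows "antiholomorphic F (\<lambda>w. f w + g w)"
  unfolding antiholomorphic_iff
proof
  fix z assume "z \<in> F \<rightarrow>\<^sub>E (UNIV :: complex set)"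
  then obtain a a' where f: "antilinear_derivative F f z a" and g: "antilinear_derivative F g z a'"
    using assms unfolding antiholomorphic_iff by blast
  show "\<exists>a. antilinear_derivative F (\<lambda>w. f w + g w) z a"
    by (rule exI, rule antilinear_derivative_add[OF f g])
qed

lemma norm_antilinear_le:
  assumes "finite F"
  shows "cmod (\<Sum>j\<in>F. a j * cnj (w j - z j)) \<le> (\<Sum>j\<in>F. cmod (a j)) * (\<Sum>j\<in>F. cmod (w j - z j))"
proof -
  have "cmod (\<Sum>j\<in>F. a j * cnj (w j - z j)) \<le> (\<Sum>j\<in>F. cmod (a j) * cmod (w j - z j))"
    by (rule sum_norm_le) (simp only: norm_mult complex_mod_cnj order_refl)
  also have "\<dots> \<le> (\<Sum>j\<in>F. cmod (a j) * (\<Sum>j\<in>F. cmod (w j - z j)))"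
    using assms by (intro sum_mono mult_left_mono member_le_sum) auto
  finally show ?thesis by (simp add: sum_distrib_right)
qed

lemma antilinear_derivative_mult:
  assumes F: "finite F" and f: "antilinear_derivative F f z a" and g: "antilinear_derivative F g z a'"
  shows "antilinear_derivative F (\<lambda>w. f w * g w) z (\<lambda>j. a j * g z + f z * a' j)"
  unfolding antilinear_derivative_def
proof (intro allI impI)
  fix \<epsilon> :: real assume e: "\<epsilon> > 0"
  define D where "D w = (\<Sum>j\<in>F. cmod (w j - z j))" for w
  have D0: "D w \<ge> 0" for w by (simp add: D_def sum_nonneg)
  define L where "L w = (\<Sum>j\<in>F. a j * cnj (w j - z j))" for w
  define L' where "L' w = (\<Sum>j\<in>F. a' j * cnj (w j - z j))" for w
  define A where "A = (\<Sum>j\<in>F. cmod (a j))"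
  define A' where "A' = (\<Sum>j\<in>F. cmod (a' j))"
  have A0: "A \<ge> 0" "A' \<ge> 0" by (auto simp: A_def A'_def sum_nonneg)
  have L: "cmod (L w) \<le> A * D w" "cmod (L' w) \<le> A' * D w" for w
    unfolding L_def L'_def A_def A'_def D_def by (rule norm_antilinear_le[OF F])+
  define B where "B = cmod (f z) + cmod (g z) + 1"
  define C where "C = (A + 1) * (A' + 1)"
  have B: "B > 0" unfolding B_def by (intro add_nonneg_pos add_nonneg_nonneg) auto
  have C: "C > 0" using A0 by (simp add: C_def)
  \<comment> \<open>The two remainders, multiplied by the values at \<open>z\<close>, use up one half of \<open>\<epsilon>\<close>; the product of the
    increments is of second order and uses up the other half.\<close>
  define \<eta> where "\<eta> = min 1 (\<epsilon> / (2 * B))"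
  have \<eta>: "\<eta> > 0" "\<eta> \<le> 1" "\<eta> * B \<le> \<epsilon> / 2"
  proof -
    show "\<eta> > 0" "\<eta> \<le> 1" using e B by (auto simp: \<eta>_def)
    have "\<eta> * B \<le> \<epsilon> / (2 * B) * B" using B by (intro mult_right_mono) (auto simp: \<eta>_def)
    thus "\<eta> * B \<le> \<epsilon> / 2" using B by simp
  qed
  obtain \<delta> where d: "\<delta> > 0"
    "\<And>w. w \<in> F \<rightarrow>\<^sub>E UNIV \<Longrightarrow> D w < \<delta> \<Longrightarrow> cmod (f w - f z - L w) \<le> \<eta> * D w"
    by (rule antilinear_derivativeE[OF f \<eta>(1)]) (auto simp: D_def L_def)
  obtain \<delta>' where d': "\<delta>' > 0"
    "\<And>w. w \<in> F \<rightarrow>\<^sub>E UNIV \<Longrightarrow> D w < \<delta>' \<Longrightarrow> cmod (g w - g z - L' w) \<le> \<eta> * D w"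
    by (rule antilinear_derivativeE[OF g \<eta>(1)]) (auto simp: D_def L'_def)
  define r where "r = min (min \<delta> \<delta>') (\<epsilon> / (2 * C))"
  have r: "r > 0" using d d' e C by (simp add: r_def)
  have "cmod (f w * g w - f z * g z - (\<Sum>j\<in>F. (a j * g z + f z * a' j) * cnj (w j - z j))) \<le> \<epsilon> * D w"
    if w: "w \<in> F \<rightarrow>\<^sub>E UNIV" "D w < r" for w
  proof -
    define p where "p = f w - f z - L w"
    define q where "q = g w - g z - L' w"
    have p: "cmod p \<le> \<eta> * D w" and q: "cmod q \<le> \<eta> * D w"
      unfolding p_def q_def using w by (auto intro!: d(2) d'(2) simp: r_def)
    have \<eta>D: "\<eta> * D w \<le> 1 * D w" by (intro mult_right_mono \<eta> D0)
    have fw: "cmod (L w + p) \<le> (A + 1) * D w"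
      using norm_triangle_mono[OF L(1)[of w] p] \<eta>D by (simp add: ring_distribs)
    have gw: "cmod (L' w + q) \<le> (A' + 1) * D w"
      using norm_triangle_mono[OF L(2)[of w] q] \<eta>D by (simp add: ring_distribs)
    have lin: "(\<Sum>j\<in>F. (a j * g z + f z * a' j) * cnj (w j - z j)) = L w * g z + f z * L' w"
      by (simp add: L_def L'_def ring_distribs sum.distrib sum_subtractf sum_distrib_left
          sum_distrib_right mult_ac)
    have "f w * g w - f z * g z - (L w * g z + f z * L' w) =
        (p * g z + f z * q) + (L w + p) * (L' w + q)"
      by (simp add: p_def q_def algebra_simps)
    also have "cmod \<dots> \<le> (\<eta> * D w * cmod (g z) + cmod (f z) * (\<eta> * D w)) +
        ((A + 1) * D w) * ((A' + 1) * D w)"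
    proof (intro norm_triangle_mono)
      show "cmod (p * g z) \<le> \<eta> * D w * cmod (g z)"
        unfolding norm_mult by (intro mult_right_mono p) auto
      show "cmod (f z * q) \<le> cmod (f z) * (\<eta> * D w)"
        unfolding norm_mult by (intro mult_left_mono q) auto
      show "cmod ((L w + p) * (L' w + q)) \<le> ((A + 1) * D w) * ((A' + 1) * D w)"
        unfolding norm_mult using A0 D0 by (intro mult_mono fw gw) auto
    qed
    also have "\<dots> = (\<eta> * (cmod (f z) + cmod (g z))) * D w + C * D w * D w"
      by (simp add: C_def algebra_simps)
    also have "\<dots> \<le> (\<eta> * B) * D w + C * r * D w"
      using w(2) C \<eta>(1) by (intro add_mono mult_right_mono mult_left_mono D0) (auto simp: B_def)
    also have "\<dots> \<le> \<epsilon> / 2 * D w + \<epsilon> / 2 * D w"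
    proof (intro add_mono mult_right_mono \<eta>(3) D0)
      have "C * r \<le> C * (\<epsilon> / (2 * C))" using C by (intro mult_left_mono) (auto simp: r_def)
      thus "C * r \<le> \<epsilon> / 2" using C by simp
    qed
    finally show ?thesis unfolding lin by simp
  qed
  thus "\<exists>\<delta>>0. \<forall>w \<in> F \<rightarrow>\<^sub>E UNIV. (\<Sum>j\<in>F. cmod (w j - z j)) < \<delta> \<longrightarrow>
      cmod (f w * g w - f z * g z - (\<Sum>j\<in>F. (a j * g z + f z * a' j) * cnj (w j - z j)))
        \<le> \<epsilon> * (\<Sum>j\<in>F. cmod (w j - z j))"
    using r unfolding D_def by blast
qed

lemma antiholomorphic_mult:
  assumes "finite F" and "antiholomorphic F f" "antiholomorphic F g"
  shows "antiholomorphic F (\<lambda>w. f w * g w)"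
  unfolding antiholomorphic_iff
proof
  fix z assume "z \<in> F \<rightarrow>\<^sub>E (UNIV :: complex set)"
  then obtain a a' where f: "antilinear_derivative F f z a" and g: "antilinear_derivative F g z a'"
    using assms unfolding antiholomorphic_iff by blast
  show "\<exists>a. antilinear_derivative F (\<lambda>w. f w * g w) z a"
    by (rule exI, rule antilinear_derivative_mult[OF assms(1) f g])
qed

lemma antiholomorphic_power:
  "finite F \<Longrightarrow> antiholomorphic F g \<Longrightarrow> antiholomorphic F (\<lambda>w. g w ^ n)"
  by (induction n) (auto intro: antiholomorphic_const antiholomorphic_mult)

lemma antiholomorphic_prod:
  "finite F \<Longrightarrow> (\<And>i. i \<in> I \<Longrightarrow> antiholomorphic F (g i)) \<Longrightarrow> antiholomorphic F (\<lambda>w. \<Prod>i\<in>I. g i w)"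
  by (induction I rule: infinite_finite_induct) (auto intro: antiholomorphic_const antiholomorphic_mult)

lemma antiholomorphic_sum:
  "(\<And>i. i \<in> I \<Longrightarrow> antiholomorphic F (g i)) \<Longrightarrow> antiholomorphic F (\<lambda>w. \<Sum>i\<in>I. g i w)"
  by (induction I rule: infinite_finite_induct) (auto intro: antiholomorphic_const antiholomorphic_add)

text \<open>
  The antilinear differential gives continuity, and its conjugate restricted to one variable is a
  complex derivative.
\<close>

lemma entire_cnj_antiholomorphic:
  assumes F: "finite F" and g: "antiholomorphic F g"
  shows "entire (\<lambda>z. cnj (g (restrict z F)))"
  unfolding entire_def
proof (intro conjI allI)
  have "((\<lambda>z. cnj (g (restrict z F))) \<longlongrightarrow> cnj (g (restrict z F))) (at z)" for z
    unfolding tendsto_iff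
  proof (intro allI impI)
    fix \<epsilon> :: real assume e: "\<epsilon> > 0"
    define D where "D w = (\<Sum>j\<in>F. cmod (w j - z j))" for w
    have Dr: "(\<Sum>j\<in>F. cmod (restrict w F j - restrict z F j)) = D w" for w
      by (simp add: D_def)
    obtain a where "antilinear_derivative F g (restrict z F) a"
      using g unfolding antiholomorphic_iff by (meson restrict_PiE_iff UNIV_I)
    from antilinear_derivativeE[OF this zero_less_one] obtain \<delta> where d: "\<delta> > 0"
      "\<And>w. w \<in> F \<rightarrow>\<^sub>E UNIV \<Longrightarrow> (\<Sum>j\<in>F. cmod (w j - restrict z F j)) < \<delta> \<Longrightarrow>
        cmod (g w - g (restrict z F) - (\<Sum>j\<in>F. a j * cnj (w j - restrict z F j)))
          \<le> 1 * (\<Sum>j\<in>F. cmod (w j - restrict z F j))" by blast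
    define A where "A = (\<Sum>j\<in>F. cmod (a j)) + 1"
    have A: "A > 0" unfolding A_def by (intro add_nonneg_pos sum_nonneg) auto
    have "continuous_on UNIV D" unfolding D_def
      by (intro continuous_intros continuous_on_product_coordinates)
    hence "(D \<longlongrightarrow> D z) (at z)" by (auto simp: continuous_on_def)
    hence "eventually (\<lambda>w. D w < min \<delta> (\<epsilon> / A)) (at z)"
      using d(1) e A by (intro order_tendstoD(2)[of D "D z"]) (auto simp: D_def)
    thus "\<forall>\<^sub>F w in at z. dist (cnj (g (restrict w F))) (cnj (g (restrict z F))) < \<epsilon>"
    proof eventually_elim
      case (elim w)
      define S where "S = (\<Sum>j\<in>F. a j * cnj (restrict w F j - restrict z F j))"
      have "g (restrict w F) - g (restrict z F) = (g (restrict w F) - g (restrict z F) - S) + S"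
        by simp
      also have "cmod \<dots> \<le> 1 * D w + (\<Sum>j\<in>F. cmod (a j)) * D w"
      proof (intro norm_triangle_mono)
        show "cmod (g (restrict w F) - g (restrict z F) - S) \<le> 1 * D w"
          using d(2)[of "restrict w F"] elim unfolding S_def Dr by auto
        show "cmod S \<le> (\<Sum>j\<in>F. cmod (a j)) * D w"
          unfolding S_def Dr[symmetric] by (rule norm_antilinear_le[OF F])
      qed
      also have "\<dots> = A * D w" by (simp add: A_def ring_distribs)
      also have "\<dots> < \<epsilon>" using elim A by (simp add: pos_less_divide_eq mult.commute)
      finally show ?case by (simp add: dist_norm flip: complex_cnj_diff)
    qed
  qed
  thus "continuous_on UNIV (\<lambda>z. cnj (g (restrict z F)))"
    by (simp add: continuous_on_def)
next
  fix z i
  define u where "u \<zeta> = cnj (g (restrict (z(i := \<zeta>)) F))" for \<zeta>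
  show "(\<lambda>\<zeta>. cnj (g (restrict (z(i := \<zeta>)) F))) holomorphic_on UNIV"
  proof (cases "i \<in> F")
    case False
    hence "restrict (z(i := \<zeta>)) F = restrict z F" for \<zeta> by (auto simp: restrict_def fun_eq_iff)
    thus ?thesis by simp
  next
    case True
    have "\<exists>d. (u has_field_derivative d) (at \<zeta>0)" for \<zeta>0
    proof -
      define z0 where "z0 = restrict (z(i := \<zeta>0)) F"
      have dif: "restrict (z(i := \<zeta>)) F j - z0 j = (if j = i then \<zeta> - \<zeta>0 else 0)" if "j \<in> F" for j \<zeta>
        using that by (auto simp: z0_def)
      have D: "(\<Sum>j\<in>F. cmod (restrict (z(i := \<zeta>)) F j - z0 j)) = cmod (\<zeta> - \<zeta>0)" for \<zeta>
      proof -
        have "(\<Sum>j\<in>F. cmod (restrict (z(i := \<zeta>)) F j - z0 j)) =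
            (\<Sum>j\<in>F. if j = i then cmod (\<zeta> - \<zeta>0) else 0)"
          by (intro sum.cong refl) (simp add: dif del: restrict_apply)
        thus ?thesis using True F by simp
      qed
      obtain a where a: "antilinear_derivative F g z0 a"
        using g unfolding antiholomorphic_iff z0_def by (meson restrict_PiE_iff UNIV_I)
      have lin: "(\<Sum>j\<in>F. a j * cnj (restrict (z(i := \<zeta>)) F j - z0 j)) = a i * cnj (\<zeta> - \<zeta>0)" for \<zeta>
      proof -
        have "(\<Sum>j\<in>F. a j * cnj (restrict (z(i := \<zeta>)) F j - z0 j)) =
            (\<Sum>j\<in>F. if j = i then a i * cnj (\<zeta> - \<zeta>0) else 0)"
          by (intro sum.cong refl) (auto simp add: dif simp del: restrict_apply)
        thus ?thesis using True F by simp
      qed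
      have "(u has_derivative (\<lambda>h. cnj (a i) * h)) (at \<zeta>0)"
        unfolding has_derivative_at_alt
      proof (intro conjI allI impI bounded_linear_mult_right)
        fix \<epsilon> :: real assume e: "\<epsilon> > 0"
        obtain \<delta> where d: "\<delta> > 0" "\<And>w. w \<in> F \<rightarrow>\<^sub>E UNIV \<Longrightarrow> (\<Sum>j\<in>F. cmod (w j - z0 j)) < \<delta> \<Longrightarrow>
          cmod (g w - g z0 - (\<Sum>j\<in>F. a j * cnj (w j - z0 j))) \<le> \<epsilon> * (\<Sum>j\<in>F. cmod (w j - z0 j))"
          using antilinear_derivativeE[OF a e] by blast
        have "cmod (u \<zeta> - u \<zeta>0 - cnj (a i) * (\<zeta> - \<zeta>0)) \<le> \<epsilon> * cmod (\<zeta> - \<zeta>0)"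
          if "cmod (\<zeta> - \<zeta>0) < \<delta>" for \<zeta>
        proof -
          have "u \<zeta> - u \<zeta>0 - cnj (a i) * (\<zeta> - \<zeta>0) =
              cnj (g (restrict (z(i := \<zeta>)) F) - g z0 - a i * cnj (\<zeta> - \<zeta>0))"
            by (simp add: u_def z0_def)
          hence "cmod (u \<zeta> - u \<zeta>0 - cnj (a i) * (\<zeta> - \<zeta>0)) =
              cmod (g (restrict (z(i := \<zeta>)) F) - g z0 - a i * cnj (\<zeta> - \<zeta>0))"
            by (simp only: complex_mod_cnj)
          also have "\<dots> \<le> \<epsilon> * cmod (\<zeta> - \<zeta>0)"
            using d(2)[of "restrict (z(i := \<zeta>)) F"] that unfolding D lin by simp
          finally show ?thesis .
        qed
        thus "\<exists>\<delta>>0. \<forall>\<zeta>. cmod (\<zeta> - \<zeta>0) < \<delta> \<longrightarrow>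
            cmod (u \<zeta> - u \<zeta>0 - cnj (a i) * (\<zeta> - \<zeta>0)) \<le> \<epsilon> * cmod (\<zeta> - \<zeta>0)"
          using d(1) by blast
      qed
      thus ?thesis unfolding has_field_derivative_def by blast
    qed
    hence "u holomorphic_on UNIV"
      by (auto simp: holomorphic_on_def field_differentiable_def)
    thus ?thesis by (simp add: u_def[abs_def])
  qed
qed


section \<open>Antiholomorphic functions and polynomials have the same closure\<close>

lemma cspan_Q_fun_of_monomials:
  assumes F: "finite F" "F \<subseteq> E" and h: "h > 0" and p: "p \<in> cspan (monomials F)"
  shows "(\<lambda>w. cnj (p (complex_coord F w))) \<in> cspan {Q_fun \<alpha> h |\<alpha>. finite (S_supp \<alpha>) \<and> S_supp \<alpha> \<subseteq> E}"
    (is "_ \<in> cspan ?Q")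
proof -
  obtain T c where T: "finite T" "T \<subseteq> monomials F" "p = (\<lambda>z. \<Sum>g\<in>T. c g * g z)"
    using p by (auto simp: cspan_def)
  have "(\<lambda>w. cnj (g (complex_coord F w))) \<in> cspan ?Q" if gT: "g \<in> T" for g
  proof -
    obtain \<beta> where g: "g = (\<lambda>z. \<Prod>j\<in>F. z j ^ \<beta> j)" using gT T(2) unfolding monomials_def by blast
    define \<alpha> where "\<alpha> j = (if j \<in> F then \<beta> j else 0)" for j
    have supp: "S_supp \<alpha> \<subseteq> F" by (auto simp: S_supp_def \<alpha>_def split: if_splits)
    hence "finite (S_supp \<alpha>)" "S_supp \<alpha> \<subseteq> E" using F finite_subset by auto
    hence "Q_fun \<alpha> h \<in> ?Q" by blast
    moreover have "cnj (g (complex_coord F w)) = (1 / Q_const \<alpha> h) * Q_fun \<alpha> h w" for w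
      using Q_const_nonzero[OF h, of \<alpha>]
      by (simp add: Q_fun_complex_coord[OF F(1) supp] g \<alpha>_def)
    hence "(\<lambda>w. cnj (g (complex_coord F w))) = (\<lambda>w. (1 / Q_const \<alpha> h) * Q_fun \<alpha> h w)" by blast
    ultimately show ?thesis by (simp only: cspan_cmult cspan_base)
  qed
  hence "(\<lambda>w. \<Sum>g\<in>T. cnj (c g) * cnj (g (complex_coord F w))) \<in> cspan ?Q"
    by (intro cspan_sum cspan_cmult)
  thus ?thesis by (simp add: T(3))
qed

lemma cspan_Q_fun_cylindrical:
  "cspan {Q_fun \<alpha> h |\<alpha>. finite (S_supp \<alpha>) \<and> S_supp \<alpha> \<subseteq> E} \<inter> L2 M \<subseteq> cylindrical_antiholomorphic E M"
proof
  fix f assume f: "f \<in> cspan {Q_fun \<alpha> h |\<alpha>. finite (S_supp \<alpha>) \<and> S_supp \<alpha> \<subseteq> E} \<inter> L2 M"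
  then obtain T c where T: "finite T" "T \<subseteq> {Q_fun \<alpha> h |\<alpha>. finite (S_supp \<alpha>) \<and> S_supp \<alpha> \<subseteq> E}"
    "f = (\<lambda>w. \<Sum>q\<in>T. c q * q w)" by (auto simp: cspan_def)
  have "\<forall>q\<in>T. \<exists>\<alpha>. q = Q_fun \<alpha> h \<and> finite (S_supp \<alpha>) \<and> S_supp \<alpha> \<subseteq> E" using T(2) by blast
  then obtain \<alpha> where \<alpha>: "\<And>q. q \<in> T \<Longrightarrow> q = Q_fun (\<alpha> q) h"
    "\<And>q. q \<in> T \<Longrightarrow> finite (S_supp (\<alpha> q))" "\<And>q. q \<in> T \<Longrightarrow> S_supp (\<alpha> q) \<subseteq> E" by metis
  define F where "F = (\<Union>q\<in>T. S_supp (\<alpha> q))"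
  have F: "finite F" "F \<subseteq> E" using T(1) \<alpha> by (auto simp: F_def)
  define g where "g z = (\<Sum>q\<in>T. (c q * Q_const (\<alpha> q) h) * (\<Prod>j\<in>F. cnj (z j) ^ \<alpha> q j))"
    for z :: "'a \<Rightarrow> complex"
  have "antiholomorphic F g" unfolding g_def
    by (intro antiholomorphic_sum antiholomorphic_mult antiholomorphic_const antiholomorphic_prod
        antiholomorphic_power antiholomorphic_cnj_coord F(1))
  moreover have "f p = g (complex_coord F p)" for p
  proof -
    have "q p = Q_const (\<alpha> q) h * (\<Prod>j\<in>F. cnj (complex_coord F p j) ^ \<alpha> q j)" if "q \<in> T" for q
      using Q_fun_complex_coord[OF F(1), of "\<alpha> q" h p] \<alpha>(1)[OF that] that by (auto simp: F_def)
    thus ?thesis unfolding T(3) g_def by (intro sum.cong) (auto simp: mult.assoc)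
  qed
  hence "\<forall>(x, \<xi>)\<in>space M. f (x, \<xi>) = g (\<lambda>j\<in>F. Complex (x j) (\<xi> j))"
    by (simp add: complex_coord_def)
  ultimately show "f \<in> cylindrical_antiholomorphic E M"
    using f F unfolding cylindrical_antiholomorphic_def by blast
qed

text \<open>
  The complex coordinates transport the problem to finitely many Gaussian variables, where the
  conjugate of the given function is entire.
\<close>

lemma cylindrical_in_closure_cspan_Q_fun:
  assumes \<mu>: "is_gaussian_measure b E h \<mu>" and h: "h > 0" and b: "\<forall>j\<in>E. b j > 0"
  shows "cylindrical_antiholomorphic E (\<mu> \<Otimes>\<^sub>M \<mu>) \<subseteq>
    L2_closure (\<mu> \<Otimes>\<^sub>M \<mu>) (cspan {Q_fun \<alpha> h |\<alpha>. finite (S_supp \<alpha>) \<and> S_supp \<alpha> \<subseteq> E})"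
    (is "_ \<subseteq> L2_closure ?M (cspan ?Q)")
proof
  fix f assume "f \<in> cylindrical_antiholomorphic E ?M"
  then obtain F g where fL: "f \<in> L2 ?M" and F: "finite F" "F \<subseteq> E" and g: "antiholomorphic F g"
    and fg: "\<forall>(x, \<xi>)\<in>space ?M. f (x, \<xi>) = g (\<lambda>j\<in>F. Complex (x j) (\<xi> j))"
    unfolding cylindrical_antiholomorphic_def by blast
  note zm = complex_coord_measurable[OF \<mu> h b F]
  note zd = complex_coord_distr[OF \<mu> h b F]
  define u where "u z = cnj (g (restrict z F))" for z
  have u: "entire u" unfolding u_def[abs_def] by (rule entire_cnj_antiholomorphic[OF F(1) g])
  have u_dep: "depends_on F u"
    unfolding depends_on_def u_def by (metis restrict_ext)
  have um: "u \<in> borel_measurable (PiM F (\<lambda>_. borel))"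
    using u by (intro borel_measurable_depends_on[OF F(1) _ u_dep]) (simp add: entire_def)
  have f_eq: "f p = cnj (u (complex_coord F p))" if "p \<in> space ?M" for p
  proof -
    have "f p = g (complex_coord F p)" using fg that by (cases p) (auto simp: complex_coord_def)
    thus ?thesis by (simp add: u_def complex_coord_def)
  qed
  have uL: "(\<lambda>p. u (complex_coord F p)) \<in> L2 ?M"
  proof (rule L2_I)
    show "(\<lambda>p. u (complex_coord F p)) \<in> borel_measurable ?M" by (rule measurable_compose[OF zm um])
    have "integrable ?M (\<lambda>p. (cmod (f p))\<^sup>2)" by (rule L2_integrable[OF fL])
    also have "?this \<longleftrightarrow> integrable ?M (\<lambda>p. (cmod (u (complex_coord F p)))\<^sup>2)"
      by (intro Bochner_Integration.integrable_cong) (auto simp: f_eq)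
    finally show "integrable ?M (\<lambda>p. (cmod (u (complex_coord F p)))\<^sup>2)" .
  qed
  hence uG: "u \<in> L2 (gauss_prod h F)" using L2_distr_iff[OF zm um] by (simp add: zd)
  have uC: "u \<in> L2_closure (gauss_prod h F) (cspan (monomials F))"
    by (rule entire_in_closure_monomials[OF h F(1) u u_dep uG])
  show "f \<in> L2_closure ?M (cspan ?Q)"
    unfolding L2_closure_def
  proof (intro CollectI conjI allI impI fL)
    fix \<epsilon> :: real assume "\<epsilon> > 0"
    then obtain p where p: "p \<in> cspan (monomials F)" "p \<in> L2 (gauss_prod h F)"
      "L2_norm (gauss_prod h F) (\<lambda>z. u z - p z) < \<epsilon>"
      using uC unfolding L2_closure_def by blast
    have pm: "p \<in> borel_measurable (PiM F (\<lambda>_. borel))"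
      using L2_measurable[OF p(2)] measurable_cong_sets[OF sets_gauss_prod refl] by blast
    define q where "q w = cnj (p (complex_coord F w))" for w
    have qQ: "q \<in> cspan ?Q" unfolding q_def[abs_def] by (rule cspan_Q_fun_of_monomials[OF F h p(1)])
    have pL: "(\<lambda>w. p (complex_coord F w)) \<in> L2 ?M" using L2_distr_iff[OF zm pm] p(2) by (simp add: zd)
    have cnj_m: "cnj \<in> borel_measurable borel"
      by (intro borel_measurable_continuous_onI continuous_intros)
    have qL: "q \<in> L2 ?M"
    proof (rule L2_I)
      show "q \<in> borel_measurable ?M"
        unfolding q_def[abs_def] by (rule measurable_compose[OF L2_measurable[OF pL] cnj_m])
      show "integrable ?M (\<lambda>w. (cmod (q w))\<^sup>2)" using L2_integrable[OF pL] by (simp add: q_def)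
    qed
    have "(\<integral>w. (cmod (f w - q w))\<^sup>2 \<partial>?M) =
        (\<integral>w. (cmod (u (complex_coord F w) - p (complex_coord F w)))\<^sup>2 \<partial>?M)"
    proof (rule Bochner_Integration.integral_cong[OF refl])
      fix w assume "w \<in> space ?M"
      hence "f w - q w = cnj (u (complex_coord F w) - p (complex_coord F w))"
        by (simp add: f_eq q_def)
      thus "(cmod (f w - q w))\<^sup>2 = (cmod (u (complex_coord F w) - p (complex_coord F w)))\<^sup>2"
        by (simp only: complex_mod_cnj)
    qed
    hence "L2_norm ?M (\<lambda>w. f w - q w) =
        L2_norm ?M (\<lambda>w. u (complex_coord F w) - p (complex_coord F w))"
      by (simp add: L2_norm_def)
    also have "\<dots> = L2_norm (gauss_prod h F) (\<lambda>z. u z - p z)"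
      using L2_norm_distr[OF zm borel_measurable_diff[OF um pm]] by (simp add: zd)
    also have "\<dots> < \<epsilon>" by (rule p(3))
    finally show "\<exists>q\<in>cspan ?Q \<inter> L2 ?M. L2_norm ?M (\<lambda>w. f w - q w) < \<epsilon>" using qQ qL by blast
  qed
qed

lemma SB_antiholomorphic_eq_SB_polynomial:
  assumes "is_gaussian_measure b E h \<mu>" "h > 0" "\<forall>j\<in>E. b j > 0"
  shows "SB_antiholomorphic E (\<mu> \<Otimes>\<^sub>M \<mu>) = SB_polynomial E h (\<mu> \<Otimes>\<^sub>M \<mu>)"
  unfolding SB_antiholomorphic_def SB_polynomial_def
proof (intro equalityI L2_closure_mono_closure)
  show "cylindrical_antiholomorphic E (\<mu> \<Otimes>\<^sub>M \<mu>) \<inter> L2 (\<mu> \<Otimes>\<^sub>M \<mu>) \<subseteq> L2_closure (\<mu> \<Otimes>\<^sub>M \<mu>)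
      (cspan {Q_fun \<alpha> h |\<alpha>. finite (S_supp \<alpha>) \<and> S_supp \<alpha> \<subseteq> E})"
    using cylindrical_in_closure_cspan_Q_fun[OF assms] by blast
  show "cspan {Q_fun \<alpha> h |\<alpha>. finite (S_supp \<alpha>) \<and> S_supp \<alpha> \<subseteq> E} \<inter> L2 (\<mu> \<Otimes>\<^sub>M \<mu>) \<subseteq>
      L2_closure (\<mu> \<Otimes>\<^sub>M \<mu>) (cylindrical_antiholomorphic E (\<mu> \<Otimes>\<^sub>M \<mu>))"
    using cspan_Q_fun_cylindrical subset_L2_closure by fast
qed


section \<open>The Segal isomorphisms on products of unit vectors\<close>

lemma gaussian_coordinate_L2:
  assumes \<mu>: "is_gaussian_measure b E t \<mu>" and t: "t > 0" and b: "\<forall>j\<in>E. b j > 0" and j: "j \<in> E"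
  shows "(\<lambda>x. c * complex_of_real (x j)) \<in> L2 \<mu>"
proof (rule L2_cmult)
  note coord = gaussian_measure_coordinate_measurable[OF \<mu> t b j]
  have m: "complex_of_real \<in> borel_measurable borel" by measurable
  have "complex_of_real \<in> L2 (gauss1 t)"
    using nn_integral_gauss1_even_moment[OF t, of 1] by (simp add: L2_iff_nn_integral norm_of_real)
  thus "(\<lambda>x. complex_of_real (x j)) \<in> L2 \<mu>"
    using L2_distr_iff[OF coord m] by (simp add: gaussian_measure_coordinate_distr[OF \<mu> t b j])
qed

text \<open>
  For a multiple of a unit vector the defining sums are eventually constant along every exhaustion,
  and the countability of \<open>E\<close> provides one.
\<close>

lemma ell_unit_vec:
  assumes \<mu>: "is_gaussian_measure b E t \<mu>" and t: "t > 0" and b: "\<forall>j\<in>E. b j > 0"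
    and j: "j \<in> E" and E: "countable E"
  shows "AE x in \<mu>. ell E \<mu> (\<lambda>i. c * unit_vec j i) x = c * complex_of_real (x j)"
proof -
  define S where "S F x = (\<Sum>i\<in>F. c * unit_vec j i * complex_of_real (x i))"
    for F and x :: "'a \<Rightarrow> real"
  define f0 where "f0 x = c * complex_of_real (x j)" for x :: "'a \<Rightarrow> real"
  define exh where "exh F \<longleftrightarrow> incseq F \<and> (\<forall>n. finite (F n)) \<and> (\<Union>n. F n) = E" for F :: "nat \<Rightarrow> 'a set"
  define P where "P f \<longleftrightarrow> f \<in> L2 \<mu> \<and> (\<forall>F. exh F \<longrightarrow> (\<lambda>n. L2_norm \<mu> (\<lambda>x. f x - S (F n) x)) \<longlonglongrightarrow> 0)" for f
  have S: "S F = f0" if "finite F" "j \<in> F" for F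
  proof
    fix x
    have "S F x = (\<Sum>i\<in>F. if i = j then f0 x else 0)"
      unfolding S_def by (intro sum.cong) (auto simp: unit_vec_def f0_def)
    thus "S F x = f0 x" using that by simp
  qed
  have ev: "eventually (\<lambda>n. S (F n) = f0) sequentially" if F: "exh F" for F
  proof -
    obtain N where N: "j \<in> F N" using F j unfolding exh_def by blast
    have "S (F n) = f0" if "n \<ge> N" for n
      using F N incseqD[of F N n] that unfolding exh_def by (intro S) auto
    thus ?thesis unfolding eventually_sequentially by blast
  qed
  have f0L: "f0 \<in> L2 \<mu>" unfolding f0_def[abs_def] by (rule gaussian_coordinate_L2[OF \<mu> t b j])
  have "P f0" unfolding P_def
  proof (intro conjI f0L allI impI)
    fix F assume "exh F"
    have "eventually (\<lambda>n. L2_norm \<mu> (\<lambda>x. f0 x - S (F n) x) = 0) sequentially"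
      using ev[OF \<open>exh F\<close>] by eventually_elim (simp add: L2_norm_def)
    thus "(\<lambda>n. L2_norm \<mu> (\<lambda>x. f0 x - S (F n) x)) \<longlonglongrightarrow> 0"
      by (rule tendsto_eventually)
  qed
  moreover have "ell E \<mu> (\<lambda>i. c * unit_vec j i) = (SOME f. P f)"
    unfolding ell_def P_def exh_def S_def ..
  ultimately have P: "P (ell E \<mu> (\<lambda>i. c * unit_vec j i))" by (metis someI)
  define f where "f = ell E \<mu> (\<lambda>i. c * unit_vec j i)"
  have fL: "f \<in> L2 \<mu>" using P by (simp add: P_def f_def)
  define F where "F n = from_nat_into E ` {..n}" for n
  have F: "exh F" unfolding exh_def
  proof (intro conjI allI)
    show "incseq F" by (auto simp: F_def incseq_def)
    show "finite (F n)" for n by (simp add: F_def)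
    have "(\<Union>n. F n) = range (from_nat_into E)" by (auto simp: F_def)
    thus "(\<Union>n. F n) = E" using range_from_nat_into[OF _ E] j by auto
  qed
  have "(\<lambda>n. L2_norm \<mu> (\<lambda>x. f x - S (F n) x)) \<longlonglongrightarrow> 0" using P F by (simp add: P_def f_def)
  moreover have "(\<lambda>n. L2_norm \<mu> (\<lambda>x. f x - S (F n) x)) \<longlonglongrightarrow> L2_norm \<mu> (\<lambda>x. f x - f0 x)"
  proof (rule tendsto_eventually)
    show "eventually (\<lambda>n. L2_norm \<mu> (\<lambda>x. f x - S (F n) x) = L2_norm \<mu> (\<lambda>x. f x - f0 x)) sequentially"
      using ev[OF F] by eventually_elim simp
  qed
  ultimately have "L2_norm \<mu> (\<lambda>x. f x - f0 x) = 0" using LIMSEQ_unique by blast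
  hence "AE x in \<mu>. f x - f0 x = 0" by (subst (asm) L2_norm_eq_0_iff) (rule L2_diff[OF fL f0L])
  thus ?thesis by (simp add: f_def f0_def)
qed

lemma is_segal_iso_imp_fock_isometry:
  assumes "is_segal_iso M X c l J"
  shows "fock_isometry M X J"
  using assms unfolding is_segal_iso_def fock_isometry_def by simp

lemma T_map_unit_vec_ell2: "j \<in> E \<Longrightarrow> T_map (unit_vec j) \<in> ell2 (E <+> E)"
proof -
  assume j: "j \<in> E"
  have "(\<lambda>i. (cmod (T_map (unit_vec j) i))\<^sup>2) summable_on {Inl j, Inr j}" by simp
  also have "?this \<longleftrightarrow> (\<lambda>i. (cmod (T_map (unit_vec j) i))\<^sup>2) summable_on (E <+> E)"
    by (rule summable_on_cong_neutral) (use j in \<open>auto simp: T_map_def unit_vec_def split: sum.splits\<close>)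
  finally show ?thesis using j by (auto simp: ell2_def T_map_def unit_vec_def split: sum.splits)
qed

lemma sym_prod_Nil: "sym_prod [] = vacuum"
proof
  fix xs show "sym_prod [] xs = vacuum xs"
    by (simp add: sym_prod_def tensor_def vacuum_def permutes_empty)
qed

text \<open>
  By the Pythagorean theorem an orthogonal projection that does not decrease the norm does not move
  the element.
\<close>

lemma is_proj_compl_norm_eq:
  assumes proj: "is_proj_compl M (L2_closure M V) (L2_closure M V') f g"
    and norm: "L2_norm M f \<le> L2_norm M g"
  shows "AE w in M. f w = g w"
proof -
  define d where "d w = f w - g w" for w
  have L: "f \<in> L2 M" "g \<in> L2 M" "d \<in> L2 M"
    using proj L2_closure_subset unfolding is_proj_compl_def d_def[abs_def] by blast+
  have orth: "(\<integral>w. g w * cnj (d w) \<partial>M) = 0"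
    using proj unfolding is_proj_compl_def L2_inner_def by (auto simp: d_def)
  note [measurable] = L[THEN L2_measurable]
  have i: "integrable M (\<lambda>w. g w * cnj (d w))"
  proof (rule Bochner_Integration.integrable_bound)
    show "integrable M (\<lambda>w. (cmod (g w))\<^sup>2 + (cmod (d w))\<^sup>2)"
      using L by (auto intro!: Bochner_Integration.integrable_add L2_integrable)
    have [measurable]: "cnj \<in> borel_measurable borel"
      by (intro borel_measurable_continuous_onI continuous_intros)
    show "(\<lambda>w. g w * cnj (d w)) \<in> borel_measurable M" by measurable
    have "x * y \<le> x\<^sup>2 + y\<^sup>2" for x y :: real
    proof -
      have "x * y \<le> \<bar>x * y\<bar>" by simp
      also have "2 * \<bar>x * y\<bar> \<le> x\<^sup>2 + y\<^sup>2"
        using sum_squares_bound[of "\<bar>x\<bar>" "\<bar>y\<bar>"] by (simp add: abs_mult)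
      hence "\<bar>x * y\<bar> \<le> x\<^sup>2 + y\<^sup>2" using abs_ge_zero[of "x * y"] by linarith
      finally show ?thesis .
    qed
    thus "AE w in M. norm (g w * cnj (d w)) \<le> norm ((cmod (g w))\<^sup>2 + (cmod (d w))\<^sup>2)"
      by (intro AE_I2) (simp add: norm_mult)
  qed
  have "(L2_norm M f)\<^sup>2 = (\<integral>w. (cmod (g w))\<^sup>2 + (cmod (d w))\<^sup>2 + 2 * Re (g w * cnj (d w)) \<partial>M)"
    unfolding L2_norm_power2
  proof (rule Bochner_Integration.integral_cong[OF refl])
    fix w
    have "f w = g w + d w" by (simp add: d_def)
    thus "(cmod (f w))\<^sup>2 = (cmod (g w))\<^sup>2 + (cmod (d w))\<^sup>2 + 2 * Re (g w * cnj (d w))"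
      by (simp add: cmod_power2 power2_sum algebra_simps)
  qed
  also have "\<dots> = (L2_norm M g)\<^sup>2 + (L2_norm M d)\<^sup>2 + 2 * (\<integral>w. Re (g w * cnj (d w)) \<partial>M)"
    unfolding L2_norm_power2 using L integrable_Re[OF i] by (simp add: L2_integrable del: times_complex.sel)
  also have "(\<integral>w. Re (g w * cnj (d w)) \<partial>M) = Re (\<integral>w. g w * cnj (d w) \<partial>M)"
    by (rule integral_Re[OF i])
  finally have "(L2_norm M f)\<^sup>2 = (L2_norm M g)\<^sup>2 + (L2_norm M d)\<^sup>2" by (simp add: orth)
  moreover have "(L2_norm M f)\<^sup>2 \<le> (L2_norm M g)\<^sup>2" using norm by (intro power_mono) auto
  ultimately have "(L2_norm M d)\<^sup>2 \<le> 0" by linarith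
  hence "L2_norm M d = 0" by simp
  hence "AE w in M. d w = 0" using L2_norm_eq_0_iff[OF L(3)] by simp
  thus ?thesis by (simp add: d_def)
qed


lemma (in prob_space) distr_pair_snd:
  assumes "sigma_finite_measure N"
  shows "distr (M \<Otimes>\<^sub>M N) N snd = N"
proof (rule measure_eqI)
  interpret N: sigma_finite_measure N by fact
  fix A assume "A \<in> sets (distr (M \<Otimes>\<^sub>M N) N snd)"
  hence A: "A \<in> sets N" by simp
  hence "snd -` A \<inter> space (M \<Otimes>\<^sub>M N) = space M \<times> A"
    using sets.sets_into_space[OF A] by (auto simp: space_pair_measure)
  with A show "emeasure (distr (M \<Otimes>\<^sub>M N) N snd) A = emeasure N A"
    by (simp add: emeasure_distr N.emeasure_pair_measure_Times emeasure_space_1)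
qed simp

lemma segal_iso_Phi_T_map_unit_vec:
  assumes \<mu>: "is_gaussian_measure b E h \<mu>" and h: "h > 0" and b: "\<forall>j\<in>E. b j > 0"
    and E: "countable E" and J: "is_segal_iso_Phi E h \<mu> J" and j: "j \<in> E"
  shows "AE p in \<mu> \<Otimes>\<^sub>M \<mu>. J (sym_prod [T_map (unit_vec j)]) p =
    complex_of_real ((2 * h) powr (- 1 / 2)) * (complex_of_real (fst p j) - \<i> * complex_of_real (snd p j))"
proof -
  interpret \<mu>: prob_space \<mu> using \<mu> by (simp add: is_gaussian_measure_def)
  define r where "r = complex_of_real (1 / sqrt 2)"
  have Inl: "(\<lambda>i. T_map (unit_vec j) (Inl i)) = (\<lambda>i. r * unit_vec j i)"
    by (simp add: T_map_def r_def)
  have Inr: "(\<lambda>i. T_map (unit_vec j) (Inr i)) = (\<lambda>i. (- \<i> * r) * unit_vec j i)"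
    by (simp add: T_map_def r_def)
  have "AE x in distr (\<mu> \<Otimes>\<^sub>M \<mu>) \<mu> fst. ell E \<mu> (\<lambda>i. r * unit_vec j i) x = r * complex_of_real (x j)"
    unfolding \<mu>.distr_pair_fst by (rule ell_unit_vec[OF \<mu> h b j E])
  hence 1: "AE p in \<mu> \<Otimes>\<^sub>M \<mu>. ell E \<mu> (\<lambda>i. r * unit_vec j i) (fst p) = r * complex_of_real (fst p j)"
    by (rule AE_distrD[rotated]) simp
  have "AE x in distr (\<mu> \<Otimes>\<^sub>M \<mu>) \<mu> snd. ell E \<mu> (\<lambda>i. (- \<i> * r) * unit_vec j i) x =
      (- \<i> * r) * complex_of_real (x j)"
    unfolding \<mu>.distr_pair_snd[OF \<mu>.sigma_finite_measure_axioms]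
    by (rule ell_unit_vec[OF \<mu> h b j E])
  hence 2: "AE p in \<mu> \<Otimes>\<^sub>M \<mu>. ell E \<mu> (\<lambda>i. (- \<i> * r) * unit_vec j i) (snd p) =
      (- \<i> * r) * complex_of_real (snd p j)"
    by (rule AE_distrD[rotated]) simp
  have 3: "AE p in \<mu> \<Otimes>\<^sub>M \<mu>. J (sym_prod [T_map (unit_vec j)]) p =
      complex_of_real (h powr (- 1 / 2)) * ell_pair E \<mu> (T_map (unit_vec j)) p"
    using J T_map_unit_vec_ell2[OF j] unfolding is_segal_iso_Phi_def is_segal_iso_def by blast
  have c: "complex_of_real (h powr (- 1 / 2)) * r = complex_of_real ((2 * h) powr (- 1 / 2))"
    using h by (simp add: r_def powr_mult powr_minus_divide powr_half_sqrt)
  from 1 2 3 show ?thesis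
  proof eventually_elim
    case (elim p)
    have "J (sym_prod [T_map (unit_vec j)]) p = complex_of_real (h powr (- 1 / 2)) *
        (r * complex_of_real (fst p j) + (- \<i> * r) * complex_of_real (snd p j))"
      unfolding elim(3) ell_pair_def case_prod_beta Inl Inr elim(1,2) ..
    also have "\<dots> = (complex_of_real (h powr (- 1 / 2)) * r) *
        (complex_of_real (fst p j) - \<i> * complex_of_real (snd p j))"
      by (simp add: algebra_simps)
    finally show ?case unfolding c .
  qed
qed

text \<open>
  The image under \<open>J\<^sub>\<Phi>\<close> of a symmetric product is the projection of the product of the images.
  Products of factors \<open>x\<^sub>j - \<i> \<xi>\<^sub>j\<close> are not changed by it: isometry of \<open>J\<^sub>\<Phi>\<close> and \<open>W\<close> gives the
  projection the norm of a symmetric product of unit vectors, and both this norm and the norm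
  of \<open>Q\<^sub>\<alpha>\<close> have the square \<open>\<alpha>!\<close>.
\<close>

lemma segal_iso_Phi_segal_bargmann_unit_vecs:
  assumes \<mu>: "is_gaussian_measure b E h \<mu>" and h: "h > 0" and b: "\<forall>j\<in>E. b j > 0"
    and E: "countable E" and J: "is_segal_iso_Phi E h \<mu> J" and W: "is_segal_bargmann E W"
    and xs: "set xs \<subseteq> E"
  shows "AE p in \<mu> \<Otimes>\<^sub>M \<mu>. J (W (sym_prod (map unit_vec xs))) p = Q_fun (count (mset xs)) h p"
proof (cases "xs = []")
  case True
  have "W vacuum = vacuum" using W unfolding is_segal_bargmann_def by blast
  moreover have "AE p in \<mu> \<Otimes>\<^sub>M \<mu>. J vacuum p = 1"
    using J unfolding is_segal_iso_Phi_def is_segal_iso_def by blast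
  moreover have "Q_fun (count (mset xs)) h p = 1" for p
    using Q_fun_list[OF h, of xs p] True by simp
  ultimately show ?thesis using True by (simp only: sym_prod_Nil list.map)
next
  case False
  define us where "us = map T_map (map unit_vec xs)"
  let ?M = "\<mu> \<Otimes>\<^sub>M \<mu>"
  let ?A = "ell_pair E \<mu> ` ell2 (E <+> E)"
  define f where "f p = (\<Prod>i<length us. J (sym_prod [us ! i]) p)" for p
  have us: "us \<noteq> []" "set us \<subseteq> ell2 (E <+> E)"
    using False xs by (auto simp: us_def intro!: T_map_unit_vec_ell2)
  have proj: "is_proj_compl ?M (L2_closure ?M (poly_space ?A (length us)))
      (L2_closure ?M (poly_space ?A (length us - 1))) f (J (sym_prod us))"
    using J us unfolding is_segal_iso_Phi_def is_segal_iso_def f_def[abs_def] by blast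
  have fL: "f \<in> L2 ?M" using proj L2_closure_subset unfolding is_proj_compl_def by blast
  have "set (map unit_vec xs) \<subseteq> ell2 E" using xs by (auto intro!: unit_vec_ell2)
  hence Wus: "W (sym_prod (map unit_vec xs)) = sym_prod us"
    using W False unfolding is_segal_bargmann_def us_def by blast
  have "AE p in ?M. \<forall>i\<in>{..<length us}. J (sym_prod [us ! i]) p =
      complex_of_real ((2 * h) powr (- 1 / 2)) *
      (complex_of_real (fst p (xs ! i)) - \<i> * complex_of_real (snd p (xs ! i)))"
  proof (subst AE_finite_all, simp, rule ballI)
    fix i assume i: "i \<in> {..<length us}"
    hence "xs ! i \<in> E" using xs by (auto simp: us_def)
    moreover have "us ! i = T_map (unit_vec (xs ! i))" using i by (simp add: us_def)
    ultimately show "AE p in ?M. J (sym_prod [us ! i]) p =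
      complex_of_real ((2 * h) powr (- 1 / 2)) *
      (complex_of_real (fst p (xs ! i)) - \<i> * complex_of_real (snd p (xs ! i)))"
      using segal_iso_Phi_T_map_unit_vec[OF \<mu> h b E J] by simp
  qed
  hence fQ: "AE p in ?M. f p = Q_fun (count (mset xs)) h p"
  proof eventually_elim
    case (elim p)
    have "f p = (\<Prod>i<length us. complex_of_real ((2 * h) powr (- 1 / 2)) *
      (complex_of_real (fst p (xs ! i)) - \<i> * complex_of_real (snd p (xs ! i))))"
      unfolding f_def using elim by (intro prod.cong) auto
    thus ?case by (simp add: Q_fun_list[OF h] us_def)
  qed
  have fock: "sym_prod (map unit_vec xs) \<in> fock E" by (rule sym_prod_unit_vecs_fock[OF xs])
  have "L2_norm ?M (J (sym_prod us)) = ell2_norm (sym_prod us)"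
    using J W fock unfolding is_segal_iso_Phi_def is_segal_iso_def is_segal_bargmann_def
    by (metis Wus)
  also have "\<dots> = ell2_norm (sym_prod (map unit_vec xs))"
    using W fock unfolding is_segal_bargmann_def Wus[symmetric] by blast
  finally have "(L2_norm ?M (J (sym_prod us)))\<^sup>2 = (\<Prod>x\<in>set xs. fact (count (mset xs) x))"
    by (simp add: norm_sym_prod_unit_vecs)
  moreover have "L2_norm ?M f = L2_norm ?M (Q_fun (count (mset xs)) h)"
    by (intro L2_norm_cong_AE L2_measurable fL Q_fun_L2[OF \<mu> h b xs] fQ)
  ultimately have "(L2_norm ?M f)\<^sup>2 = (L2_norm ?M (J (sym_prod us)))\<^sup>2"
    by (simp add: Q_fun_norm[OF \<mu> h b xs])
  hence "L2_norm ?M f \<le> L2_norm ?M (J (sym_prod us))"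
    by (intro power2_le_imp_le[of "L2_norm ?M f"]) auto
  hence "AE p in ?M. f p = J (sym_prod us) p" by (rule is_proj_compl_norm_eq[OF proj])
  with fQ show ?thesis unfolding Wus by eventually_elim simp
qed

lemma fock_isometry_segal_bargmann:
  assumes "is_segal_iso_Phi E h \<mu> J" "is_segal_bargmann E W"
  shows "fock_isometry (\<mu> \<Otimes>\<^sub>M \<mu>) E (J \<circ> W)"
proof -
  have J: "fock_isometry (\<mu> \<Otimes>\<^sub>M \<mu>) (E <+> E) J"
    using assms(1) unfolding is_segal_iso_Phi_def by (rule is_segal_iso_imp_fock_isometry)
  have W: "W F \<in> fock (E <+> E)" "ell2_norm (W F) = ell2_norm F"
    "W (\<lambda>xs. z * F xs) = (\<lambda>ys. z * W F ys)" if "F \<in> fock E" for F z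
    using assms(2) that unfolding is_segal_bargmann_def by blast+
  have Wadd: "W (\<lambda>xs. F xs + G xs) = (\<lambda>ys. W F ys + W G ys)" if "F \<in> fock E" "G \<in> fock E" for F G
    using assms(2) that unfolding is_segal_bargmann_def by blast
  show ?thesis unfolding fock_isometry_def comp_def
    by (auto simp: W Wadd intro: fock_isometry_L2[OF J] fock_isometry_add[OF J]
        fock_isometry_cmult[OF J] fock_isometry_norm[OF J W(1), THEN trans])
qed

lemma L2_range_theta:
  assumes "is_segal_iso_K E h \<mu>K JK"
  shows "L2_range M (theta E \<mu>K JK W J) (L2 \<mu>K) = L2_range M (J \<circ> W) (fock E)"
proof -
  have iso: "fock_isometry \<mu>K E JK"
    using assms unfolding is_segal_iso_K_def by (rule is_segal_iso_imp_fock_isometry)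
  have surj: "\<exists>F\<in>fock E. AE x in \<mu>K. JK F x = g x" if "g \<in> L2 \<mu>K" for g
    using assms that unfolding is_segal_iso_K_def is_segal_iso_def by blast
  have theta: "theta E \<mu>K JK W J g = (J \<circ> W) F" if F: "F \<in> fock E" "AE x in \<mu>K. JK F x = g x" for F g
  proof -
    have "(THE F. F \<in> fock E \<and> (AE x in \<mu>K. JK F x = g x)) = F"
    proof (rule the_equality)
      fix G assume G: "G \<in> fock E \<and> (AE x in \<mu>K. JK G x = g x)"
      from conjunct2[OF G] F(2) have "AE x in \<mu>K. JK G x = JK F x" by eventually_elim simp
      thus "G = F" using fock_isometry_inject[OF iso] G F(1) by blast
    qed (use F in simp)
    thus ?thesis by (simp add: theta_def)
  qed
  show ?thesis
  proof (intro equalityI subsetI)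
    fix f assume "f \<in> L2_range M (theta E \<mu>K JK W J) (L2 \<mu>K)"
    then obtain g where g: "g \<in> L2 \<mu>K" "AE w in M. f w = theta E \<mu>K JK W J g w" and fL: "f \<in> L2 M"
      unfolding L2_range_def by blast
    obtain F where F: "F \<in> fock E" "AE x in \<mu>K. JK F x = g x" using surj[OF g(1)] by blast
    show "f \<in> L2_range M (J \<circ> W) (fock E)"
      using g(2) F(1) fL unfolding theta[OF F] L2_range_def by blast
  next
    fix f assume "f \<in> L2_range M (J \<circ> W) (fock E)"
    then obtain F where F: "F \<in> fock E" "AE w in M. f w = (J \<circ> W) F w" and fL: "f \<in> L2 M"
      unfolding L2_range_def by blast
    have "theta E \<mu>K JK W J (JK F) = (J \<circ> W) F" by (rule theta[OF F(1)]) simp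
    moreover have "JK F \<in> L2 \<mu>K" by (rule fock_isometry_L2[OF iso F(1)])
    ultimately show "f \<in> L2_range M (theta E \<mu>K JK W J) (L2 \<mu>K)"
      using F(2) fL unfolding L2_range_def by force
  qed
qed


section \<open>The Segal--Bargmann space\<close>

theorem theorem4p4:
  fixes \<Gamma> E :: "'g set" and b :: "'g \<Rightarrow> real" and h :: real
    and \<mu>K \<mu> :: "('g \<Rightarrow> real) measure"
    and JK :: "('g list \<Rightarrow> complex) \<Rightarrow> ('g \<Rightarrow> real) \<Rightarrow> complex"
    and J\<Phi> :: "(('g + 'g) list \<Rightarrow> complex) \<Rightarrow> ('g \<Rightarrow> real) \<times> ('g \<Rightarrow> real) \<Rightarrow> complex"
    and W :: "('g list \<Rightarrow> complex) \<Rightarrow> ('g + 'g) list \<Rightarrow> complex"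
  defines "\<mu>\<Phi> \<equiv> \<mu> \<Otimes>\<^sub>M \<mu>"
  assumes "countable \<Gamma>"
    and "\<And>j. j \<in> \<Gamma> \<Longrightarrow> b j > 0"
    and "\<And>\<epsilon>. \<epsilon> > 0 \<Longrightarrow>
           (\<lambda>j. LINT x:{\<epsilon> * b j..}|lborel. exp (- x\<^sup>2 / 2) :: real) summable_on \<Gamma>"
    and "E \<subseteq> \<Gamma>" and "infinite E" and "h > 0"
    and "is_gaussian_measure b E (h / 2) \<mu>K"
    and "is_gaussian_measure b E h \<mu>"
    and "is_segal_iso_K E h \<mu>K JK"
    and "is_segal_iso_Phi E h \<mu> J\<Phi>"
    and "is_segal_bargmann E W"
  shows "L2_closed_subspace \<mu>\<Phi> (SB_antiholomorphic E \<mu>\<Phi>) \<and>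
         SB_antiholomorphic E \<mu>\<Phi> = SB_polynomial E h \<mu>\<Phi> \<and>
         SB_antiholomorphic E \<mu>\<Phi> = L2_range \<mu>\<Phi> (J\<Phi> \<circ> W) (fock E) \<and>
         SB_antiholomorphic E \<mu>\<Phi> = L2_range \<mu>\<Phi> (theta E \<mu>K JK W J\<Phi>) (L2 \<mu>K)"
proof -
  have b: "\<forall>j\<in>E. b j > 0" using assms by blast
  have E: "countable E" using assms countable_subset by blast
  note \<mu> = \<open>is_gaussian_measure b E h \<mu>\<close> and h = \<open>h > 0\<close>
  note J = \<open>is_segal_iso_Phi E h \<mu> J\<Phi>\<close> and W = \<open>is_segal_bargmann E W\<close>
  have 1: "SB_antiholomorphic E \<mu>\<Phi> = SB_polynomial E h \<mu>\<Phi>"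
    unfolding \<mu>\<Phi>_def by (rule SB_antiholomorphic_eq_SB_polynomial[OF \<mu> h b])
  have 2: "L2_range \<mu>\<Phi> (J\<Phi> \<circ> W) (fock E) = SB_polynomial E h \<mu>\<Phi>"
    unfolding SB_polynomial_def \<mu>\<Phi>_def
  proof (rule L2_range_fock_isometry[where q = "\<lambda>xs. Q_fun (count (mset xs)) h"])
    show "fock_isometry (\<mu> \<Otimes>\<^sub>M \<mu>) E (J\<Phi> \<circ> W)" by (rule fock_isometry_segal_bargmann[OF J W])
    show "{Q_fun \<alpha> h |\<alpha>. finite (S_supp \<alpha>) \<and> S_supp \<alpha> \<subseteq> E} =
        {Q_fun (count (mset xs)) h |xs. set xs \<subseteq> E}"
      by (rule multi_indices_eq_counts)
    show "Q_fun (count (mset xs)) h \<in> L2 (\<mu> \<Otimes>\<^sub>M \<mu>)" if "set xs \<subseteq> E" for xs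
      by (rule Q_fun_L2[OF \<mu> h b that])
    show "AE w in \<mu> \<Otimes>\<^sub>M \<mu>. (J\<Phi> \<circ> W) (sym_prod (map unit_vec xs)) w = Q_fun (count (mset xs)) h w"
      if "set xs \<subseteq> E" for xs
      using segal_iso_Phi_segal_bargmann_unit_vecs[OF \<mu> h b E J W that] by simp
  qed
  have 3: "L2_range \<mu>\<Phi> (theta E \<mu>K JK W J\<Phi>) (L2 \<mu>K) = L2_range \<mu>\<Phi> (J\<Phi> \<circ> W) (fock E)"
    by (rule L2_range_theta) fact
  have 4: "L2_closed_subspace \<mu>\<Phi> (SB_polynomial E h \<mu>\<Phi>)"
    unfolding SB_polynomial_def by (rule L2_closed_subspace_closure_cspan)
  from 1 2 3 4 show ?thesis by simp
qed

end
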